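(* Let $G$ be a finitely generated group and $H$ a finitely generated subgroup of $G$ with $e(G,H)>1$. Suppose that $e(G,K)=1$ for every subgroup $K$ of $G$ commensurable with a subgroup of infinite index in $H$, and that $X$ is a non-trivial $H$-almost invariant subset of $G$ such that $si(H\backslash X,H\backslash X)=0$. Then $G$ splits over a subgroup commensurable with $H$.
   Context: $e(G,H)$ is the number of ends of the quotient graph $H\backslash\Gamma$, where $\Gamma$ is the Cayley graph of $G$ (with left $G$-action) for a finite generating set. Two subgroups are commensurable if their intersection has finite index in both. $G$ splits over a subgroup $L$ if $G$ is isomorphic to an HNN extension $A*_L$ or to an amalgamated free product $A*_LB$ with $A\neq L\neq B$ (with $L$ the given subgroup of $G$). Two sets are almost equal if their symmetric difference is finite. $G$ acts on the right on the set $H\backslash G$ of cosets $Hg$; $P\subset H\backslash G$ is almost invariant if $Pg$ is almost equal to $P$ for all $g\in G$. For $X\subset G$ write $X^*=G-X$. $X$ is $H$-almost invariant if $hX=X$ for all $h\in H$ and the image $H\backslash X$ of $X$ in $H\backslash G$ is almost invariant; it is non-trivial if $H\backslash X$ and $H\backslash X^*$ are both infinite. For $X\subset G$ (the vertex set of $\Gamma$), $\delta X$ is the set of edges of $\Gamma$ with exactly one endpoint in $X$; $\delta X$ is also regarded as the set of all endpoints of these edges, a subset of $G$. For $g\in G$, $gX$ crosses $X$ strongly if both $\delta(gX)\cap X$ and $\delta(gX)\cap X^*$ project to infinite sets in $H\backslash G$. The strong self-intersection number $si(H\backslash X,H\backslash X)$ is the number of double cosets $HgH$ such that $gX$ crosses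 $X$ strongly (independent of the finite generating set used to define $\Gamma$). *)

theory Defs
  imports
    "HOL-Algebra.Coset"
    "HOL-Algebra.Generated_Groups"
    "HOL-Library.Extended_Nat"
    "Graph_Theory.Digraph_Component"
begin

section \<open>Cayley graphs, their quotients, and ends\<close>

text \<open>Arcs only record a choice of orientation for each edge; every notion below that refers to
  a graph is insensitive to this choice. The group acts on the left by
  \<open>h(g, s) = (hg, s)\<close>.\<close>

definition cayley_graph :: "('a, 'm) monoid_scheme \<Rightarrow> 'a set \<Rightarrow> ('a, 'a \<times> 'a) pre_digraph" where
  "cayley_graph G S =
     \<lparr>verts = carrier G, arcs = carrier G \<times> S, tail = fst, head = (\<lambda>(g, s). g \<otimes>\<^bsub>G\<^esub> s)\<rparr>"

text \<open>The quotient \<open>H \ \<Gamma>\<close>. The \<open>H\<close>-orbit \<open>Hg \<times> {s}\<close> of the edge \<open>(g, s)\<close> is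
  encoded as the pair \<open>(Hg, s)\<close>.\<close>

definition quotient_cayley_graph ::
  "('a, 'm) monoid_scheme \<Rightarrow> 'a set \<Rightarrow> 'a set \<Rightarrow> ('a set, 'a set \<times> 'a) pre_digraph" where
  "quotient_cayley_graph G S H =
     \<lparr>verts = rcosets\<^bsub>G\<^esub> H, arcs = (rcosets\<^bsub>G\<^esub> H) \<times> S, tail = fst,
      head = (\<lambda>(C, s). C #>\<^bsub>G\<^esub> s)\<rparr>"

text \<open>Connected components are those of the underlying undirected graph, i.e. the strong
  components of the symmetric closure.\<close>

definition graph_components :: "('v, 'e) pre_digraph \<Rightarrow> 'v set set" where
  "graph_components \<Gamma> = pre_digraph.sccs_verts (with_proj (mk_symmetric \<Gamma>))"

definition ecard :: "'a set \<Rightarrow> enat" where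
  "ecard A = (if finite A then enat (card A) else \<infinity>)"

definition num_ends :: "('v, 'e) pre_digraph \<Rightarrow> enat" where
  "num_ends \<Gamma> =
     (SUP F \<in> {F. finite F \<and> F \<subseteq> verts \<Gamma>}.
        ecard {C \<in> graph_components (induce_subgraph \<Gamma> (verts \<Gamma> - F)). infinite C})"

definition ends_of_pair :: "('a, 'm) monoid_scheme \<Rightarrow> 'a set \<Rightarrow> 'a set \<Rightarrow> enat" where
  "ends_of_pair G S H = num_ends (quotient_cayley_graph G S H)"


section \<open>Finite generation, index, commensurability\<close>

definition fin_gen_subgroup :: "('a, 'm) monoid_scheme \<Rightarrow> 'a set \<Rightarrow> bool" where
  "fin_gen_subgroup G H \<longleftrightarrow> (\<exists>T. finite T \<and> T \<subseteq> carrier G \<and> H = generate G T)"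

text \<open>Meaningful for subgroups \<open>K \<subseteq> H\<close>.\<close>

definition finite_index :: "('a, 'm) monoid_scheme \<Rightarrow> 'a set \<Rightarrow> 'a set \<Rightarrow> bool" where
  "finite_index G K H \<longleftrightarrow> finite (rcosets\<^bsub>G\<lparr>carrier := H\<rparr>\<^esub> K)"

definition commensurable :: "('a, 'm) monoid_scheme \<Rightarrow> 'a set \<Rightarrow> 'a set \<Rightarrow> bool" where
  "commensurable G H K \<longleftrightarrow> finite_index G (H \<inter> K) H \<and> finite_index G (H \<inter> K) K"


section \<open>Almost invariant sets and strong crossing\<close>

definition almost_equal :: "'b set \<Rightarrow> 'b set \<Rightarrow> bool" where
  "almost_equal P Q \<longleftrightarrow> finite ((P - Q) \<union> (Q - P))"

definition almost_invariant ::
  "('a, 'm) monoid_scheme \<Rightarrow> 'a set \<Rightarrow> 'a set set \<Rightarrow> bool" where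
  "almost_invariant G H P \<longleftrightarrow>
     P \<subseteq> rcosets\<^bsub>G\<^esub> H \<and> (\<forall>g\<in>carrier G. almost_equal ((\<lambda>C. C #>\<^bsub>G\<^esub> g) ` P) P)"

definition coset_image :: "('a, 'm) monoid_scheme \<Rightarrow> 'a set \<Rightarrow> 'a set \<Rightarrow> 'a set set" where
  "coset_image G H X = (\<lambda>x. H #>\<^bsub>G\<^esub> x) ` X"

definition H_almost_invariant :: "('a, 'm) monoid_scheme \<Rightarrow> 'a set \<Rightarrow> 'a set \<Rightarrow> bool" where
  "H_almost_invariant G H X \<longleftrightarrow>
     X \<subseteq> carrier G \<and> (\<forall>h\<in>H. h <#\<^bsub>G\<^esub> X = X) \<and> almost_invariant G H (coset_image G H X)"

definition nontrivial_over :: "('a, 'm) monoid_scheme \<Rightarrow> 'a set \<Rightarrow> 'a set \<Rightarrow> bool" where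
  "nontrivial_over G H X \<longleftrightarrow>
     infinite (coset_image G H X) \<and> infinite (coset_image G H (carrier G - X))"

definition coboundary :: "('v, 'e) pre_digraph \<Rightarrow> 'v set \<Rightarrow> 'e set" where
  "coboundary \<Gamma> X = {e \<in> arcs \<Gamma>. (tail \<Gamma> e \<in> X) \<noteq> (head \<Gamma> e \<in> X)}"

definition coboundary_verts :: "('v, 'e) pre_digraph \<Rightarrow> 'v set \<Rightarrow> 'v set" where
  "coboundary_verts \<Gamma> X = tail \<Gamma> ` coboundary \<Gamma> X \<union> head \<Gamma> ` coboundary \<Gamma> X"

definition crosses_strongly ::
  "('a, 'm) monoid_scheme \<Rightarrow> 'a set \<Rightarrow> 'a set \<Rightarrow> 'a set \<Rightarrow> 'a \<Rightarrow> bool" where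
  "crosses_strongly G S H X g \<longleftrightarrow>
     (let D = coboundary_verts (cayley_graph G S) (g <#\<^bsub>G\<^esub> X)
      in infinite (coset_image G H (D \<inter> X)) \<and>
         infinite (coset_image G H (D \<inter> (carrier G - X))))"

definition strong_self_intersection ::
  "('a, 'm) monoid_scheme \<Rightarrow> 'a set \<Rightarrow> 'a set \<Rightarrow> 'a set \<Rightarrow> enat" where
  "strong_self_intersection G S H X =
     ecard {(H #>\<^bsub>G\<^esub> g) <#>\<^bsub>G\<^esub> H | g. g \<in> carrier G \<and> crosses_strongly G S H X g}"


section \<open>Amalgamated free products, HNN extensions, splittings\<close>

text \<open>The monoid presented by a set \<open>A\<close> of letters and a set \<open>R\<close> of relations between words:
  words modulo the congruence generated by \<open>R\<close>. It is a group in both uses below, since there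
  every letter is invertible modulo the relations.\<close>

inductive_set word_cong :: "'x set \<Rightarrow> ('x list \<times> 'x list) set \<Rightarrow> ('x list \<times> 'x list) set"
  for A :: "'x set" and R :: "('x list \<times> 'x list) set" where
  refl: "w \<in> lists A \<Longrightarrow> (w, w) \<in> word_cong A R"
| rel: "(u, v) \<in> R \<Longrightarrow> p @ u @ q \<in> lists A \<Longrightarrow> p @ v @ q \<in> lists A \<Longrightarrow>
          (p @ u @ q, p @ v @ q) \<in> word_cong A R"
| sym: "(u, v) \<in> word_cong A R \<Longrightarrow> (v, u) \<in> word_cong A R"
| trans: "(u, v) \<in> word_cong A R \<Longrightarrow> (v, w) \<in> word_cong A R \<Longrightarrow> (u, w) \<in> word_cong A R"

definition presented_monoid :: "'x set \<Rightarrow> ('x list \<times> 'x list) set \<Rightarrow> 'x list set monoid" where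
  "presented_monoid A R =
     \<lparr>carrier = lists A // word_cong A R,
      monoid.mult = (\<lambda>U V. word_cong A R `` {u @ v | u v. u \<in> U \<and> v \<in> V}),
      one = word_cong A R `` {[]}\<rparr>"

text \<open>The multiplication table of \<open>A\<close>, with \<open>\<iota>\<close> turning elements into letters.\<close>

definition table_rels :: "('a, 'm) monoid_scheme \<Rightarrow> ('a \<Rightarrow> 'x) \<Rightarrow> ('x list \<times> 'x list) set" where
  "table_rels A \<iota> =
     {([\<iota> x, \<iota> y], [\<iota> (x \<otimes>\<^bsub>A\<^esub> y)]) | x y. x \<in> carrier A \<and> y \<in> carrier A} \<union> {([\<iota> \<one>\<^bsub>A\<^esub>], [])}"

text \<open>\<open>A *\<^sub>L B\<close> for \<open>i : L \<rightarrow> A\<close> and \<open>j : L \<rightarrow> B\<close>.\<close>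

definition amalgam_letters ::
  "('a, 'm) monoid_scheme \<Rightarrow> ('b, 'n) monoid_scheme \<Rightarrow> ('a + 'b) set" where
  "amalgam_letters A B = carrier A <+> carrier B"

definition amalgam_rels ::
  "('a, 'm) monoid_scheme \<Rightarrow> ('b, 'n) monoid_scheme \<Rightarrow> 'l set \<Rightarrow> ('l \<Rightarrow> 'a) \<Rightarrow> ('l \<Rightarrow> 'b) \<Rightarrow>
     (('a + 'b) list \<times> ('a + 'b) list) set" where
  "amalgam_rels A B L i j =
     table_rels A Inl \<union> table_rels B Inr \<union> {([Inl (i l)], [Inr (j l)]) | l. l \<in> L}"

definition amalgam ::
  "('a, 'm) monoid_scheme \<Rightarrow> ('b, 'n) monoid_scheme \<Rightarrow> 'l set \<Rightarrow> ('l \<Rightarrow> 'a) \<Rightarrow> ('l \<Rightarrow> 'b) \<Rightarrow>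
     ('a + 'b) list set monoid" where
  "amalgam A B L i j = presented_monoid (amalgam_letters A B) (amalgam_rels A B L i j)"

definition amalgam_class ::
  "('a, 'm) monoid_scheme \<Rightarrow> ('b, 'n) monoid_scheme \<Rightarrow> 'l set \<Rightarrow> ('l \<Rightarrow> 'a) \<Rightarrow> ('l \<Rightarrow> 'b) \<Rightarrow>
     ('a + 'b) list \<Rightarrow> ('a + 'b) list set" where
  "amalgam_class A B L i j w =
     word_cong (amalgam_letters A B) (amalgam_rels A B L i j) `` {w}"

text \<open>\<open>A *\<^sub>L\<close> for \<open>i, j : L \<rightarrow> A\<close>, with stable letter \<open>t\<close> and \<open>t\<^sup>-\<^sup>1 i(l) t = j(l)\<close>.\<close>

datatype 'a hnn_letter = Base 'a | Stable | Stable_Inv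

definition hnn_letters :: "('a, 'm) monoid_scheme \<Rightarrow> 'a hnn_letter set" where
  "hnn_letters A = Base ` carrier A \<union> {Stable, Stable_Inv}"

definition hnn_rels ::
  "('a, 'm) monoid_scheme \<Rightarrow> 'l set \<Rightarrow> ('l \<Rightarrow> 'a) \<Rightarrow> ('l \<Rightarrow> 'a) \<Rightarrow>
     ('a hnn_letter list \<times> 'a hnn_letter list) set" where
  "hnn_rels A L i j =
     table_rels A Base \<union> {([Stable, Stable_Inv], []), ([Stable_Inv, Stable], [])} \<union>
     {([Stable_Inv, Base (i l), Stable], [Base (j l)]) | l. l \<in> L}"

definition hnn_extension ::
  "('a, 'm) monoid_scheme \<Rightarrow> 'l set \<Rightarrow> ('l \<Rightarrow> 'a) \<Rightarrow> ('l \<Rightarrow> 'a) \<Rightarrow>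
     'a hnn_letter list set monoid" where
  "hnn_extension A L i j = presented_monoid (hnn_letters A) (hnn_rels A L i j)"

definition hnn_class ::
  "('a, 'm) monoid_scheme \<Rightarrow> 'l set \<Rightarrow> ('l \<Rightarrow> 'a) \<Rightarrow> ('l \<Rightarrow> 'a) \<Rightarrow>
     'a hnn_letter list \<Rightarrow> 'a hnn_letter list set" where
  "hnn_class A L i j w = word_cong (hnn_letters A) (hnn_rels A L i j) `` {w}"

text \<open>The isomorphism is required to send the copy of \<open>L\<close> in the HNN extension or amalgamated
  product identically onto the given subgroup \<open>L\<close> of \<open>G\<close>. Taking the elements of \<open>A\<close> and \<open>B\<close>
  from the type of elements of \<open>G\<close> loses nothing, as both groups embed in \<open>G\<close>.\<close>

definition splits_as_hnn :: "('a, 'm) monoid_scheme \<Rightarrow> 'a set \<Rightarrow> bool" where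
  "splits_as_hnn G L \<longleftrightarrow>
     (\<exists>(A :: 'a monoid) i j \<phi>. group A \<and>
        i \<in> mon (G\<lparr>carrier := L\<rparr>) A \<and> j \<in> mon (G\<lparr>carrier := L\<rparr>) A \<and>
        \<phi> \<in> iso (hnn_extension A L i j) G \<and>
        (\<forall>l\<in>L. \<phi> (hnn_class A L i j [Base (i l)]) = l))"

definition splits_as_amalgam :: "('a, 'm) monoid_scheme \<Rightarrow> 'a set \<Rightarrow> bool" where
  "splits_as_amalgam G L \<longleftrightarrow>
     (\<exists>(A :: 'a monoid) (B :: 'a monoid) i j \<phi>. group A \<and> group B \<and>
        i \<in> mon (G\<lparr>carrier := L\<rparr>) A \<and> j \<in> mon (G\<lparr>carrier := L\<rparr>) B \<and>
        i ` L \<noteq> carrier A \<and> j ` L \<noteq> carrier B \<and>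
        \<phi> \<in> iso (amalgam A B L i j) G \<and>
        (\<forall>l\<in>L. \<phi> (amalgam_class A B L i j [Inl (i l)]) = l))"

definition splits_over :: "('a, 'm) monoid_scheme \<Rightarrow> 'a set \<Rightarrow> bool" where
  "splits_over G L \<longleftrightarrow> subgroup L G \<and> (splits_as_hnn G L \<or> splits_as_amalgam G L)"

end

(*
Call a subset of G small if it is covered by finitely many cosets Hg, and let C be the commensurator
of H. If g is not in C, vanishing strong self-intersection together with the finite generation of H
shows that X either almost contains or almost misses gH; changing X on a small set we may assume that
"almost" can be dropped. Identify two points of G when no C-translate of the new X separates them: the
classes form a connected graph with a C-action in which X is a finite cut. A minimal cut crossing
as few other minimal cuts as possible is nested with all its images (the Dunwoody-Kroen argument), and
it lifts to an almost invariant set Y that is nested with its C-translates. For g outside C the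
hypothesis e(G,K) = 1 with K = H \<inter> gHg^-1 makes a corner of Y and gY small. Hence the translates of
Y and its complement, ordered by inclusion inside C-orbits and by almost inclusion in general, form a
discrete nested poset with involution, that is, the oriented edges of a tree on which G acts. The
half-trees at an edge serve as ping-pong sets that turn G into an amalgamated product or an HNN
extension over the stabiliser of Y, which is commensurable with H.
*)

theory Submission
  imports Defs
begin

section \<open>Minimal edge cuts modulo an ideal, and a cut nested with all its images\<close>

section \<open>Nested cuts in a connected graph\<close>

text \<open>Closure of the commensurator under inverses is not automatic: \<open>g <# H\<close> may
  be H-finite without \<open>inv g <# H\<close> being so. The hypothesis on all groups commensurable
  with a subgroup of infinite index excludes this, since \<open>g <# X\<close> would be almost
  invariant over \<open>gHg^-1\<close>. Two kinds of nestedness occur because neither reaches the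
  whole group. Outside C the ends hypothesis controls corners only up to small sets, but strictly,
  for almost equality of two translates forces the translating element into C. Inside C distinct
  translates can be almost equal, so exact nestedness is needed and comes from minimising. The
  quotient of the Cayley graph by H carries no natural action of C, hence the dual graph; the fibre
  of a vertex can contain a coset \<open>g <# H\<close> that is not H-finite, so sides of cuts are
  measured by an ideal of vertex sets, not by cardinality. Good position puts each
  \<open>g <# H\<close> with g outside C into a single fibre, and so is inherited by Y. As H is only
  known to have a finite orbit on Y, the group \<open>H \<inter> stab Y\<close> takes over from
  H.\<close>

definition outb :: "('v \<times> 'v) set \<Rightarrow> 'v set \<Rightarrow> ('v \<times> 'v) set" where
  "outb E Y = {(u, v) \<in> E. u \<in> Y \<and> v \<notin> Y}"

definition conn_in :: "('v \<times> 'v) set \<Rightarrow> 'v set \<Rightarrow> bool" where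
  "conn_in E Y \<longleftrightarrow> (\<forall>u\<in>Y. \<forall>v\<in>Y. (u, v) \<in> (E \<inter> Y \<times> Y)\<^sup>*)"

definition nested_in :: "'v set \<Rightarrow> 'v set \<Rightarrow> 'v set \<Rightarrow> bool" where
  "nested_in V Y Z \<longleftrightarrow> Y \<subseteq> Z \<or> Z \<subseteq> Y \<or> Y \<inter> Z = {} \<or> Y \<union> Z = V"

text \<open>Eight of the sixteen combinations place D compatibly with both corners. In the others D
  mediates between Y and Z, as in \<open>Y \<subseteq> D\<close> and \<open>D \<subseteq> Z\<close>,
  and makes them nested, against \<open>nn\<close>.\<close>

lemma nested_in_corners:
  assumes "nested_in V Y D" "nested_in V Z D" and nn: "\<not> nested_in V Y Z"
    and sub: "Y \<subseteq> V" "Z \<subseteq> V" "D \<subseteq> V"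
  shows "nested_in V (Y \<inter> Z) D \<and> nested_in V (Y \<union> Z) D"
proof -
  have "\<not> Y \<subseteq> Z" "\<not> Z \<subseteq> Y" "Y \<inter> Z \<noteq> {}" "Y \<union> Z \<noteq> V"
    using nn by (auto simp: nested_in_def)
  note * = this sub
  have "Y \<subseteq> D \<or> D \<subseteq> Y \<or> Y \<inter> D = {} \<or> Y \<union> D = V" "Z \<subseteq> D \<or> D \<subseteq> Z \<or> Z \<inter> D = {} \<or> Z \<union> D = V"
    using assms(1,2) by (simp_all add: nested_in_def)
  then show ?thesis
  proof (elim disjE)
    assume "Y \<subseteq> D" "Z \<subseteq> D" then show ?thesis unfolding nested_in_def by blast
  next
    assume "D \<subseteq> Y" "D \<subseteq> Z" then show ?thesis unfolding nested_in_def by blast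
  next
    assume "Y \<inter> D = {}" "Z \<inter> D = {}"
    then have "(Y \<inter> Z) \<inter> D = {}" "(Y \<union> Z) \<inter> D = {}" by blast+
    then show ?thesis unfolding nested_in_def by simp
  next
    assume "Y \<union> D = V" "Z \<union> D = V"
    then have "(Y \<inter> Z) \<union> D = V" "(Y \<union> Z) \<union> D = V" by blast+
    then show ?thesis unfolding nested_in_def by simp
  next
    assume "Y \<subseteq> D" "Z \<union> D = V"
    then have "Y \<inter> Z \<subseteq> D" "(Y \<union> Z) \<union> D = V" using sub by blast+
    then show ?thesis unfolding nested_in_def by simp
  next
    assume "Y \<union> D = V" "Z \<subseteq> D"
    then have "Y \<inter> Z \<subseteq> D" "(Y \<union> Z) \<union> D = V" using sub by blast+
    then show ?thesis unfolding nested_in_def by simp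
  next
    assume "D \<subseteq> Y" "Z \<inter> D = {}"
    then have "(Y \<inter> Z) \<inter> D = {}" "D \<subseteq> Y \<union> Z" by blast+
    then show ?thesis unfolding nested_in_def by simp
  next
    assume "Y \<inter> D = {}" "D \<subseteq> Z"
    then have "(Y \<inter> Z) \<inter> D = {}" "D \<subseteq> Y \<union> Z" by blast+
    then show ?thesis unfolding nested_in_def by simp
  qed (use * in blast)+
qed

lemma nested_in_corner:
  assumes "nested_in V Y D \<or> nested_in V Z D" "Y \<subseteq> V" "Z \<subseteq> V" "D \<subseteq> V"
  shows "nested_in V (Y \<inter> Z) D \<or> nested_in V (Y \<union> Z) D"
proof -
  have "(Y \<subseteq> D \<or> Z \<subseteq> D) \<or> (D \<subseteq> Y \<or> D \<subseteq> Z) \<or> (Y \<inter> D = {} \<or> Z \<inter> D = {}) \<or> (Y \<union> D = V \<or> Z \<union> D = V)"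
    using assms(1) unfolding nested_in_def by argo
  then have "Y \<inter> Z \<subseteq> D \<or> D \<subseteq> Y \<union> Z \<or> (Y \<inter> Z) \<inter> D = {} \<or> (Y \<union> Z) \<union> D = V"
    using assms(2-4) by (elim disjE) blast+
  then show ?thesis unfolding nested_in_def by argo
qed

text \<open>The order of quantifiers matters: the edges of one path serve every Y that separates its
  ends, so that infinitely many cuts can be sorted by finitely many edges.\<close>

lemma path_crosses:
  assumes "(a, b) \<in> R\<^sup>*"
  shows "\<exists>P. finite P \<and> P \<subseteq> R \<and> (\<forall>Y. a \<in> Y \<longrightarrow> b \<notin> Y \<longrightarrow> P \<inter> outb R Y \<noteq> {})"
  using assms
proof (induction rule: rtrancl_induct)
  case base
  show ?case by (intro exI[of _ "{}"]) auto
next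
  case (step y z)
  then obtain P where P: "finite P" "P \<subseteq> R" "\<And>Y. a \<in> Y \<Longrightarrow> y \<notin> Y \<Longrightarrow> P \<inter> outb R Y \<noteq> {}"
    by blast
  have "insert (y, z) P \<inter> outb R Y \<noteq> {}" if "a \<in> Y" "z \<notin> Y" for Y
    using P(3)[OF that(1)] step.hyps(2) that by (cases "y \<in> Y") (auto simp: outb_def)
  then show ?case using P step.hyps(2) by (intro exI[of _ "insert (y, z) P"]) auto
qed

text \<open>Induction on the size, for all graphs at once. Removing the edge between a and b lowers
  the size and keeps both sides connected, because it joins different sides. If a and b become
  disconnected, Y can only be the component of a; otherwise every Y cuts one of the finitely many
  edges of a fixed path from a to b.\<close>

lemma finite_tight_cuts:
  assumes "sym E" "E \<subseteq> V \<times> V"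
  shows "finite {Y. Y \<subseteq> V \<and> (a, b) \<in> outb E Y \<and> finite (outb E Y) \<and> card (outb E Y) = n
            \<and> conn_in E Y \<and> conn_in E (V - Y)}"
  using assms
proof (induction n arbitrary: E a b)
  case 0
  then show ?case by (auto simp: card_eq_0_iff simp del: neq0_conv intro: finite_subset[of _ "{}"])
next
  case (Suc n)
  define E' where "E' = E - {(a, b), (b, a)}"
  have E': "sym E'" "E' \<subseteq> V \<times> V" using Suc.prems by (auto simp: E'_def sym_def)
  let ?T = "\<lambda>E a b n. {Y. Y \<subseteq> V \<and> (a, b) \<in> outb E Y \<and> finite (outb E Y)
    \<and> card (outb E Y) = n \<and> conn_in E Y \<and> conn_in E (V - Y)}"
  have red: "finite (outb E' Y) \<and> card (outb E' Y) = n \<and> conn_in E' Y \<and> conn_in E' (V - Y) \<and> a \<in> Y \<and> b \<in> V - Y"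
    if "Y \<in> ?T E a b (Suc n)" for Y
  proof -
    have "outb E' Y = outb E Y - {(a, b)}" using that by (auto simp: outb_def E'_def)
    moreover have "E' \<inter> Y \<times> Y = E \<inter> Y \<times> Y" "E' \<inter> (V - Y) \<times> (V - Y) = E \<inter> (V - Y) \<times> (V - Y)"
      using that by (auto simp: E'_def outb_def)
    moreover have "a \<in> Y \<and> b \<in> V - Y" using that Suc.prems(2) by (auto simp: outb_def)
    moreover have "finite (outb E Y)" "card (outb E Y) = Suc n" "(a, b) \<in> outb E Y" "conn_in E Y" "conn_in E (V - Y)"
      using that by simp_all
    ultimately show ?thesis unfolding conn_in_def by simp
  qed
  show ?case
  proof (cases "(a, b) \<in> E'\<^sup>*")
    case False
    have "Y = {y \<in> V. (a, y) \<in> E'\<^sup>*}" if Y: "Y \<in> ?T E a b (Suc n)" for Y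
    proof -
      have "(a, y) \<in> E'\<^sup>*" if "y \<in> Y" for y
        using red[OF Y] that unfolding conn_in_def by (auto intro: rtrancl_mono[THEN subsetD, of "E' \<inter> Y \<times> Y"])
      moreover have "(y, b) \<in> E'\<^sup>*" if "y \<in> V - Y" for y
      proof -
        have "(y, b) \<in> (E' \<inter> (V - Y) \<times> (V - Y))\<^sup>*" using red[OF Y] that unfolding conn_in_def by blast
        then show ?thesis by (rule rtrancl_mono[THEN subsetD, rotated]) auto
      qed
      ultimately show ?thesis using Y False rtrancl_trans[of a _ E' b] by blast
    qed
    then have "?T E a b (Suc n) \<subseteq> {{y \<in> V. (a, y) \<in> E'\<^sup>*}}" by blast
    then show ?thesis by (rule finite_subset) simp
  next
    case True
    obtain P where P: "finite P" "P \<subseteq> E'" "\<And>Y. a \<in> Y \<Longrightarrow> b \<notin> Y \<Longrightarrow> P \<inter> outb E' Y \<noteq> {}"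
      using path_crosses[OF True] by blast
    have "?T E a b (Suc n) \<subseteq> (\<Union>e\<in>P. ?T E' (fst e) (snd e) n)"
    proof
      fix Y assume Y: "Y \<in> ?T E a b (Suc n)"
      then obtain c d where cd: "(c, d) \<in> P" "(c, d) \<in> outb E' Y" using P(3)[of Y] red[OF Y] by auto
      then show "Y \<in> (\<Union>e\<in>P. ?T E' (fst e) (snd e) n)"
        using red[OF Y] Y by (intro UN_I[of "(c, d)"]) auto
    qed
    moreover have "finite (\<Union>e\<in>P. ?T E' (fst e) (snd e) n)"
      using Suc.IH[OF E'] P(1) by (intro finite_UN_I)
    ultimately show ?thesis by (rule finite_subset)
  qed
qed

text \<open>\<open>I\<close> is an ideal of negligible vertex sets. Local finiteness is not assumed;
  finiteness is asked only of the edge set of a cut.\<close>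

locale cut_graph =
  fixes V :: "'v set" and E :: "('v \<times> 'v) set" and I :: "'v set \<Rightarrow> bool"
  assumes E_sub: "E \<subseteq> V \<times> V" and E_sym: "sym E"
    and connected: "u \<in> V \<Longrightarrow> v \<in> V \<Longrightarrow> (u, v) \<in> E\<^sup>*"
    and I_empty: "I {}" and I_mono: "I B \<Longrightarrow> A \<subseteq> B \<Longrightarrow> I A"
    and I_Un: "I A \<Longrightarrow> I B \<Longrightarrow> I (A \<union> B)"
begin

definition cut :: "'v set \<Rightarrow> bool" where
  "cut Y \<longleftrightarrow> Y \<subseteq> V \<and> finite (outb E Y) \<and> \<not> I Y \<and> \<not> I (V - Y)"

definition mincut :: "'v set \<Rightarrow> bool" where
  "mincut Y \<longleftrightarrow> cut Y \<and> (\<forall>Z. cut Z \<longrightarrow> card (outb E Y) \<le> card (outb E Z))"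

definition crossing :: "'v set \<Rightarrow> 'v set set" where
  "crossing Y = {Z. mincut Z \<and> \<not> nested_in V Y Z}"

text \<open>A second minimisation, among the cuts with fewest edges. As \<open>card\<close> vanishes
  on infinite sets, it has the intended meaning only through \<open>finite_crossing\<close>.\<close>

definition bestcut :: "'v set \<Rightarrow> bool" where
  "bestcut Y \<longleftrightarrow> mincut Y \<and> (\<forall>Z. mincut Z \<longrightarrow> card (crossing Y) \<le> card (crossing Z))"

definition cut_aut :: "('v \<Rightarrow> 'v) \<Rightarrow> bool" where
  "cut_aut f \<longleftrightarrow> bij_betw f V V \<and> (\<forall>u\<in>V. \<forall>v\<in>V. (u, v) \<in> E \<longleftrightarrow> (f u, f v) \<in> E)
     \<and> (\<forall>A\<subseteq>V. I (f ` A) \<longleftrightarrow> I A)"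

lemma outb_compl: "Y \<subseteq> V \<Longrightarrow> outb E (V - Y) = (outb E Y)\<inverse>"
  using E_sub E_sym unfolding outb_def sym_def by auto

lemma cut_compl: "cut Y \<Longrightarrow> cut (V - Y)"
  unfolding cut_def by (simp add: outb_compl double_diff)

lemma card_outb_compl: "Y \<subseteq> V \<Longrightarrow> card (outb E (V - Y)) = card (outb E Y)"
  by (simp add: outb_compl)

lemma mincut_compl: "mincut Y \<Longrightarrow> mincut (V - Y)"
proof -
  assume Y: "mincut Y"
  then have "cut Y" "Y \<subseteq> V" by (simp_all add: mincut_def cut_def)
  then show "mincut (V - Y)" using Y by (simp add: mincut_def cut_compl card_outb_compl)
qed

lemma outb_nonempty: "u \<in> Y \<Longrightarrow> v \<in> V - Y \<Longrightarrow> Y \<subseteq> V \<Longrightarrow> outb E Y \<noteq> {}"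
proof -
  assume "u \<in> Y" "v \<in> V - Y" "Y \<subseteq> V"
  then show "outb E Y \<noteq> {}" using path_crosses[OF connected[of u v]] by (metis DiffE inf_bot_right subsetD)
qed

text \<open>Membership in Y and in Z switches at the same edges, so it agrees along paths from a
  common vertex, which a boundary edge provides. This later counts translates of a cut by their
  boundaries.\<close>

lemma outb_eq_imp_eq:
  assumes "Y \<subseteq> V" "Z \<subseteq> V" "outb E Y = outb E Z" "outb E Y \<noteq> {}"
  shows "Y = Z"
proof -
  obtain a b where "(a, b) \<in> outb E Y" using assms(4) by auto
  then have a: "a \<in> Y" "a \<in> Z" "a \<in> V" using assms by (auto simp: outb_def)
  have "v \<in> V \<and> (v \<in> Y \<longleftrightarrow> v \<in> Z)" if "(a, v) \<in> E\<^sup>*" for v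
    using that
  proof (induction rule: rtrancl_induct)
    case base then show ?case using a by simp
  next
    case (step y z)
    have "(y, z) \<in> outb E Y \<longleftrightarrow> (y, z) \<in> outb E Z" "(z, y) \<in> outb E Y \<longleftrightarrow> (z, y) \<in> outb E Z"
      using assms(3) by auto
    then show ?case using step E_sub E_sym unfolding outb_def sym_def by blast
  qed
  then show ?thesis using connected a(3) assms(1,2) by blast
qed

text \<open>If Y fell into two parts without an edge between them, its boundary would be the
  disjoint union of their boundaries, both nonempty as the whole graph is connected. One part is not
  negligible and would be a cut with fewer edges.\<close>

lemma mincut_connected:
  assumes Y: "mincut Y"
  shows "conn_in E Y"
proof (rule ccontr)
  assume "\<not> conn_in E Y"
  then obtain u v where uv: "u \<in> Y" "v \<in> Y" "(u, v) \<notin> (E \<inter> Y \<times> Y)\<^sup>*" unfolding conn_in_def by blast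
  define Y1 where "Y1 = {y \<in> Y. (u, y) \<in> (E \<inter> Y \<times> Y)\<^sup>*}"
  define Y2 where "Y2 = Y - Y1"
  have cY: "cut Y" using Y by (simp add: mincut_def)
  have sep: "(x, y) \<notin> E" if "x \<in> Y1" "y \<in> Y2" for x y
    using that unfolding Y1_def Y2_def by (auto intro: rtrancl_into_rtrancl)
  then have sep': "(y, x) \<notin> E" if "x \<in> Y1" "y \<in> Y2" for x y
    using that E_sym by (auto simp: sym_def)
  have un: "outb E Y = outb E Y1 \<union> outb E Y2" and disj: "outb E Y1 \<inter> outb E Y2 = {}"
    using sep sep' by (auto simp: outb_def Y2_def Y1_def)
  have fin: "finite (outb E Y1)" "finite (outb E Y2)" using cY un by (auto simp: cut_def)
  obtain w where w: "w \<in> V - Y" using cY I_empty by (metis all_not_in_conv cut_def)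
  have sub: "Y1 \<subseteq> Y" "Y2 \<subseteq> Y" "Y \<subseteq> V" using cY by (auto simp: Y1_def Y2_def cut_def)
  have ne: "outb E Y1 \<noteq> {}" "outb E Y2 \<noteq> {}"
    using outb_nonempty[of u Y1 w] outb_nonempty[of v Y2 w] uv w sub by (auto simp: Y1_def Y2_def)
  have "card (outb E Y) = card (outb E Y1) + card (outb E Y2)"
    unfolding un using fin disj by (rule card_Un_disjoint)
  then have lt: "card (outb E Y1) < card (outb E Y)" "card (outb E Y2) < card (outb E Y)"
    using ne fin by (simp_all add: card_gt_0_iff)
  have "Y = Y1 \<union> Y2" using sub by (auto simp: Y2_def)
  then have "\<not> I Y1 \<or> \<not> I Y2" using I_Un cY by (auto simp: cut_def)
  moreover have "\<not> I (V - Y1)" "\<not> I (V - Y2)"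
    using cY I_mono[of "V - Y1" "V - Y"] I_mono[of "V - Y2" "V - Y"] sub by (auto simp: cut_def)
  ultimately have "cut Y1 \<or> cut Y2" using fin sub by (auto simp: cut_def)
  then show False using lt Y by (auto simp: mincut_def)
qed

text \<open>Both sides of a minimal cut Z are connected; if Z crosses Y, each of them meets Y and
  its complement and so contains an end of a boundary edge of Y. Hence Z separates two of finitely
  many vertices and cuts an edge of one of finitely many fixed paths, which leaves finitely many Z
  by \<open>finite_tight_cuts\<close>.\<close>

lemma finite_crossing:
  assumes Y: "mincut Y"
  shows "finite (crossing Y)"
proof -
  define D where "D = Field (outb E Y)"
  have finD: "finite D" using Y unfolding D_def mincut_def cut_def by (intro finite_Field) auto
  have DV: "D \<subseteq> V" using E_sub by (auto simp: D_def Field_def outb_def)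
  have "\<forall>e\<in>D \<times> D. \<exists>P. finite P \<and> P \<subseteq> E \<and> (\<forall>Z. fst e \<in> Z \<longrightarrow> snd e \<notin> Z \<longrightarrow> P \<inter> outb E Z \<noteq> {})"
  proof
    fix e assume "e \<in> D \<times> D"
    then have "(fst e, snd e) \<in> E\<^sup>*" using DV by (intro connected) auto
    then show "\<exists>P. finite P \<and> P \<subseteq> E \<and> (\<forall>Z. fst e \<in> Z \<longrightarrow> snd e \<notin> Z \<longrightarrow> P \<inter> outb E Z \<noteq> {})"
      by (rule path_crosses)
  qed
  then obtain P where P: "\<And>e. e \<in> D \<times> D \<Longrightarrow> finite (P e)"
    "\<And>e Z. e \<in> D \<times> D \<Longrightarrow> fst e \<in> Z \<Longrightarrow> snd e \<notin> Z \<Longrightarrow> P e \<inter> outb E Z \<noteq> {}"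
    by metis
  define Q where "Q = (\<Union>e\<in>D \<times> D. P e)"
  have finQ: "finite Q" using P(1) finD by (auto simp: Q_def)
  let ?T = "\<lambda>e. {Z. Z \<subseteq> V \<and> (fst e, snd e) \<in> outb E Z \<and> finite (outb E Z)
    \<and> card (outb E Z) = card (outb E Y) \<and> conn_in E Z \<and> conn_in E (V - Z)}"
  have "crossing Y \<subseteq> (\<Union>e\<in>Q. ?T e)"
  proof
    fix Z assume "Z \<in> crossing Y"
    then have Z: "mincut Z" and nn: "\<not> nested_in V Y Z" by (auto simp: crossing_def)
    have sub: "Y \<subseteq> V" "Z \<subseteq> V" using Y Z by (auto simp: mincut_def cut_def)
    have "\<exists>p\<in>D. p \<in> W" if W: "mincut W" and ne: "W \<inter> Y \<noteq> {}" "W - Y \<noteq> {}" for W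
    proof -
      obtain p q where "p \<in> W \<inter> Y" "q \<in> W - Y" using ne by blast
      then have "(p, q) \<in> (E \<inter> W \<times> W)\<^sup>*" using mincut_connected[OF W] by (auto simp: conn_in_def)
      from path_crosses[OF this] obtain P where "P \<inter> outb (E \<inter> W \<times> W) Y \<noteq> {}"
        using \<open>p \<in> W \<inter> Y\<close> \<open>q \<in> W - Y\<close> by (metis DiffE IntE)
      then obtain x y where "(x, y) \<in> outb (E \<inter> W \<times> W) Y" by auto
      then show ?thesis by (force simp: D_def Field_def outb_def)
    qed
    note meets = this
    have "Z \<inter> Y \<noteq> {}" "Z - Y \<noteq> {}" "(V - Z) \<inter> Y \<noteq> {}" "(V - Z) - Y \<noteq> {}"
      using nn sub by (auto simp: nested_in_def)
    then obtain p q where pq: "p \<in> D" "p \<in> Z" "q \<in> D" "q \<notin> Z"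
      using meets[OF Z] meets[OF mincut_compl[OF Z]] by (metis DiffD2)
    then have "P (p, q) \<inter> outb E Z \<noteq> {}" using P(2)[of "(p, q)" Z] by auto
    then obtain e where e: "e \<in> Q" "e \<in> outb E Z" using pq by (auto simp: Q_def)
    have "cut Y" "cut Z" using Y Z by (simp_all add: mincut_def)
    then have "card (outb E Z) = card (outb E Y)" "finite (outb E Z)"
      using Y Z by (simp_all add: mincut_def antisym cut_def[of Z])
    then have "Z \<in> ?T e"
      using e(2) mincut_connected[OF Z] mincut_connected[OF mincut_compl[OF Z]] sub by simp
    then show "Z \<in> (\<Union>e\<in>Q. ?T e)" using e(1) by blast
  qed
  moreover have "finite (\<Union>e\<in>Q. ?T e)"
    using finQ finite_tight_cuts[OF E_sym E_sub] by (intro finite_UN_I) auto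
  ultimately show ?thesis by (rule finite_subset)
qed

lemma outb_submodular:
  assumes "finite (outb E Y)" "finite (outb E Z)"
  shows "card (outb E (Y \<inter> Z)) + card (outb E (Y \<union> Z)) \<le> card (outb E Y) + card (outb E Z)"
proof -
  have sub: "outb E (Y \<inter> Z) \<union> outb E (Y \<union> Z) \<subseteq> outb E Y \<union> outb E Z"
    "outb E (Y \<inter> Z) \<inter> outb E (Y \<union> Z) \<subseteq> outb E Y \<inter> outb E Z"
    by (auto simp: outb_def)
  have fin: "finite (outb E (Y \<inter> Z))" "finite (outb E (Y \<union> Z))"
    using finite_subset[OF sub(1)] assms by auto
  have "card (outb E (Y \<inter> Z) \<union> outb E (Y \<union> Z)) \<le> card (outb E Y \<union> outb E Z)"
    "card (outb E (Y \<inter> Z) \<inter> outb E (Y \<union> Z)) \<le> card (outb E Y \<inter> outb E Z)"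
    using sub assms by (auto intro: card_mono)
  then show ?thesis
    using card_Un_Int[OF fin] card_Un_Int[OF assms] by linarith
qed

text \<open>Submodularity leaves no slack: each of the two sets is a cut and has at least the
  minimal number of edges, while together they have at most twice that number.\<close>

lemma mincut_corners:
  assumes Y: "mincut Y" and Z: "mincut Z" and ni: "\<not> I (Y \<inter> Z)" "\<not> I (V - (Y \<union> Z))"
  shows "mincut (Y \<inter> Z)" "mincut (Y \<union> Z)"
proof -
  have c: "cut Y" "cut Z" using Y Z by (auto simp: mincut_def)
  have sub: "outb E (Y \<inter> Z) \<union> outb E (Y \<union> Z) \<subseteq> outb E Y \<union> outb E Z"
    by (auto simp: outb_def)
  have "finite (outb E (Y \<inter> Z))" "finite (outb E (Y \<union> Z))"
    using finite_subset[OF sub] c by (auto simp: cut_def)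
  moreover have "\<not> I (V - (Y \<inter> Z))" "\<not> I (Y \<union> Z)"
    using c I_mono[of "V - Y \<inter> Z" "V - Y"] I_mono[of "Y \<union> Z" Y] by (auto simp: cut_def)
  ultimately have cc: "cut (Y \<inter> Z)" "cut (Y \<union> Z)" using ni c by (auto simp: cut_def)
  have "card (outb E Y) = card (outb E Z)" using Y Z by (auto simp: mincut_def intro: antisym)
  moreover have "card (outb E Y) \<le> card (outb E (Y \<inter> Z))" "card (outb E Y) \<le> card (outb E (Y \<union> Z))"
    using Y cc by (auto simp: mincut_def)
  moreover have "card (outb E (Y \<inter> Z)) + card (outb E (Y \<union> Z)) \<le> card (outb E Y) + card (outb E Z)"
    using c by (intro outb_submodular) (auto simp: cut_def)
  ultimately have "card (outb E (Y \<inter> Z)) = card (outb E Y)" "card (outb E (Y \<union> Z)) = card (outb E Y)"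
    by linarith+
  then show "mincut (Y \<inter> Z)" "mincut (Y \<union> Z)" using cc Y by (auto simp: mincut_def)
qed

lemma crossing_compl: "Z \<subseteq> V \<Longrightarrow> crossing (V - Z) = crossing Z"
proof -
  assume Z: "Z \<subseteq> V"
  have "nested_in V (V - Z) D \<longleftrightarrow> nested_in V Z D" if "D \<subseteq> V" for D
  proof -
    have "V - Z \<subseteq> D \<longleftrightarrow> Z \<union> D = V" "D \<subseteq> V - Z \<longleftrightarrow> Z \<inter> D = {}" "(V - Z) \<inter> D = {} \<longleftrightarrow> D \<subseteq> Z"
      "(V - Z) \<union> D = V \<longleftrightarrow> Z \<subseteq> D" using Z that by blast+
    then show ?thesis unfolding nested_in_def by argo
  qed
  then show ?thesis by (auto simp: crossing_def mincut_def cut_def)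
qed

text \<open>Crossing is submodular too: a cut that crosses one of the two corners crosses Y or Z,
  and a cut that crosses both crosses Y and Z. Strictness comes from Y, which crosses Z but neither
  corner.\<close>

lemma crossing_corners:
  assumes Y: "mincut Y" and Z: "mincut Z" and ni: "\<not> I (Y \<inter> Z)" "\<not> I (V - (Y \<union> Z))"
    and nn: "\<not> nested_in V Y Z"
  shows "card (crossing (Y \<inter> Z)) + card (crossing (Y \<union> Z)) < card (crossing Y) + card (crossing Z)"
proof -
  have mc: "mincut (Y \<inter> Z)" "mincut (Y \<union> Z)" using mincut_corners[OF Y Z ni] by auto
  have sub: "Y \<subseteq> V" "Z \<subseteq> V" using Y Z by (auto simp: mincut_def cut_def)
  have un: "crossing (Y \<inter> Z) \<union> crossing (Y \<union> Z) \<subseteq> crossing Y \<union> crossing Z - {Y}"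
  proof
    fix D assume D: "D \<in> crossing (Y \<inter> Z) \<union> crossing (Y \<union> Z)"
    then have DV: "D \<subseteq> V" and mD: "mincut D" by (auto simp: crossing_def mincut_def cut_def)
    have "D \<noteq> Y" using D by (auto simp: crossing_def nested_in_def)
    moreover have "nested_in V (Y \<inter> Z) D \<and> nested_in V (Y \<union> Z) D" if "nested_in V Y D" "nested_in V Z D"
      using nested_in_corners[OF that nn sub DV] .
    ultimately show "D \<in> crossing Y \<union> crossing Z - {Y}" using D mD by (auto simp: crossing_def)
  qed
  have int: "crossing (Y \<inter> Z) \<inter> crossing (Y \<union> Z) \<subseteq> crossing Y \<inter> crossing Z"
  proof
    fix D assume D: "D \<in> crossing (Y \<inter> Z) \<inter> crossing (Y \<union> Z)"
    then have DV: "D \<subseteq> V" and mD: "mincut D" by (auto simp: crossing_def mincut_def cut_def)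
    have "nested_in V (Y \<inter> Z) D \<or> nested_in V (Y \<union> Z) D" if "nested_in V Y D \<or> nested_in V Z D"
      using that sub DV nested_in_corner by blast
    then show "D \<in> crossing Y \<inter> crossing Z" using D mD by (auto simp: crossing_def)
  qed
  have "Y \<in> crossing Z" using nn Y by (auto simp: crossing_def nested_in_def)
  then have "crossing Y \<union> crossing Z - {Y} \<subset> crossing Y \<union> crossing Z" by auto
  with un have "crossing (Y \<inter> Z) \<union> crossing (Y \<union> Z) \<subset> crossing Y \<union> crossing Z" by blast
  then have "card (crossing (Y \<inter> Z) \<union> crossing (Y \<union> Z)) < card (crossing Y \<union> crossing Z)"
    using finite_crossing[OF Y] finite_crossing[OF Z] by (intro psubset_card_mono) auto
  moreover have "card (crossing (Y \<inter> Z) \<inter> crossing (Y \<union> Z)) \<le> card (crossing Y \<inter> crossing Z)"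
    using int finite_crossing[OF Y] by (intro card_mono) auto
  ultimately show ?thesis
    using card_Un_Int[OF finite_crossing[OF mc(1)] finite_crossing[OF mc(2)]]
      card_Un_Int[OF finite_crossing[OF Y] finite_crossing[OF Z]] by linarith
qed

lemma bestcut_nested:
  assumes Y: "bestcut Y" and Z: "bestcut Z"
  shows "nested_in V Y Z"
proof (rule ccontr)
  assume nn: "\<not> nested_in V Y Z"
  have m: "mincut Y" "mincut Z" using Y Z by (auto simp: bestcut_def)
  have sub: "Y \<subseteq> V" "Z \<subseteq> V" using m by (auto simp: mincut_def cut_def)
  have aux: False if Z: "mincut Z" "card (crossing Z) = card (crossing Y)" "\<not> nested_in V Y Z"
    "\<not> I (Y \<inter> Z)" "\<not> I (V - (Y \<union> Z))" for Z
  proof -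
    note crossing_corners[OF m(1) Z(1) Z(4) Z(5) Z(3)]
    moreover have "card (crossing Y) \<le> card (crossing (Y \<inter> Z))" "card (crossing Y) \<le> card (crossing (Y \<union> Z))"
      using Y mincut_corners[OF m(1) Z(1) Z(4) Z(5)] by (auto simp: bestcut_def)
    ultimately show False using Z(2) by linarith
  qed
  have eq: "card (crossing Z) = card (crossing Y)"
    using Y Z by (auto simp: bestcut_def intro: antisym)
  \<comment> \<open>Two adjacent corners unite to Y, to Z or to a complement of these, so they are
    never both negligible. Hence some pair of opposite corners consists of non-negligible
    sets.\<close>
  have "\<not> I (Y \<inter> Z) \<or> \<not> I (Y \<inter> (V - Z))" "\<not> I (V - (Y \<union> Z)) \<or> \<not> I (V - (Y \<union> (V - Z)))"
    "\<not> I (Y \<inter> Z) \<or> \<not> I (V - (Y \<union> (V - Z)))" "\<not> I (V - (Y \<union> Z)) \<or> \<not> I (Y \<inter> (V - Z))"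
  proof -
    have "Y \<inter> Z \<union> Y \<inter> (V - Z) = Y" "(V - (Y \<union> Z)) \<union> (V - (Y \<union> (V - Z))) = V - Y"
      "Y \<inter> Z \<union> (V - (Y \<union> (V - Z))) = Z" "(V - (Y \<union> Z)) \<union> Y \<inter> (V - Z) = V - Z"
      using sub by auto
    then show "\<not> I (Y \<inter> Z) \<or> \<not> I (Y \<inter> (V - Z))" "\<not> I (V - (Y \<union> Z)) \<or> \<not> I (V - (Y \<union> (V - Z)))"
      "\<not> I (Y \<inter> Z) \<or> \<not> I (V - (Y \<union> (V - Z)))" "\<not> I (V - (Y \<union> Z)) \<or> \<not> I (Y \<inter> (V - Z))"
      using m I_Un unfolding mincut_def cut_def by metis+
  qed
  then consider "\<not> I (Y \<inter> Z)" "\<not> I (V - (Y \<union> Z))"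
    | "\<not> I (Y \<inter> (V - Z))" "\<not> I (V - (Y \<union> (V - Z)))" by blast
  then show False
  proof cases
    case 1
    then show False using aux[OF m(2) eq nn] by blast
  next
    case 2
    have "\<not> nested_in V Y (V - Z)" using nn sub by (auto simp: nested_in_def)
    then show False using aux[OF mincut_compl[OF m(2)] _ _ 2] eq crossing_compl[OF sub(2)] by simp
  qed
qed

lemma cut_aut_inv: "cut_aut f \<Longrightarrow> cut_aut (inv_into V f)"
proof -
  assume f: "cut_aut f"
  then have b: "bij_betw f V V" and e: "\<And>u v. u \<in> V \<Longrightarrow> v \<in> V \<Longrightarrow> (u, v) \<in> E \<longleftrightarrow> (f u, f v) \<in> E"
    and i: "\<And>A. A \<subseteq> V \<Longrightarrow> I (f ` A) \<longleftrightarrow> I A" by (simp_all add: cut_aut_def)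
  have b': "bij_betw (inv_into V f) V V" by (rule bij_betw_inv_into[OF b])
  have fi: "f (inv_into V f x) = x" if "x \<in> V" for x using b that by (rule bij_betw_inv_into_right)
  have "f ` inv_into V f ` A = A" if "A \<subseteq> V" for A using fi that by (force simp: image_image)
  then have "I (inv_into V f ` A) \<longleftrightarrow> I A" if "A \<subseteq> V" for A
    using i[of "inv_into V f ` A"] bij_betw_imp_surj_on[OF b'] that by (metis image_mono)
  moreover have "(inv_into V f u, inv_into V f v) \<in> E \<longleftrightarrow> (u, v) \<in> E" if "u \<in> V" "v \<in> V" for u v
    using e[of "inv_into V f u" "inv_into V f v"] fi that bij_betwE[OF b'] by simp
  ultimately show "cut_aut (inv_into V f)"
    unfolding cut_aut_def using b' by blast
qed

lemma outb_image:
  assumes "cut_aut f" "Y \<subseteq> V"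
  shows "outb E (f ` Y) = (\<lambda>(u, v). (f u, f v)) ` outb E Y"
proof -
  have b: "inj_on f V" "f ` V = V" and e: "\<And>u v. u \<in> V \<Longrightarrow> v \<in> V \<Longrightarrow> (u, v) \<in> E \<longleftrightarrow> (f u, f v) \<in> E"
    using assms unfolding cut_aut_def bij_betw_def by blast+
  show ?thesis
  proof (intro equalityI subsetI)
    fix p assume "p \<in> outb E (f ` Y)"
    then obtain u v' where p: "p = (f u, v')" "u \<in> Y" "v' \<notin> f ` Y" "(f u, v') \<in> E" by (auto simp: outb_def)
    then obtain v where v: "v \<in> V" "v' = f v" using E_sub b(2) by blast
    then have "(u, v) \<in> outb E Y" using p e[of u v] assms(2) by (auto simp: outb_def)
    then show "p \<in> (\<lambda>(u, v). (f u, f v)) ` outb E Y" using p v by force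
  next
    fix p assume "p \<in> (\<lambda>(u, v). (f u, f v)) ` outb E Y"
    then obtain u v where p: "p = (f u, f v)" "(u, v) \<in> E" "u \<in> Y" "v \<notin> Y" by (auto simp: outb_def)
    then have uv: "u \<in> V" "v \<in> V" using E_sub by auto
    then have "f v \<notin> f ` Y" using b(1) p assms(2) by (auto simp: inj_on_def)
    then show "p \<in> outb E (f ` Y)" using p uv e by (auto simp: outb_def)
  qed
qed

lemma card_outb_image:
  assumes "cut_aut f" "Y \<subseteq> V"
  shows "card (outb E (f ` Y)) = card (outb E Y)"
proof -
  have "inj_on f V" using assms unfolding cut_aut_def bij_betw_def by blast
  then have "inj_on (map_prod f f) (V \<times> V)" using map_prod_inj_on by blast
  then have "inj_on (\<lambda>(u, v). (f u, f v)) (outb E Y)"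
    unfolding map_prod_def by (rule inj_on_subset) (use E_sub in \<open>auto simp: outb_def\<close>)
  then show ?thesis unfolding outb_image[OF assms] by (rule card_image)
qed

lemma image_compl: "cut_aut f \<Longrightarrow> Y \<subseteq> V \<Longrightarrow> f ` (V - Y) = V - f ` Y"
  using inj_on_image_set_diff[of f V V Y] by (simp add: cut_aut_def bij_betw_def)

lemma mincut_image: "cut_aut f \<Longrightarrow> mincut Y \<Longrightarrow> mincut (f ` Y)"
proof -
  assume f: "cut_aut f" and Y: "mincut Y"
  have sub: "Y \<subseteq> V" using Y by (auto simp: mincut_def cut_def)
  have I: "I (f ` Y) \<longleftrightarrow> I Y" "I (f ` (V - Y)) \<longleftrightarrow> I (V - Y)"
    using f sub by (simp_all add: cut_aut_def del: image_diff_subset)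
  have "f ` V = V" using f by (simp add: cut_aut_def bij_betw_def)
  then have "f ` Y \<subseteq> V" using sub by blast
  moreover have "finite (outb E (f ` Y))" using Y by (simp add: outb_image[OF f sub] mincut_def cut_def)
  ultimately have "cut (f ` Y)"
    using Y I unfolding mincut_def cut_def image_compl[OF f sub] by simp
  then show ?thesis using Y card_outb_image[OF f sub] unfolding mincut_def by simp
qed

text \<open>One inequality suffices: pulling back along the inverse embeds the cuts that cross the
  image into those that cross Y, and Y already attains the minimum.\<close>

lemma bestcut_image:
  assumes f: "cut_aut f" and Y: "bestcut Y"
  shows "bestcut (f ` Y)"
proof -
  define g where "g = inv_into V f"
  have g: "cut_aut g" unfolding g_def by (rule cut_aut_inv[OF f])
  have m: "mincut Y" using Y by (simp add: bestcut_def)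
  then have sub: "Y \<subseteq> V" by (simp add: mincut_def cut_def)
  have bij: "bij_betw f V V" using f by (simp add: cut_aut_def)
  have gf: "g (f x) = x" "f (g x) = x" if "x \<in> V" for x
    using bij that by (auto simp: g_def bij_betw_inv_into_left bij_betw_inv_into_right)
  have gV: "x \<in> V \<Longrightarrow> g x \<in> V" "x \<in> V \<Longrightarrow> f x \<in> V" for x
    using bij bij_betwE[of f V V] bij_betwE[of g V V] g by (simp_all add: cut_aut_def)
  have "inj_on ((`) g) (crossing (f ` Y))"
  proof (rule inj_on_inverseI[where g = "(`) f"])
    fix Z assume "Z \<in> crossing (f ` Y)"
    then have "Z \<subseteq> V" by (simp add: crossing_def mincut_def cut_def)
    then show "f ` g ` Z = Z" using gf by (force simp: image_image)
  qed
  moreover have "(`) g ` crossing (f ` Y) \<subseteq> crossing Y"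
  proof (rule image_subsetI)
    fix Z assume Z: "Z \<in> crossing (f ` Y)"
    then have ZV: "Z \<subseteq> V" and mZ: "mincut Z" and nn: "\<not> nested_in V (f ` Y) Z"
      by (auto simp: crossing_def mincut_def cut_def)
    have e: "f ` g ` Z = Z" using gf ZV by (force simp: image_image)
    have fV: "f ` V = V" using bij by (simp add: bij_betw_def)
    have "nested_in V (f ` Y) Z" if "nested_in V Y (g ` Z)"
    proof -
      have gZ: "g ` Z \<subseteq> V" using ZV gV by auto
      consider "Y \<subseteq> g ` Z" | "g ` Z \<subseteq> Y" | "Y \<inter> g ` Z = {}" | "Y \<union> g ` Z = V"
        using \<open>nested_in V Y (g ` Z)\<close> by (auto simp: nested_in_def)
      then show ?thesis
      proof cases
        case 1 then show ?thesis using e unfolding nested_in_def by blast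
      next
        case 2 then show ?thesis using e unfolding nested_in_def by blast
      next
        case 3
        have "f ` Y \<inter> f ` g ` Z = {}"
          using 3 sub gZ bij by (subst inj_on_image_Int[symmetric, of f V]) (auto simp: bij_betw_def)
        then show ?thesis using e unfolding nested_in_def by simp
      next
        case 4
        then have "f ` Y \<union> Z = V" using e fV by (metis image_Un)
        then show ?thesis unfolding nested_in_def by simp
      qed
    qed
    then show "g ` Z \<in> crossing Y" using nn mincut_image[OF g mZ] by (auto simp: crossing_def)
  qed
  ultimately have "card (crossing (f ` Y)) \<le> card (crossing Y)"
    using finite_crossing[OF m] by (rule card_inj_on_le)
  then have "card (crossing (f ` Y)) \<le> card (crossing Z)" if "mincut Z" for Z
    using Y that le_trans unfolding bestcut_def by metis
  then show ?thesis using mincut_image[OF f m] unfolding bestcut_def by simp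
qed

theorem invariant_nested_cut:
  assumes "cut X"
  shows "\<exists>Y. cut Y \<and> (\<forall>f. cut_aut f \<longrightarrow> nested_in V Y (f ` Y))"
proof -
  have "\<exists>M. mincut M"
    unfolding mincut_def by (rule ex_has_least_nat[of cut X "\<lambda>Z. card (outb E Z)", OF assms])
  then obtain M where M: "mincut M" ..
  have "\<exists>Y. bestcut Y"
    unfolding bestcut_def by (rule ex_has_least_nat[of mincut M "\<lambda>Z. card (crossing Z)", OF M])
  then obtain Y where Y: "bestcut Y" ..
  then have "cut Y" by (simp add: bestcut_def mincut_def)
  then show ?thesis using bestcut_nested[OF Y bestcut_image[OF _ Y]] by blast
qed

end

section \<open>Ping-pong criteria for amalgamated products and HNN extensions\<close>

section \<open>Recognising presented groups\<close>

declare in_lists_conv_set [simp del] in_listsD [rule del] in_listsI [rule del]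

lemma word_cong_lists:
  "(u, v) \<in> word_cong A R \<Longrightarrow> u \<in> lists A \<and> v \<in> lists A"
  by (induction rule: word_cong.induct) auto

lemma equiv_word_cong: "equiv (lists A) (word_cong A R)"
proof (rule equivI)
  show "word_cong A R \<subseteq> lists A \<times> lists A" by (auto dest: word_cong_lists)
  show "refl_on (lists A) (word_cong A R)"
    by (auto simp: refl_on_def intro: word_cong.refl dest: word_cong_lists)
  show "sym (word_cong A R)" by (auto simp: sym_def intro: word_cong.sym)
  show "trans (word_cong A R)" by (auto simp: trans_def intro: word_cong.trans)
qed

lemma word_cong_append:
  assumes "(u, v) \<in> word_cong A R" "p \<in> lists A" "q \<in> lists A"
  shows "(p @ u @ q, p @ v @ q) \<in> word_cong A R"
  using assms
proof (induction rule: word_cong.induct)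
  case (rel u v p' q')
  have "((p @ p') @ u @ (q' @ q), (p @ p') @ v @ (q' @ q)) \<in> word_cong A R"
    using rel by (intro word_cong.rel) auto
  then show ?case by simp
next
  case (refl w)
  then show ?case by (simp add: word_cong.refl)
next
  case (sym u v)
  then show ?case by (simp add: word_cong.sym)
next
  case (trans u v w)
  then show ?case using word_cong.trans by fast
qed

lemmas word_cong_prepend = word_cong_append[where q = "[]", simplified]
lemmas word_cong_postpend = word_cong_append[where p = "[]", simplified]

lemma word_cong_rel:
  "(u, v) \<in> R \<Longrightarrow> u \<in> lists A \<Longrightarrow> v \<in> lists A \<Longrightarrow> (u, v) \<in> word_cong A R"
  using word_cong.rel[of u v R "[]" "[]" A] by simp

definition word_val :: "('a, 'm) monoid_scheme \<Rightarrow> ('x \<Rightarrow> 'a) \<Rightarrow> 'x list \<Rightarrow> 'a" where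
  "word_val G f w = foldr (\<lambda>x g. f x \<otimes>\<^bsub>G\<^esub> g) w \<one>\<^bsub>G\<^esub>"

lemma word_val_simps [simp]:
  "word_val G f [] = \<one>\<^bsub>G\<^esub>" "word_val G f (x # w) = f x \<otimes>\<^bsub>G\<^esub> word_val G f w"
  by (simp_all add: word_val_def)

context group
begin

lemma word_val_closed [simp]: "f \<in> A \<rightarrow> carrier G \<Longrightarrow> w \<in> lists A \<Longrightarrow> word_val G f w \<in> carrier G"
  by (induction w) auto

lemma word_val_append:
  "f \<in> A \<rightarrow> carrier G \<Longrightarrow> u \<in> lists A \<Longrightarrow> v \<in> lists A \<Longrightarrow>
    word_val G f (u @ v) = word_val G f u \<otimes> word_val G f v"
proof (induction u)
  case (Cons x u)
  then have "f x \<in> carrier G" by auto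
  then show ?case using Cons word_val_closed[of f A u] word_val_closed[of f A v] by (simp add: m_assoc)
qed simp

lemma word_val_cong:
  assumes f: "f \<in> A \<rightarrow> carrier G"
    and R: "\<And>u v. (u, v) \<in> R \<Longrightarrow> u \<in> lists A \<Longrightarrow> v \<in> lists A \<Longrightarrow> word_val G f u = word_val G f v"
    and uv: "(u, v) \<in> word_cong A R"
  shows "word_val G f u = word_val G f v"
  using uv
proof (induction rule: word_cong.induct)
  case (rel u v p q)
  then show ?case using R[of u v] by (simp add: word_val_append[OF f])
qed auto

text \<open>In a monoid a trivial kernel alone does not give injectivity. Surjectivity supplies a
  word for the inverse of each value, and \<open>ker\<close> makes this word a two-sided inverse
  modulo the congruence.\<close>

lemma presented_monoid_iso:
  assumes f: "f \<in> A \<rightarrow> carrier G"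
    and R: "\<And>u v. (u, v) \<in> R \<Longrightarrow> u \<in> lists A \<Longrightarrow> v \<in> lists A \<Longrightarrow> word_val G f u = word_val G f v"
    and gen: "\<And>g. g \<in> carrier G \<Longrightarrow> \<exists>w\<in>lists A. word_val G f w = g"
    and ker: "\<And>w. w \<in> lists A \<Longrightarrow> word_val G f w = \<one> \<Longrightarrow> (w, []) \<in> word_cong A R"
  shows "\<exists>\<phi>. \<phi> \<in> iso (presented_monoid A R) G \<and>
    (\<forall>w\<in>lists A. \<phi> (word_cong A R `` {w}) = word_val G f w)"
proof -
  let ?C = "word_cong A R"
  define \<phi> where "\<phi> U = the_elem (word_val G f ` U)" for U
  note eq = equiv_word_cong[of A R]
  have val: "\<phi> (?C `` {w}) = word_val G f w" if "w \<in> lists A" for w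
  proof -
    have "word_val G f ` (?C `` {w}) = {word_val G f w}"
    proof
      show "{word_val G f w} \<subseteq> word_val G f ` (?C `` {w})" using equiv_class_self[OF eq that] by simp
      show "word_val G f ` (?C `` {w}) \<subseteq> {word_val G f w}"
      proof
        fix g assume "g \<in> word_val G f ` (?C `` {w})"
        then obtain v where "(w, v) \<in> ?C" "g = word_val G f v" by auto
        then show "g \<in> {word_val G f w}" using word_val_cong[OF f R] by fastforce
      qed
    qed
    then show ?thesis by (simp add: \<phi>_def)
  qed
  have mult: "U \<otimes>\<^bsub>presented_monoid A R\<^esub> V = ?C `` {u @ v}"
    if "u \<in> lists A" "v \<in> lists A" "U = ?C `` {u}" "V = ?C `` {v}" for u v U V
  proof -
    have "(u @ v, u' @ v') \<in> ?C" if "(u, u') \<in> ?C" "(v, v') \<in> ?C" for u' v'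
    proof -
      have l: "u' \<in> lists A" using that word_cong_lists by fast
      have "(u @ v, u' @ v) \<in> ?C" using word_cong_postpend that(1) \<open>v \<in> lists A\<close> by fast
      moreover have "(u' @ v, u' @ v') \<in> ?C" using word_cong_prepend that(2) l by fast
      ultimately show ?thesis by (rule word_cong.trans)
    qed
    then have "?C `` {w} = ?C `` {u @ v}" if "w \<in> {a @ b |a b. a \<in> U \<and> b \<in> V}" for w
      using that \<open>U = _\<close> \<open>V = _\<close> equiv_class_eq[OF eq] by fast
    moreover have "u @ v \<in> {a @ b |a b. a \<in> U \<and> b \<in> V}"
      using that equiv_class_self[OF eq] by auto
    ultimately have "?C `` {a @ b |a b. a \<in> U \<and> b \<in> V} = ?C `` {u @ v}" by blast
    then show ?thesis by (simp add: presented_monoid_def)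
  qed
  have car: "carrier (presented_monoid A R) = {?C `` {w} |w. w \<in> lists A}"
    by (auto simp: presented_monoid_def quotient_def)
  have hom: "\<phi> \<in> hom (presented_monoid A R) G"
  proof (rule homI)
    fix U assume "U \<in> carrier (presented_monoid A R)"
    then show "\<phi> U \<in> carrier G" using val f by (auto simp: car)
  next
    fix U V assume "U \<in> carrier (presented_monoid A R)" "V \<in> carrier (presented_monoid A R)"
    then obtain u v where uv: "u \<in> lists A" "v \<in> lists A" "U = ?C `` {u}" "V = ?C `` {v}" by (auto simp: car)
    then show "\<phi> (U \<otimes>\<^bsub>presented_monoid A R\<^esub> V) = \<phi> U \<otimes> \<phi> V"
      using mult[OF uv] val uv by (simp add: word_val_append[OF f])
  qed
  have inj: "inj_on \<phi> (carrier (presented_monoid A R))"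
  proof (rule inj_onI)
    fix U V assume "U \<in> carrier (presented_monoid A R)" "V \<in> carrier (presented_monoid A R)" "\<phi> U = \<phi> V"
    then obtain u v where uv: "u \<in> lists A" "v \<in> lists A" "U = ?C `` {u}" "V = ?C `` {v}"
      by (auto simp: car)
    then have uv_eq: "word_val G f u = word_val G f v" using val \<open>\<phi> U = \<phi> V\<close> by simp
    obtain v' where v': "v' \<in> lists A" "word_val G f v' = inv (word_val G f v)"
      using gen[of "inv (word_val G f v)"] uv(2) f by auto
    have c: "word_val G f v \<in> carrier G" using uv(2) f by simp
    have "(u @ v', []) \<in> ?C" "(v' @ v, []) \<in> ?C"
      using uv uv_eq v' c f by (auto intro!: ker simp: word_val_append[OF f])
    then have "(u @ v' @ v, v) \<in> ?C" "(u @ v' @ v, u) \<in> ?C"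
      using word_cong_postpend[of "u @ v'" "[]" A R v] word_cong_prepend[of "v' @ v" "[]" A R u] uv by auto
    then have "(u, v) \<in> ?C" using word_cong.sym word_cong.trans by fast
    then show "U = V" using uv equiv_class_eq[OF eq] by simp
  qed
  have "\<phi> ` carrier (presented_monoid A R) = carrier G"
  proof
    show "\<phi> ` carrier (presented_monoid A R) \<subseteq> carrier G" using hom by (auto simp: hom_def)
    show "carrier G \<subseteq> \<phi> ` carrier (presented_monoid A R)"
    proof
      fix g assume "g \<in> carrier G"
      then obtain w where "w \<in> lists A" "word_val G f w = g" using gen by blast
      then show "g \<in> \<phi> ` carrier (presented_monoid A R)"
        using val by (intro image_eqI[of _ _ "?C `` {w}"]) (auto simp: car)
    qed
  qed
  then have "\<phi> \<in> iso (presented_monoid A R) G" using hom inj by (simp add: iso_def bij_betw_def)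
  then show ?thesis using val by blast
qed

end

text \<open>Minimal length in the congruence class replaces a normal form: a reducible pattern is
  excluded because it would yield a shorter word.\<close>

definition shortest :: "'x set \<Rightarrow> ('x list \<times> 'x list) set \<Rightarrow> 'x list \<Rightarrow> bool" where
  "shortest A R w \<longleftrightarrow> w \<in> lists A \<and> (\<forall>w'. (w, w') \<in> word_cong A R \<longrightarrow> length w \<le> length w')"

lemma ex_shortest:
  assumes "w \<in> lists A"
  shows "\<exists>w'. (w, w') \<in> word_cong A R \<and> shortest A R w'"
proof -
  obtain w' where w': "(w, w') \<in> word_cong A R"
    "\<And>v. (w, v) \<in> word_cong A R \<Longrightarrow> length w' \<le> length v"
    using ex_has_least_nat[of "\<lambda>v. (w, v) \<in> word_cong A R" w length] word_cong.refl[OF assms] by blast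
  have "shortest A R w'" unfolding shortest_def
    using w'(2) word_cong_lists[OF w'(1)] word_cong.trans[OF w'(1)] by simp
  then show ?thesis using w'(1) by blast
qed

lemma shortest_Cons: "shortest A R (x # w) \<Longrightarrow> shortest A R w"
  unfolding shortest_def using word_cong_prepend[of w _ A R "[x]"] by force

lemma shortest_irreducible:
  assumes "shortest A R (u @ w)" "(u, v) \<in> word_cong A R" "length v < length u"
  shows False
  using assms word_cong_postpend[of u v A R w] unfolding shortest_def by force

context group
begin

definition sub_monoid :: "'a set \<Rightarrow> 'a monoid" where
  "sub_monoid A = \<lparr>carrier = A, monoid.mult = (\<otimes>), one = \<one>\<rparr>"

lemma sub_monoid_simps [simp]:
  "carrier (sub_monoid A) = A" "x \<otimes>\<^bsub>sub_monoid A\<^esub> y = x \<otimes> y" "\<one>\<^bsub>sub_monoid A\<^esub> = \<one>"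
  by (simp_all add: sub_monoid_def)

lemma group_sub_monoid: "subgroup A G \<Longrightarrow> group (sub_monoid A)"
  by (rule groupI)
    (auto simp: subgroup.m_closed subgroup.one_closed subgroup.mem_carrier m_assoc
      intro!: bexI[of _ "inv x" for x] subgroup.m_inv_closed)

text \<open>Ping-pong. A shortest word with at least two letters alternates between
  \<open>A - M\<close> and \<open>B - M\<close>; built up from its last letter, its value lands in P
  or in Q according to the first letter and so is not the unit.\<close>

lemma splits_as_amalgamI:
  assumes A: "subgroup A G" and B: "subgroup B G" and M: "M = A \<inter> B" "M \<noteq> A" "M \<noteq> B"
    and gen: "generate G (A \<union> B) = carrier G"
    and AP: "\<And>a. a \<in> A - M \<Longrightarrow> a \<in> P" "\<And>a g. a \<in> A - M \<Longrightarrow> g \<in> Q \<Longrightarrow> a \<otimes> g \<in> P"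
    and BQ: "\<And>b. b \<in> B - M \<Longrightarrow> b \<in> Q" "\<And>b g. b \<in> B - M \<Longrightarrow> g \<in> P \<Longrightarrow> b \<otimes> g \<in> Q"
    and PQ: "\<one> \<notin> P" "\<one> \<notin> Q"
  shows "splits_as_amalgam G M"
proof -
  let ?A = "sub_monoid A" and ?B = "sub_monoid B"
  let ?X = "amalgam_letters ?A ?B" and ?R = "amalgam_rels ?A ?B M id id"
  let ?f = "case_sum id id"
  let ?C = "word_cong ?X ?R"
  have AG: "A \<subseteq> carrier G" and BG: "B \<subseteq> carrier G" using A B by (auto dest: subgroup.subset)
  have X: "?X = Inl ` A \<union> Inr ` B" by (auto simp: amalgam_letters_def)
  have f: "?f \<in> ?X \<rightarrow> carrier G" using AG BG by (auto simp: X)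
  have merge: "([Inl a, Inl a'], [Inl (a \<otimes> a')]) \<in> ?C" if "a \<in> A" "a' \<in> A" for a a'
    using that A by (intro word_cong_rel) (auto simp: amalgam_rels_def table_rels_def X subgroup.m_closed)
  have merge': "([Inr b, Inr b'], [Inr (b \<otimes> b')]) \<in> ?C" if "b \<in> B" "b' \<in> B" for b b'
    using that B by (intro word_cong_rel) (auto simp: amalgam_rels_def table_rels_def X subgroup.m_closed)
  have unit: "([Inl \<one>], []) \<in> ?C" "([Inr \<one>], []) \<in> ?C"
    using A B by (auto intro!: word_cong_rel simp: amalgam_rels_def table_rels_def X subgroup.one_closed)
  have swap: "([Inl m], [Inr m]) \<in> ?C" if "m \<in> M" for m
    using that M(1) by (intro word_cong_rel) (auto simp: amalgam_rels_def X)
  have mergeA: "([x, y], [Inl (a \<otimes> a')]) \<in> ?C"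
    if "x \<in> ?X" "a \<in> A" "a' \<in> A" "([x], [Inl a]) \<in> ?C" "([y], [Inl a']) \<in> ?C" for x y a a'
  proof -
    have "([x, y], [x, Inl a']) \<in> ?C" "([x, Inl a'], [Inl a, Inl a']) \<in> ?C"
      using word_cong_prepend[OF that(5), of "[x]"] word_cong_postpend[OF that(4), of "[Inl a']"] that by (simp_all add: X)
    then show ?thesis using merge[OF that(2,3)] by (blast intro: word_cong.trans)
  qed
  have mergeB: "([x, y], [Inr (b \<otimes> b')]) \<in> ?C"
    if "x \<in> ?X" "b \<in> B" "b' \<in> B" "([x], [Inr b]) \<in> ?C" "([y], [Inr b']) \<in> ?C" for x y b b'
  proof -
    have "([x, y], [x, Inr b']) \<in> ?C" "([x, Inr b'], [Inr b, Inr b']) \<in> ?C"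
      using word_cong_prepend[OF that(5), of "[x]"] word_cong_postpend[OF that(4), of "[Inr b']"] that by (simp_all add: X)
    then show ?thesis using merge'[OF that(2,3)] by (blast intro: word_cong.trans)
  qed
  \<comment> \<open>Two adjacent letters that both represent elements of A, or both elements of B,
    would merge into one. Through \<open>swap\<close> a letter from M represents an element of
    either factor, so neither letter comes from M and the two come from different factors.\<close>
  have alt: "\<exists>a\<in>A - M. \<exists>b\<in>B - M. (x = Inl a \<and> y = Inr b) \<or> (x = Inr b \<and> y = Inl a)"
    if s: "shortest ?X ?R (x # y # w)" for x y w
  proof -
    have no: "([x, y], [z]) \<notin> ?C" for z
      using shortest_irreducible[of ?X ?R "[x, y]" w "[z]"] s by auto
    have xy: "x \<in> ?X" "y \<in> ?X" using s by (auto simp: shortest_def)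
    have self: "([z], [z]) \<in> ?C" if "z \<in> ?X" for z using that by (simp add: word_cong.refl)
    have nA: "\<not> (([x], [Inl a]) \<in> ?C \<and> ([y], [Inl a']) \<in> ?C)" if "a \<in> A" "a' \<in> A" for a a'
      using mergeA[OF xy(1) that] no by blast
    have nB: "\<not> (([x], [Inr b]) \<in> ?C \<and> ([y], [Inr b']) \<in> ?C)" if "b \<in> B" "b' \<in> B" for b b'
      using mergeB[OF xy(1) that] no by blast
    have M': "m \<in> M \<Longrightarrow> m \<in> A \<and> m \<in> B" for m using M(1) by simp
    show ?thesis
    proof (cases x; cases y)
      fix a b assume e: "x = Inl a" "y = Inr b"
      then have "a \<in> A" "b \<in> B" using xy by (auto simp: X)
      moreover have "a \<notin> M" "b \<notin> M"
        using nA[of a b] nB[of a b] swap word_cong.sym self xy M' calculation unfolding e by blast+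
      ultimately show ?thesis using e by blast
    next
      fix a b assume e: "x = Inr b" "y = Inl a"
      then have "a \<in> A" "b \<in> B" using xy by (auto simp: X)
      moreover have "a \<notin> M" "b \<notin> M"
        using nA[of b a] nB[of b a] swap word_cong.sym self xy M' calculation unfolding e by blast+
      ultimately show ?thesis using e by blast
    next
      fix a a' assume "x = Inl a" "y = Inl a'"
      then show ?thesis using nA[of a a'] self xy by (auto simp: X)
    next
      fix b b' assume "x = Inr b" "y = Inr b'"
      then show ?thesis using nB[of b b'] self xy by (auto simp: X)
    qed
  qed
  have pp: "(\<forall>a\<in>A - M. x = Inl a \<longrightarrow> word_val G ?f (x # w) \<in> P) \<and> (\<forall>b\<in>B - M. x = Inr b \<longrightarrow> word_val G ?f (x # w) \<in> Q)"
    if "shortest ?X ?R (x # w)" for x w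
    using that
  proof (induction w arbitrary: x)
    case Nil
    then show ?case using AP(1) BQ(1) AG BG by auto
  next
    case (Cons y w)
    note IH = Cons.IH[OF shortest_Cons[OF Cons.prems]]
    then show ?case using alt[OF Cons.prems] AP(2) BQ(2) by auto
  qed
  have mem: "x \<in> A \<Longrightarrow> x \<in> carrier G" "x \<in> B \<Longrightarrow> x \<in> carrier G" for x using AG BG by auto
  have rel: "word_val G ?f u = word_val G ?f v" if "(u, v) \<in> ?R" for u v
    using that M(1) by (auto simp: amalgam_rels_def table_rels_def m_assoc mem)
  have ker: "(w, []) \<in> ?C" if w: "w \<in> lists ?X" "word_val G ?f w = \<one>" for w
  proof -
    obtain w' where w': "(w, w') \<in> ?C" "shortest ?X ?R w'" using ex_shortest[OF w(1)] by blast
    have v: "word_val G ?f w' = \<one>" using word_val_cong[OF f rel w'(1)] w(2) by simp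
    have "w' = []"
    proof (cases w')
      case (Cons x u)
      have xX: "x \<in> ?X" using w'(2) Cons by (auto simp: shortest_def)
      show ?thesis
      proof (cases u)
        \<comment> \<open>A single letter may lie in M, about which P and Q say nothing; having
          value one, it is removed by the unit relation.\<close>
        case Nil
        then have "x = Inl \<one> \<or> x = Inr \<one>" using v Cons xX AG BG by (auto simp: X)
        then show ?thesis using shortest_irreducible[of ?X ?R w' "[]" "[]"] w'(2) unit Cons Nil by auto
      next
        case (Cons y z)
        then show ?thesis using alt[of x y z] pp[of x u] w'(2) v PQ \<open>w' = x # u\<close> by auto
      qed
    qed simp
    then show ?thesis using w'(1) by simp
  qed
  have "\<exists>w\<in>lists ?X. word_val G ?f w = g" if "g \<in> carrier G" for g
  proof -
    have "g \<in> generate G (A \<union> B)" using that gen by simp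
    then show ?thesis
    proof (induction rule: generate.induct)
      case one
      show ?case by (rule bexI[of _ "[]"]) auto
    next
      case (incl h)
      then show ?case using AG BG
        by (elim UnE) (rule bexI[of _ "[Inl h]"] bexI[of _ "[Inr h]"]; auto simp: X)+
    next
      case (inv h)
      then show ?case using AG BG A B
        by (elim UnE) (rule bexI[of _ "[Inl (inv h)]"] bexI[of _ "[Inr (inv h)]"];
            auto simp: X subgroup.m_inv_closed)+
    next
      case (eng h1 h2)
      then obtain u v where uv: "u \<in> lists ?X" "v \<in> lists ?X" "word_val G ?f u = h1" "word_val G ?f v = h2" by blast
      then show ?case using word_val_append[OF f uv(1,2)] by (intro bexI[of _ "u @ v"]) auto
    qed
  qed
  then have "\<exists>\<phi>. \<phi> \<in> iso (presented_monoid ?X ?R) G \<and> (\<forall>w\<in>lists ?X. \<phi> (?C `` {w}) = word_val G ?f w)"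
    using rel ker by (intro presented_monoid_iso[OF f]) auto
  then obtain \<phi> where \<phi>: "\<phi> \<in> iso (presented_monoid ?X ?R) G"
    "\<And>w. w \<in> lists ?X \<Longrightarrow> \<phi> (?C `` {w}) = word_val G ?f w"
    by auto
  have "\<phi> (amalgam_class ?A ?B M id id [Inl (id l)]) = l" if "l \<in> M" for l
    using \<phi>(2)[of "[Inl l]"] that M(1) AG by (auto simp: amalgam_class_def X)
  moreover have "id \<in> mon (G\<lparr>carrier := M\<rparr>) ?A" "id \<in> mon (G\<lparr>carrier := M\<rparr>) ?B"
    using M(1) by (auto simp: mon_def hom_def)
  moreover have "\<phi> \<in> iso (amalgam ?A ?B M id id) G" using \<phi>(1) by (simp add: amalgam_def)
  moreover have "id ` M \<noteq> carrier ?A" "id ` M \<noteq> carrier ?B" using M(2,3) by auto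
  ultimately show ?thesis
    unfolding splits_as_amalgam_def using group_sub_monoid A B by blast
qed

lemma conj_inv_conj:
  assumes "t \<in> carrier G" "a \<in> carrier G"
  shows "t \<otimes> (inv t \<otimes> a \<otimes> t) \<otimes> inv t = a"
proof -
  have "t \<otimes> (inv t \<otimes> a \<otimes> t) = a \<otimes> t" using assms by (simp add: m_assoc flip: m_assoc[of t "inv t"])
  then show ?thesis using assms by (simp add: m_assoc)
qed

text \<open>Ping-pong: P receives the values of shortest words beginning with the letter sent to
  \<open>inv t\<close>, Q those of words beginning with the letter sent to t. \<open>P3\<close> and
  \<open>Q3\<close> are the cases that remain once pinches are excluded. A word may begin with a
  letter of A, so the unit must be kept out of the A-translates of P and Q as well.\<close>

lemma splits_as_hnnI:
  assumes A: "subgroup A G" and MA: "M \<subseteq> A" and t: "t \<in> carrier G"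
    and conj: "\<And>m. m \<in> M \<Longrightarrow> t \<otimes> m \<otimes> inv t \<in> A"
    and gen: "generate G (insert t A) = carrier G"
    and P1: "\<And>a. a \<in> A \<Longrightarrow> inv t \<otimes> a \<in> P"
    and P2: "\<And>a g. a \<in> A \<Longrightarrow> g \<in> P \<Longrightarrow> inv t \<otimes> (a \<otimes> g) \<in> P"
    and P3: "\<And>a g. a \<in> A \<Longrightarrow> inv t \<otimes> a \<otimes> t \<notin> M \<Longrightarrow> g \<in> Q \<Longrightarrow> inv t \<otimes> (a \<otimes> g) \<in> P"
    and Q1: "\<And>a. a \<in> A \<Longrightarrow> t \<otimes> a \<in> Q"
    and Q2: "\<And>a g. a \<in> A \<Longrightarrow> g \<in> Q \<Longrightarrow> t \<otimes> (a \<otimes> g) \<in> Q"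
    and Q3: "\<And>a g. a \<in> A - M \<Longrightarrow> g \<in> P \<Longrightarrow> t \<otimes> (a \<otimes> g) \<in> Q"
    and PQ: "\<And>a g. a \<in> A \<Longrightarrow> g \<in> P \<union> Q \<Longrightarrow> a \<otimes> g \<noteq> \<one>"
    and PQG: "P \<subseteq> carrier G" "Q \<subseteq> carrier G"
  shows "splits_as_hnn G M"
proof -
  let ?A = "sub_monoid A" and ?j = "\<lambda>m. t \<otimes> m \<otimes> inv t"
  let ?X = "hnn_letters ?A" and ?R = "hnn_rels ?A M id ?j"
  \<comment> \<open>The presentation reads \<open>t^-1 i(l) t = j(l)\<close>, with M to be embedded
    identically by i. Since \<open>j m\<close> is \<open>t m t^-1\<close> here, the stable letter
    has to be sent to \<open>inv t\<close>.\<close>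
  let ?f = "case_hnn_letter id (inv t) t"
  let ?C = "word_cong ?X ?R"
  have AG: "A \<subseteq> carrier G" using A by (auto dest: subgroup.subset)
  have oneA: "\<one> \<in> A" using A by (rule subgroup.one_closed)
  have X: "?X = Base ` A \<union> {Stable, Stable_Inv}" by (auto simp: hnn_letters_def)
  have f: "?f \<in> ?X \<rightarrow> carrier G" using AG t by (auto simp: X)
  have merge: "([Base a, Base a'], [Base (a \<otimes> a')]) \<in> ?C" if "a \<in> A" "a' \<in> A" for a a'
    using that A by (intro word_cong_rel) (auto simp: hnn_rels_def table_rels_def X subgroup.m_closed)
  have unit: "([Base \<one>], []) \<in> ?C"
    using oneA by (auto intro!: word_cong_rel simp: hnn_rels_def table_rels_def X)
  have canc: "([Stable, Stable_Inv], []) \<in> ?C" "([Stable_Inv, Stable], []) \<in> ?C"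
    by (auto intro!: word_cong_rel simp: hnn_rels_def X)
  have pinch: "([Stable_Inv, Base m, Stable], [Base (?j m)]) \<in> ?C" if "m \<in> M" for m
    using that MA conj by (intro word_cong_rel) (auto simp: hnn_rels_def X)
  \<comment> \<open>The presentation contains only one direction of the pinch; conjugating it by the
    stable letter gives the other.\<close>
  have pinch': "([Stable, Base (?j m), Stable_Inv], [Base m]) \<in> ?C" if m: "m \<in> M" for m
  proof -
    have L: "Stable \<in> ?X" "Stable_Inv \<in> ?X" "Base m \<in> ?X" using m MA by (auto simp: X)
    have "([Stable, Base (?j m), Stable_Inv], [Stable, Stable_Inv, Base m, Stable, Stable_Inv]) \<in> ?C"
      using word_cong_append[OF pinch[OF m, THEN word_cong.sym], of "[Stable]" "[Stable_Inv]"] L by simp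
    moreover have "([Stable, Stable_Inv, Base m, Stable, Stable_Inv], [Base m, Stable, Stable_Inv]) \<in> ?C"
      using word_cong_postpend[OF canc(1), of "[Base m, Stable, Stable_Inv]"] L by simp
    moreover have "([Base m, Stable, Stable_Inv], [Base m]) \<in> ?C"
      using word_cong_prepend[OF canc(1), of "[Base m]"] L by simp
    ultimately show ?thesis by (blast intro: word_cong.trans)
  qed
  have rel: "word_val G ?f u = word_val G ?f v" if "(u, v) \<in> ?R" for u v
  proof -
    have "m \<in> carrier G" if "m \<in> M" for m using that MA AG by auto
    then show ?thesis using that AG t by (auto simp: hnn_rels_def table_rels_def m_assoc subsetD[OF AG])
  qed
  have no: False if "shortest ?X ?R (u @ w)" "(u, v) \<in> ?C" "length v < length u" for u v w
    using that by (rule shortest_irreducible)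
  have tl: "shortest ?X ?R u" if "shortest ?X ?R (x # u)" for x u
    using that by (rule shortest_Cons)
  have Base_Base: False if "shortest ?X ?R (Base a # Base b # w)" for a b w
    using that merge[of a b] no[of "[Base a, Base b]" w "[Base (a \<otimes> b)]"] by (auto simp: shortest_def X)
  \<comment> \<open>One argument for both stable letters: \<open>s'\<close> is the inverse of s, and
    P', Q' are the sets attached to s and \<open>s'\<close>. A letter of A may stand between two
    stable letters, so the hypotheses range over shorter words and not just the tail.\<close>
  have prefix: "word_val G ?f (s # u) \<in> P'"
    if s: "shortest ?X ?R (s # u)" and sG: "?f s \<in> carrier G"
      and s': "s' \<noteq> s" "\<And>x. x = s \<or> x = s' \<or> x \<in> range Base" "([s, s'], []) \<in> ?C"
      and IH: "\<And>v. shortest ?X ?R (s # v) \<Longrightarrow> length v < length u \<Longrightarrow> word_val G ?f (s # v) \<in> P'"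
        "\<And>v. shortest ?X ?R (s' # v) \<Longrightarrow> length v < length u \<Longrightarrow> word_val G ?f (s' # v) \<in> Q'"
      and P1: "\<And>a. a \<in> A \<Longrightarrow> ?f s \<otimes> a \<in> P'"
      and P2: "\<And>a g. a \<in> A \<Longrightarrow> g \<in> P' \<Longrightarrow> ?f s \<otimes> (a \<otimes> g) \<in> P'"
      and P3: "\<And>a g. a \<in> A \<Longrightarrow> (\<And>z. ([s, Base a, s'], [z]) \<notin> ?C) \<Longrightarrow> g \<in> Q' \<Longrightarrow> ?f s \<otimes> (a \<otimes> g) \<in> P'"
      and P'G: "P' \<subseteq> carrier G"
    for s s' u P' Q'
  proof -
    have su: "shortest ?X ?R u" using tl[OF s] .
    consider "u = []" | a where "u = [Base a]" | a b v where "u = Base a # Base b # v"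
      | a v where "u = Base a # s # v" | a v where "u = Base a # s' # v" | v where "u = s # v" | v where "u = s' # v"
      using s'(2) by (metis (no_types, opaque_lifting) list.exhaust rangeE)
    then show ?thesis
    proof cases
      case 1
      then show ?thesis using P1[OF oneA] sG by simp
    next
      case 2
      then have "a \<in> A" using su by (auto simp: shortest_def X)
      then show ?thesis using P1 2 AG by auto
    next
      case 3
      then show ?thesis using Base_Base[of a b v] su by blast
    next
      case 4
      then have "a \<in> A" using su by (auto simp: shortest_def X)
      then show ?thesis using P2 IH(1)[of v] tl[of "Base a" "s # v"] su 4 by simp
    next
      case 5
      then have "a \<in> A" using su by (auto simp: shortest_def X)
      moreover have "([s, Base a, s'], [z]) \<notin> ?C" for z
        using no[of "[s, Base a, s']" v "[z]"] s 5 by auto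
      ultimately show ?thesis using P3 IH(2)[of v] tl[of "Base a" "s' # v"] su 5 by simp
    next
      case 6
      then have v: "word_val G ?f u \<in> P'" using IH(1)[of v] su by simp
      then show ?thesis using P2[OF oneA v] P'G by auto
    next
      case 7
      then show ?thesis using no[of "[s, s']" v "[]"] s s'(3) by simp
    qed
  qed
  have pp: "(\<forall>u. w = Stable # u \<longrightarrow> word_val G ?f w \<in> P) \<and> (\<forall>u. w = Stable_Inv # u \<longrightarrow> word_val G ?f w \<in> Q)"
    if "shortest ?X ?R w" for w
    using that
  proof (induction w rule: length_induct)
    case (1 w)
    note s = \<open>shortest ?X ?R w\<close>
    have letters: "x = Stable \<or> x = Stable_Inv \<or> x \<in> range Base" for x by (cases x) auto
    have "word_val G ?f (Stable # u) \<in> P" if w: "w = Stable # u" for u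
    proof (rule prefix[where s' = Stable_Inv and Q' = Q])
      fix a g assume a: "a \<in> A" and irr: "\<And>z. ([Stable, Base a, Stable_Inv], [z]) \<notin> ?C" and g: "g \<in> Q"
      have "inv t \<otimes> a \<otimes> t \<notin> M"
      proof
        assume m: "inv t \<otimes> a \<otimes> t \<in> M"
        have "?j (inv t \<otimes> a \<otimes> t) = a" using conj_inv_conj a AG t by auto
        then show False using pinch'[OF m] irr by simp
      qed
      then show "?f Stable \<otimes> (a \<otimes> g) \<in> P" using P3[OF a _ g] by simp
    next
      show "word_val G ?f (Stable # v) \<in> P" if "shortest ?X ?R (Stable # v)" "length v < length u" for v
        using "1.IH"[rule_format, of "Stable # v"] that w by simp
      show "word_val G ?f (Stable_Inv # v) \<in> Q" if "shortest ?X ?R (Stable_Inv # v)" "length v < length u" for v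
        using "1.IH"[rule_format, of "Stable_Inv # v"] that w by simp
      show "x = Stable \<or> x = Stable_Inv \<or> x \<in> range Base" for x by (rule letters)
      show "P \<subseteq> carrier G" by (rule PQG)
    qed (use s w P1 P2 canc t in auto)
    moreover have "word_val G ?f (Stable_Inv # u) \<in> Q" if w: "w = Stable_Inv # u" for u
    proof (rule prefix[where s' = Stable and Q' = P])
      fix a g assume a: "a \<in> A" and irr: "\<And>z. ([Stable_Inv, Base a, Stable], [z]) \<notin> ?C" and g: "g \<in> P"
      have "a \<notin> M" using pinch[of a] irr by auto
      then show "?f Stable_Inv \<otimes> (a \<otimes> g) \<in> Q" using Q3[of a g] a g by simp
    next
      show "word_val G ?f (Stable_Inv # v) \<in> Q" if "shortest ?X ?R (Stable_Inv # v)" "length v < length u" for v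
        using "1.IH"[rule_format, of "Stable_Inv # v"] that w by simp
      show "word_val G ?f (Stable # v) \<in> P" if "shortest ?X ?R (Stable # v)" "length v < length u" for v
        using "1.IH"[rule_format, of "Stable # v"] that w by simp
      show "x = Stable_Inv \<or> x = Stable \<or> x \<in> range Base" for x using letters by blast
      show "Q \<subseteq> carrier G" by (rule PQG)
    qed (use s w Q1 Q2 canc t in auto)
    ultimately show ?case by blast
  qed
  have ker: "(w, []) \<in> ?C" if w: "w \<in> lists ?X" "word_val G ?f w = \<one>" for w
  proof -
    obtain w' where w': "(w, w') \<in> ?C" "shortest ?X ?R w'" using ex_shortest[OF w(1)] by blast
    have v: "word_val G ?f w' = \<one>" using word_val_cong[OF f rel w'(1)] w(2) by simp
    have nPQ: "word_val G ?f u \<noteq> \<one>" if "word_val G ?f u \<in> P \<union> Q" for u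
      using PQ[OF oneA that] that PQG by auto
    have "w' = []"
    proof (cases w')
      case (Cons x u)
      have su: "shortest ?X ?R u" using w'(2) Cons tl by simp
      show ?thesis
      proof (cases x)
        case Stable
        then show ?thesis using pp[OF w'(2)] nPQ[of w'] v Cons by auto
      next
        case Stable_Inv
        then show ?thesis using pp[OF w'(2)] nPQ[of w'] v Cons by auto
      next
        case (Base a)
        then have a: "a \<in> A" using w'(2) Cons by (auto simp: shortest_def X)
        show ?thesis
        proof (cases u)
          case Nil
          then have "a = \<one>" using v Cons Base a AG by auto
          then show ?thesis using no[of w' "[]" "[]"] w'(2) unit Cons Nil Base by auto
        next
          case (Cons y z)
          show ?thesis
          proof (cases y)
            case (Base b)
            then show ?thesis using Base_Base w'(2) \<open>w' = x # u\<close> Cons \<open>x = Base a\<close> by simp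
          next
            case Stable
            then have "word_val G ?f u \<in> P \<union> Q" using pp[OF su] Cons by auto
            then show ?thesis using PQ[OF a] v \<open>w' = x # u\<close> \<open>x = Base a\<close> by auto
          next
            case Stable_Inv
            then have "word_val G ?f u \<in> P \<union> Q" using pp[OF su] Cons by auto
            then show ?thesis using PQ[OF a] v \<open>w' = x # u\<close> \<open>x = Base a\<close> by auto
          qed
        qed
      qed
    qed simp
    then show ?thesis using w'(1) by simp
  qed
  have "\<exists>w\<in>lists ?X. word_val G ?f w = g" if "g \<in> carrier G" for g
  proof -
    have "g \<in> generate G (insert t A)" using that gen by simp
    then show ?thesis
    proof (induction rule: generate.induct)
      case one
      show ?case by (rule bexI[of _ "[]"]) auto
    next
      case (incl h)
      then show ?case using AG t
        by (elim insertE) (rule bexI[of _ "[Stable_Inv]"] bexI[of _ "[Base h]"]; auto simp: X)+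
    next
      case (inv h)
      then show ?case using AG A t
        by (elim insertE) (rule bexI[of _ "[Stable]"] bexI[of _ "[Base (inv h)]"];
            auto simp: X subgroup.m_inv_closed)+
    next
      case (eng h1 h2)
      then obtain u v where uv: "u \<in> lists ?X" "v \<in> lists ?X" "word_val G ?f u = h1" "word_val G ?f v = h2" by blast
      then show ?case using word_val_append[OF f uv(1,2)] by (intro bexI[of _ "u @ v"]) auto
    qed
  qed
  then have "\<exists>\<phi>. \<phi> \<in> iso (presented_monoid ?X ?R) G \<and> (\<forall>w\<in>lists ?X. \<phi> (?C `` {w}) = word_val G ?f w)"
    using rel ker by (intro presented_monoid_iso[OF f]) auto
  then obtain \<phi> where \<phi>: "\<phi> \<in> iso (presented_monoid ?X ?R) G"
    "\<And>w. w \<in> lists ?X \<Longrightarrow> \<phi> (?C `` {w}) = word_val G ?f w"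
    by auto
  have "\<phi> (hnn_class ?A M id ?j [Base (id l)]) = l" if "l \<in> M" for l
  proof -
    have "l \<in> A" "l \<in> carrier G" using that MA AG by auto
    then show ?thesis using \<phi>(2)[of "[Base l]"] by (simp add: hnn_class_def X)
  qed
  moreover have "id \<in> mon (G\<lparr>carrier := M\<rparr>) ?A"
    using MA by (auto simp: mon_def hom_def)
  moreover have "?j \<in> mon (G\<lparr>carrier := M\<rparr>) ?A"
  proof -
    have MG: "m \<in> carrier G" if "m \<in> M" for m using that MA AG by auto
    have "?j (x \<otimes> y) = ?j x \<otimes> ?j y" if "x \<in> M" "y \<in> M" for x y
      using MG[OF that(1)] MG[OF that(2)] t by (simp add: m_assoc inv_solve_left flip: m_assoc[of "inv t" t])
    moreover have "inj_on ?j M" using MG t by (auto intro!: inj_onI)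
    ultimately show ?thesis using conj by (auto simp: mon_def hom_def)
  qed
  moreover have "\<phi> \<in> iso (hnn_extension ?A M id ?j) G" using \<phi>(1) by (simp add: hnn_extension_def)
  ultimately show ?thesis
    unfolding splits_as_hnn_def using group_sub_monoid[OF A] by blast
qed

end

section \<open>Discrete pocsets as trees; splittings from a single orbit of edges\<close>

section \<open>Groups acting on nested families of half-spaces\<close>

text \<open>The oriented edges of a tree, ordered by inclusion of half-trees, an edge standing for
  the half-tree that contains its initial vertex. \<open>proper\<close> excludes empty half-trees
  and \<open>finite_interval\<close> makes distances finite.\<close>

locale pocset =
  fixes E :: "'e set" and le :: "'e \<Rightarrow> 'e \<Rightarrow> bool" and star :: "'e \<Rightarrow> 'e"
  assumes le_refl: "x \<in> E \<Longrightarrow> le x x"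
    and le_antisym: "x \<in> E \<Longrightarrow> y \<in> E \<Longrightarrow> le x y \<Longrightarrow> le y x \<Longrightarrow> x = y"
    and le_trans: "x \<in> E \<Longrightarrow> y \<in> E \<Longrightarrow> z \<in> E \<Longrightarrow> le x y \<Longrightarrow> le y z \<Longrightarrow> le x z"
    and star_in [simp]: "x \<in> E \<Longrightarrow> star x \<in> E"
    and star_star [simp]: "x \<in> E \<Longrightarrow> star (star x) = x"
    and le_star: "x \<in> E \<Longrightarrow> y \<in> E \<Longrightarrow> le x y \<Longrightarrow> le (star y) (star x)"
    and nested: "x \<in> E \<Longrightarrow> y \<in> E \<Longrightarrow>
      le x y \<or> le x (star y) \<or> le (star x) y \<or> le (star x) (star y)"
    and proper: "x \<in> E \<Longrightarrow> y \<in> E \<Longrightarrow> le x y \<Longrightarrow> le x (star y) \<Longrightarrow> False"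
    and finite_interval: "x \<in> E \<Longrightarrow> y \<in> E \<Longrightarrow> finite {z \<in> E. le x z \<and> le z y}"
begin

definition lt :: "'e \<Rightarrow> 'e \<Rightarrow> bool" where
  "lt x y \<longleftrightarrow> le x y \<and> x \<noteq> y"

definition cov :: "'e \<Rightarrow> 'e \<Rightarrow> bool" where
  "cov x y \<longleftrightarrow> lt x y \<and> (\<forall>z\<in>E. \<not> (lt x z \<and> lt z y))"

text \<open>Reading half-spaces as oriented edges of a tree, this says that \<open>x\<close> and \<open>y\<close> have the same
  initial vertex.\<close>

definition adj :: "'e \<Rightarrow> 'e \<Rightarrow> bool" where
  "adj x y \<longleftrightarrow> x = y \<or> cov (star x) y"

lemma proper': "x \<in> E \<Longrightarrow> y \<in> E \<Longrightarrow> le x y \<Longrightarrow> le (star x) y \<Longrightarrow> False"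
  using proper[of "star y" x] le_star[of x y] le_star[of "star x" y] by simp

lemma lt_imp_le: "lt x y \<Longrightarrow> le x y" by (simp add: lt_def)

lemma lt_le_trans: "x \<in> E \<Longrightarrow> y \<in> E \<Longrightarrow> z \<in> E \<Longrightarrow> lt x y \<Longrightarrow> le y z \<Longrightarrow> lt x z"
  unfolding lt_def using le_trans le_antisym by metis

lemma le_lt_trans: "x \<in> E \<Longrightarrow> y \<in> E \<Longrightarrow> z \<in> E \<Longrightarrow> le x y \<Longrightarrow> lt y z \<Longrightarrow> lt x z"
  unfolding lt_def using le_trans le_antisym by metis

lemma star_inject: "x \<in> E \<Longrightarrow> y \<in> E \<Longrightarrow> star x = star y \<longleftrightarrow> x = y"
  using star_star by metis

lemma lt_star: "x \<in> E \<Longrightarrow> y \<in> E \<Longrightarrow> lt x y \<Longrightarrow> lt (star y) (star x)"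
  unfolding lt_def using le_star star_inject by blast

lemma cov_star:
  assumes "x \<in> E" "y \<in> E" "cov x y"
  shows "cov (star y) (star x)"
  unfolding cov_def
proof (intro conjI ballI notI)
  show "lt (star y) (star x)" using assms lt_star by (simp add: cov_def)
next
  fix z assume "z \<in> E" "lt (star y) z \<and> lt z (star x)"
  then have "lt (star z) y" "lt x (star z)"
    using lt_star[of "star y" z] lt_star[of z "star x"] assms by simp_all
  then show False using assms \<open>z \<in> E\<close> by (auto simp: cov_def)
qed

lemma star_neq: "x \<in> E \<Longrightarrow> star x \<noteq> x"
  using proper[of x x] le_refl[of x] by auto

lemma adj_refl: "adj x x" by (simp add: adj_def)

lemma adj_sym: "x \<in> E \<Longrightarrow> y \<in> E \<Longrightarrow> adj x y \<Longrightarrow> adj y x"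
  unfolding adj_def using cov_star[of "star x" y] by auto

text \<open>This is what makes vertices exist. Among the ways in which x and z can be nested,
  \<open>le x z\<close> puts \<open>star x\<close> strictly between \<open>star z\<close> and y,
  \<open>le (star x) (star z)\<close> puts \<open>star z\<close> strictly between
  \<open>star x\<close> and y, and \<open>le x (star z)\<close> puts x and \<open>star x\<close>
  both below y. So \<open>star x\<close> is below z; an element strictly between them is refuted by
  comparing it with y.\<close>

lemma adj_trans:
  assumes xyz: "x \<in> E" "y \<in> E" "z \<in> E" and "adj x y" "adj y z"
  shows "adj x z"
proof (cases "x = y \<or> y = z \<or> x = z")
  case False
  then have c: "cov (star x) y" "cov (star y) z" using assms by (auto simp: adj_def)
  then have c': "cov (star z) y" using cov_star[of "star y" z] xyz by simp
  have l: "lt (star x) y" "lt (star y) z" "lt (star z) y" using c c' by (auto simp: cov_def)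
  have "\<not> le x z"
  proof
    assume "le x z"
    then have "lt (star z) (star x)" using le_star[of x z] star_inject[of z x] xyz False by (auto simp: lt_def)
    then show False using c' l(1) xyz by (auto simp: cov_def)
  qed
  moreover have "\<not> le (star x) (star z)"
  proof
    assume "le (star x) (star z)"
    then have "lt (star x) (star z)" using star_inject[of x z] xyz False by (auto simp: lt_def)
    then show False using c(1) l(3) xyz by (auto simp: cov_def)
  qed
  moreover have "\<not> le x (star z)"
    using le_trans[of x "star z" y] proper'[of x y] l xyz by (auto simp: lt_def)
  ultimately have "le (star x) z" using nested[of x z] xyz by auto
  moreover have "star x \<noteq> z"
    using l proper'[of z y] xyz by (auto simp: lt_def)
  ultimately have "lt (star x) z" by (simp add: lt_def)
  moreover have False if w: "w \<in> E" "lt (star x) w" "lt w z" for w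
  proof -
    consider "le w y" | "le w (star y)" | "le (star w) y" | "le (star w) (star y)"
      using nested[of w y] w xyz by blast
    then show False
    proof cases
      case 1
      then have "w = y" using c(1) w by (auto simp: cov_def lt_def)
      then show False using w(3) l(2) proper'[of y z] xyz by (auto simp: lt_def)
    next
      case 2
      then show False
        using le_trans[of "star x" w "star y"] w l(1) proper[of "star x" y] xyz by (auto simp: lt_def)
    next
      case 3
      then have "le (star y) w" using le_star[of "star w" y] w xyz by simp
      then have "w = star y" using c(2) w by (auto simp: cov_def lt_def)
      then show False using w(2) l(1) proper[of "star x" y] xyz by (auto simp: lt_def)
    next
      case 4
      then have "le y w" using le_star[of "star w" "star y"] w xyz by simp
      then have "le y z" using le_trans[of y w z] w xyz by (simp add: lt_def)
      then show False using l(2) proper'[of y z] xyz by (auto simp: lt_def)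
    qed
  qed
  ultimately have "cov (star x) z" by (auto simp: cov_def)
  then show ?thesis by (simp add: adj_def)
qed (use assms in \<open>auto simp: adj_refl\<close>)

lemma card_interval_less:
  assumes "x \<in> E" "y \<in> E" "z \<in> E" "lt x z" "lt z y"
  shows "card {w \<in> E. le x w \<and> le w z} < card {w \<in> E. le x w \<and> le w y}"
    and "card {w \<in> E. le z w \<and> le w y} < card {w \<in> E. le x w \<and> le w y}"
proof -
  have "{w \<in> E. le x w \<and> le w z} \<subseteq> {w \<in> E. le x w \<and> le w y}"
    using le_trans[OF _ assms(3,2) _ lt_imp_le[OF assms(5)]] by blast
  moreover have "y \<in> {w \<in> E. le x w \<and> le w y}" "y \<notin> {w \<in> E. le x w \<and> le w z}"
    using assms le_refl[of y] le_trans[of x z y] le_antisym[of z y] by (auto simp: lt_def)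
  ultimately show "card {w \<in> E. le x w \<and> le w z} < card {w \<in> E. le x w \<and> le w y}"
    using finite_interval[OF assms(1,2)] by (intro psubset_card_mono) blast+
  have "{w \<in> E. le z w \<and> le w y} \<subseteq> {w \<in> E. le x w \<and> le w y}"
    using le_trans[OF assms(1,3) _ lt_imp_le[OF assms(4)]] by blast
  moreover have "x \<in> {w \<in> E. le x w \<and> le w y}" "x \<notin> {w \<in> E. le z w \<and> le w y}"
    using assms le_refl[of x] le_trans[of x z y] le_antisym[of z x] by (auto simp: lt_def)
  ultimately show "card {w \<in> E. le z w \<and> le w y} < card {w \<in> E. le x w \<and> le w y}"
    using finite_interval[OF assms(1,2)] by (intro psubset_card_mono) blast+
qed

text \<open>Discreteness as an induction principle: an interval is split at interior points until
  only covering pairs remain.\<close>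

lemma chain_induct:
  assumes "x \<in> E" "y \<in> E" "le x y" "P x"
    and step: "\<And>z w. z \<in> E \<Longrightarrow> w \<in> E \<Longrightarrow> P z \<Longrightarrow> cov z w \<Longrightarrow> P w"
  shows "P y"
  using assms(1-4)
proof (induction "card {w \<in> E. le x w \<and> le w y}" arbitrary: x y rule: less_induct)
  case less
  show ?case
  proof (cases "x = y \<or> cov x y")
    case True
    then show ?thesis using less.prems step by blast
  next
    case False
    then obtain z where z: "z \<in> E" "lt x z" "lt z y"
      using less.prems unfolding cov_def lt_def by blast
    have "P z"
      using less.hyps[of x z] card_interval_less(1)[of x y z] less.prems z by (simp add: lt_def)
    then show ?thesis
      using less.hyps[of z y] card_interval_less(2)[of x y z] less.prems z by (simp add: lt_def)
  qed
qed

lemma ex_cov: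
  assumes "x \<in> E" "y \<in> E" "lt x y"
  shows "\<exists>z\<in>E. cov z y"
  using assms
proof (induction "card {w \<in> E. le x w \<and> le w y}" arbitrary: x rule: less_induct)
  case less
  show ?case
  proof (cases "cov x y")
    case True
    then show ?thesis using less.prems by blast
  next
    case False
    then obtain z where z: "z \<in> E" "lt x z" "lt z y"
      using less.prems unfolding cov_def by blast
    then show ?thesis
      using less.hyps[of z] card_interval_less(2)[of x y z] less.prems by simp
  qed
qed

end

text \<open>A single orbit of edges up to orientation. The last two assumptions say that neither end
  of e is a leaf; otherwise a factor of the amalgam could coincide with the edge group.\<close>

locale pocset_action = pocset E le star + group G
  for E :: "'e set" and le :: "'e \<Rightarrow> 'e \<Rightarrow> bool" and star :: "'e \<Rightarrow> 'e"
    and G :: "('a, 'm) monoid_scheme" (structure) +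
  fixes act :: "'a \<Rightarrow> 'e \<Rightarrow> 'e" and e :: 'e
  assumes act_in [simp]: "g \<in> carrier G \<Longrightarrow> x \<in> E \<Longrightarrow> act g x \<in> E"
    and act_one [simp]: "x \<in> E \<Longrightarrow> act \<one> x = x"
    and act_mult: "g \<in> carrier G \<Longrightarrow> h \<in> carrier G \<Longrightarrow> x \<in> E \<Longrightarrow> act (g \<otimes> h) x = act g (act h x)"
    and act_le: "g \<in> carrier G \<Longrightarrow> x \<in> E \<Longrightarrow> y \<in> E \<Longrightarrow> le x y \<Longrightarrow> le (act g x) (act g y)"
    and act_star: "g \<in> carrier G \<Longrightarrow> x \<in> E \<Longrightarrow> act g (star x) = star (act g x)"
    and e_in [simp]: "e \<in> E"
    and orbit: "x \<in> E \<Longrightarrow> \<exists>g\<in>carrier G. x = act g e \<or> x = act g (star e)"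
    and below_e: "\<exists>x\<in>E. le x e \<and> x \<noteq> e"
    and below_star_e: "\<exists>x\<in>E. le x (star e) \<and> x \<noteq> star e"
begin

definition edge_stab :: "'a set" where
  "edge_stab = {g \<in> carrier G. act g e = e}"

text \<open>Stabiliser of the initial vertex of x; vertices are \<open>adj\<close>-classes and are
  never named.\<close>

definition vertex_stab :: "'e \<Rightarrow> 'a set" where
  "vertex_stab x = {g \<in> carrier G. adj x (act g x)}"

lemma act_inv [simp]:
  assumes "g \<in> carrier G" "x \<in> E"
  shows "act (inv g) (act g x) = x" "act g (act (inv g) x) = x"
  using assms act_mult[of "inv g" g x] act_mult[of g "inv g" x] by simp_all

lemma act_inj: "g \<in> carrier G \<Longrightarrow> x \<in> E \<Longrightarrow> y \<in> E \<Longrightarrow> act g x = act g y \<longleftrightarrow> x = y"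
  using act_inv by metis

lemma act_lt: "g \<in> carrier G \<Longrightarrow> x \<in> E \<Longrightarrow> y \<in> E \<Longrightarrow> lt x y \<Longrightarrow> lt (act g x) (act g y)"
  unfolding lt_def using act_le act_inj by blast

lemma act_cov:
  assumes "g \<in> carrier G" "x \<in> E" "y \<in> E" "cov x y"
  shows "cov (act g x) (act g y)"
  unfolding cov_def
proof (intro conjI ballI notI)
  show "lt (act g x) (act g y)" using assms act_lt by (simp add: cov_def)
next
  fix z assume "z \<in> E" "lt (act g x) z \<and> lt z (act g y)"
  then have "lt x (act (inv g) z)" "lt (act (inv g) z) y"
    using act_lt[of "inv g" "act g x" z] act_lt[of "inv g" z "act g y"] assms by simp_all
  then show False using assms \<open>z \<in> E\<close> by (auto simp: cov_def)
qed

lemma act_adj: "g \<in> carrier G \<Longrightarrow> x \<in> E \<Longrightarrow> y \<in> E \<Longrightarrow> adj x y \<Longrightarrow> adj (act g x) (act g y)"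
  unfolding adj_def using act_cov[of g "star x" y] act_star[of g x] by auto

lemma subgroup_edge_stab: "subgroup edge_stab G"
proof (rule subgroupI)
  show "edge_stab \<subseteq> carrier G" by (auto simp: edge_stab_def)
  show "edge_stab \<noteq> {}" using one_closed by (auto simp: edge_stab_def)
next
  fix a assume "a \<in> edge_stab"
  then show "inv a \<in> edge_stab" using act_inv(1)[of a e] by (simp add: edge_stab_def)
next
  fix a b assume "a \<in> edge_stab" "b \<in> edge_stab"
  then show "a \<otimes> b \<in> edge_stab" by (simp add: edge_stab_def act_mult)
qed

lemma subgroup_vertex_stab:
  assumes x: "x \<in> E"
  shows "subgroup (vertex_stab x) G"
proof (rule subgroupI)
  show "vertex_stab x \<subseteq> carrier G" by (auto simp: vertex_stab_def)
  show "vertex_stab x \<noteq> {}" using one_closed x by (auto simp: vertex_stab_def adj_refl intro!: exI[of _ \<one>])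
next
  fix a assume "a \<in> vertex_stab x"
  then show "inv a \<in> vertex_stab x"
    using act_adj[of "inv a" x "act a x"] adj_sym[of "act (inv a) x" x] x by (simp add: vertex_stab_def)
next
  fix a b assume ab: "a \<in> vertex_stab x" "b \<in> vertex_stab x"
  then have G: "a \<in> carrier G" "b \<in> carrier G" by (simp_all add: vertex_stab_def)
  have "adj (act a x) (act a (act b x))" using act_adj ab x by (simp add: vertex_stab_def)
  then have "adj x (act a (act b x))"
    using adj_trans[of x "act a x" "act a (act b x)"] ab G x by (simp add: vertex_stab_def)
  then show "a \<otimes> b \<in> vertex_stab x" using G x by (simp add: vertex_stab_def act_mult)
qed

lemma edge_stab_star: "g \<in> carrier G \<Longrightarrow> act g (star e) = star e \<longleftrightarrow> g \<in> edge_stab"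
  by (simp add: edge_stab_def act_star star_inject)

lemma edge_stab_subset: "edge_stab \<subseteq> vertex_stab e" "edge_stab \<subseteq> vertex_stab (star e)"
proof -
  have "act g e = e" "act g (star e) = star e" if "g \<in> edge_stab" for g
    using that edge_stab_star[of g] by (auto simp: edge_stab_def)
  then show "edge_stab \<subseteq> vertex_stab e" "edge_stab \<subseteq> vertex_stab (star e)"
    by (auto simp: vertex_stab_def adj_refl) (auto simp: edge_stab_def)
qed

text \<open>The far half-trees of two distinct edges with the same initial vertex are disjoint, so g
  carries the far half-tree of x into x. This is the basic ping-pong move.\<close>

lemma vertex_stab_moves:
  assumes "x \<in> E" "g \<in> vertex_stab x" "act g x \<noteq> x"
  shows "lt (act g (star x)) x"
proof -
  have g: "g \<in> carrier G" using assms by (simp add: vertex_stab_def)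
  have "cov (star x) (act g x)" using assms by (auto simp: vertex_stab_def adj_def)
  then have "lt (star x) (act g x)" by (simp add: cov_def)
  then have "lt (star (act g x)) x" using lt_star[of "star x" "act g x"] assms g by simp
  then show ?thesis using act_star g assms by simp
qed

text \<open>Connectedness of the tree: a subgroup whose translates of \<open>e\<close> and \<open>star e\<close> contain all
  neighbours of \<open>e\<close> and \<open>star e\<close> moves them everywhere.\<close>

lemma orbit_subgroup:
  assumes J: "subgroup J G"
    and nb: "\<And>x. x \<in> E \<Longrightarrow> adj e x \<or> adj (star e) x \<Longrightarrow> \<exists>j\<in>J. x = act j e \<or> x = act j (star e)"
    and y: "y \<in> E"
  shows "\<exists>j\<in>J. y = act j e \<or> y = act j (star e)"
proof -
  define T where "T y \<longleftrightarrow> (\<exists>j\<in>J. y = act j e \<or> y = act j (star e))" for y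
  have JG: "j \<in> carrier G" if "j \<in> J" for j using that J by (rule subgroup.mem_carrier[rotated])
  have Te: "T e" "T (star e)" using subgroup.one_closed[OF J] by (auto simp: T_def intro!: bexI[of _ \<one>])
  have Tstar: "T (star y)" if "T y" "y \<in> E" for y
    using that act_star JG by (auto simp: T_def)
  have step: "T w" if zw: "z \<in> E" "w \<in> E" "T z" "cov z w" for z w
  proof -
    obtain j where j: "j \<in> J" "star z = act j e \<or> star z = act j (star e)"
      using Tstar[OF zw(3,1)] by (auto simp: T_def)
    have jG: "j \<in> carrier G" using JG j by simp
    have "adj (star z) w" using zw by (simp add: adj_def)
    then have "adj (act (inv j) (star z)) (act (inv j) w)" using act_adj jG zw by simp
    then have "adj e (act (inv j) w) \<or> adj (star e) (act (inv j) w)" using j(2) jG by auto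
    then obtain k where k: "k \<in> J" "act (inv j) w = act k e \<or> act (inv j) w = act k (star e)"
      using nb[of "act (inv j) w"] jG zw by auto
    have "w = act j (act (inv j) w)" using jG zw by simp
    then have "w = act (j \<otimes> k) e \<or> w = act (j \<otimes> k) (star e)"
      using k jG JG by (auto simp: act_mult)
    then show ?thesis using subgroup.m_closed[OF J j(1) k(1)] by (auto simp: T_def)
  qed
  consider "le e y" | "le e (star y)" | "le (star e) y" | "le (star e) (star y)"
    using nested[of e y] y by auto
  then have "T y \<or> T (star y)"
    using chain_induct[of e _ T] chain_induct[of "star e" _ T] Te step y star_in[OF y] e_in star_in[OF e_in]
    by cases metis+
  then have "T y" using Tstar[of "star y"] y by auto
  then show ?thesis by (simp add: T_def)
qed

text \<open>\<open>orbit_subgroup\<close> moves \<open>act g e\<close> back to e or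
  \<open>star e\<close> within the generated group. The remaining factor of g fixes e and lies in T,
  or inverts e, the case left to \<open>flip\<close>.\<close>

lemma generate_eq_carrier:
  assumes T: "T \<subseteq> carrier G" and M: "edge_stab \<subseteq> T"
    and nb: "\<And>x. x \<in> E \<Longrightarrow> adj e x \<or> adj (star e) x \<Longrightarrow> \<exists>j\<in>generate G T. x = act j e \<or> x = act j (star e)"
    and flip: "\<And>g. g \<in> carrier G \<Longrightarrow> act g e = star e \<Longrightarrow> g \<in> generate G T"
  shows "generate G T = carrier G"
proof
  have J: "subgroup (generate G T) G" using T by (rule generate_is_subgroup)
  show "generate G T \<subseteq> carrier G" using T by (rule generate_incl)
  show "carrier G \<subseteq> generate G T"
  proof
    fix g assume g: "g \<in> carrier G"
    obtain j where j: "j \<in> generate G T" "act g e = act j e \<or> act g e = act j (star e)"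
      using orbit_subgroup[OF J nb, of "act g e"] g by auto
    have jG: "j \<in> carrier G" using j(1) J by (rule subgroup.mem_carrier[rotated])
    then have "act (inv j \<otimes> g) e = e \<or> act (inv j \<otimes> g) e = star e"
      using j(2) g by (auto simp: act_mult)
    then have "inv j \<otimes> g \<in> edge_stab \<or> inv j \<otimes> g \<in> generate G T"
      using flip[of "inv j \<otimes> g"] g jG by (auto simp: edge_stab_def)
    then have "inv j \<otimes> g \<in> generate G T"
      using M generate.incl[of _ T G] by blast
    then have "j \<otimes> (inv j \<otimes> g) \<in> generate G T" using subgroup.m_closed[OF J j(1)] by blast
    then show "g \<in> generate G T" using g jG by (simp flip: m_assoc)
  qed
qed

lemma lt_irrefl: "\<not> lt x x" by (simp add: lt_def)

lemma not_lt_star: "x \<in> E \<Longrightarrow> \<not> lt x (star x)" "x \<in> E \<Longrightarrow> \<not> lt (star x) x"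
  using proper[of x x] proper'[of x x] le_refl[of x] by (auto simp: lt_def)

lemma lt_asym: "x \<in> E \<Longrightarrow> y \<in> E \<Longrightarrow> lt x y \<Longrightarrow> \<not> lt y x"
  using le_antisym by (auto simp: lt_def)

text \<open>Elements that carry the edge of e, in one of its orientations, strictly inside the
  half-tree x. Strictness keeps the unit out of \<open>side e\<close> and
  \<open>side (star e)\<close>.\<close>

definition side :: "'e \<Rightarrow> 'a set" where
  "side x = {g \<in> carrier G. lt (act g e) x \<or> lt (act g (star e)) x}"

lemma side_mult:
  assumes "a \<in> carrier G" "g \<in> side y" "y \<in> E" "x \<in> E" "le (act a y) x"
  shows "a \<otimes> g \<in> side x"
proof -
  have g: "g \<in> carrier G" using assms by (simp add: side_def)
  have "lt (act (a \<otimes> g) z) x" if "z \<in> E" "lt (act g z) y" for z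
    using act_lt[of a "act g z" y] lt_le_trans[of "act (a \<otimes> g) z" "act a y" x] assms that g
    by (simp add: act_mult)
  then show ?thesis using assms g by (auto simp: side_def)
qed

lemma ex_adj: "\<exists>x\<in>E. adj e x \<and> x \<noteq> e" "\<exists>x\<in>E. adj (star e) x \<and> x \<noteq> star e"
proof -
  obtain w where w: "w \<in> E" "cov w e" using ex_cov[of _ e] below_e by (auto simp: lt_def)
  then have "adj e (star w)" using cov_star[of w e] by (simp add: adj_def)
  moreover have "star w \<noteq> e" using w not_lt_star[of w] by (auto simp: cov_def)
  ultimately show "\<exists>x\<in>E. adj e x \<and> x \<noteq> e" using w by auto
  obtain w where w: "w \<in> E" "cov w (star e)" using ex_cov[of _ "star e"] below_star_e by (auto simp: lt_def)
  then have "adj (star e) (star w)" using cov_star[of w "star e"] by (simp add: adj_def)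
  moreover have "star w \<noteq> star e" using w star_inject[of w e] not_lt_star[of w] by (auto simp: cov_def)
  ultimately show "\<exists>x\<in>E. adj (star e) x \<and> x \<noteq> star e" using w by auto
qed

text \<open>The hypothesis says that the two ends of e lie in different orbits of vertices. Their
  stabilisers are the factors, and the two half-trees of e give the ping-pong sets.\<close>

lemma amalgam_two_vertex_orbits:
  assumes no: "\<And>g. g \<in> carrier G \<Longrightarrow> \<not> adj e (act g (star e))"
  shows "splits_as_amalgam G edge_stab"
proof -
  let ?A = "vertex_stab e" and ?B = "vertex_stab (star e)"
  have AG: "?A \<subseteq> carrier G" "?B \<subseteq> carrier G" by (auto simp: vertex_stab_def)
  have no': "\<not> adj (star e) (act g e)" if "g \<in> carrier G" for g
    using no[of "inv g"] act_adj[of "inv g" "star e" "act g e"] adj_sym[of "act (inv g) (star e)" e] that by auto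
  have a1: "\<exists>g\<in>?A. x = act g e" if "x \<in> E" "adj e x" for x
    using orbit[OF that(1)] no that by (auto simp: vertex_stab_def)
  have b1: "\<exists>g\<in>?B. x = act g (star e)" if "x \<in> E" "adj (star e) x" for x
    using orbit[OF that(1)] no' that by (auto simp: vertex_stab_def)
  have gen: "generate G (?A \<union> ?B) = carrier G"
  proof (rule generate_eq_carrier)
    fix x assume "x \<in> E" "adj e x \<or> adj (star e) x"
    then show "\<exists>j\<in>generate G (?A \<union> ?B). x = act j e \<or> x = act j (star e)"
      using a1[of x] b1[of x] generate.incl[of _ "?A \<union> ?B" G] by blast
  next
    fix g assume "g \<in> carrier G" "act g e = star e"
    then show "g \<in> generate G (?A \<union> ?B)" using no'[of g] by (simp add: adj_refl)
  qed (use AG edge_stab_subset in auto)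
  have mA: "lt (act a (star e)) e" if "a \<in> ?A - edge_stab" for a
    using vertex_stab_moves[of e a] that AG by (auto simp: edge_stab_def)
  have mB: "lt (act b e) (star e)" if "b \<in> ?B - edge_stab" for b
    using vertex_stab_moves[of "star e" b] that AG edge_stab_star[of b] by auto
  show ?thesis
  proof (rule splits_as_amalgamI[where P = "side e" and Q = "side (star e)"])
    show "subgroup ?A G" "subgroup ?B G" by (simp_all add: subgroup_vertex_stab)
    show "edge_stab = ?A \<inter> ?B"
    proof
      show "edge_stab \<subseteq> ?A \<inter> ?B" using edge_stab_subset by simp
      show "?A \<inter> ?B \<subseteq> edge_stab"
      proof (rule ccontr)
        assume "\<not> ?A \<inter> ?B \<subseteq> edge_stab"
        then obtain g where g: "g \<in> ?A" "g \<in> ?B" "g \<notin> edge_stab" by auto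
        then have gG: "g \<in> carrier G" using AG by auto
        have "lt e (act g (star e))"
          using mB[of g] g gG lt_star[of "act g e" "star e"] act_star[of g e] by simp
        then show False using mA[of g] g gG lt_asym[of e "act g (star e)"] by simp
      qed
    qed
    obtain x g where "x \<noteq> e" "g \<in> ?A" "x = act g e" using ex_adj(1) a1 by metis
    then show "edge_stab \<noteq> ?A" unfolding edge_stab_def by blast
    obtain x g where "x \<noteq> star e" "g \<in> ?B" "x = act g (star e)" using ex_adj(2) b1 by metis
    then show "edge_stab \<noteq> ?B" using edge_stab_star AG by blast
    show "generate G (?A \<union> ?B) = carrier G" by (rule gen)
    show "a \<in> side e" if "a \<in> ?A - edge_stab" for a
      using mA[OF that] that AG by (auto simp: side_def)
    show "b \<in> side (star e)" if "b \<in> ?B - edge_stab" for b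
      using mB[OF that] that AG by (auto simp: side_def)
    show "a \<otimes> g \<in> side e" if "a \<in> ?A - edge_stab" "g \<in> side (star e)" for a g
      using side_mult[of a g "star e" e] mA[OF that(1)] that AG by (auto simp: lt_def)
    show "b \<otimes> g \<in> side (star e)" if "b \<in> ?B - edge_stab" "g \<in> side e" for b g
      using side_mult[of b g e "star e"] mB[OF that(1)] that AG by (auto simp: lt_def)
    show "\<one> \<notin> side e" "\<one> \<notin> side (star e)"
      using not_lt_star[of e] lt_irrefl by (simp_all add: side_def)
  qed
qed

text \<open>When e can be reversed, it behaves as if subdivided at its midpoint: the second factor
  is the stabiliser of the unoriented edge and contains the edge group with index two.\<close>

lemma amalgam_inversion:
  assumes \<tau>: "\<tau> \<in> carrier G" "act \<tau> e = star e"
  shows "splits_as_amalgam G edge_stab"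
proof -
  let ?A = "vertex_stab e" and ?B = "{g \<in> carrier G. act g e = e \<or> act g e = star e}"
  have AG: "?A \<subseteq> carrier G" by (auto simp: vertex_stab_def)
  have \<tau>': "act \<tau> (star e) = e" using \<tau> by (simp add: act_star)
  have B: "subgroup ?B G"
  proof (rule subgroupI)
    show "?B \<noteq> {}" using \<tau> by auto
  next
    fix a assume "a \<in> ?B"
    then have a: "a \<in> carrier G" "e = act a e \<or> e = act a (star e)" by (auto simp: act_star)
    then have "act (inv a) e = e \<or> act (inv a) e = star e"
      using act_inv(1)[of a e] act_inv(1)[of a "star e"] e_in star_in[OF e_in] by metis
    then show "inv a \<in> ?B" using a by simp
  next
    fix a b assume "a \<in> ?B" "b \<in> ?B"
    then show "a \<otimes> b \<in> ?B" by (auto simp: act_mult act_star)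
  qed auto
  have orb: "\<exists>g\<in>carrier G. x = act g e" if "x \<in> E" for x
  proof -
    obtain g where g: "g \<in> carrier G" "x = act g e \<or> x = act g (star e)" using orbit[OF \<open>x \<in> E\<close>] by blast
    moreover have "act g (star e) = act (g \<otimes> \<tau>) e" using g \<tau> by (simp add: act_mult)
    ultimately show ?thesis using \<tau> m_closed by metis
  qed
  have a1: "\<exists>g\<in>?A. x = act g e" if "x \<in> E" "adj e x" for x
    using orb[OF that(1)] that by (auto simp: vertex_stab_def)
  have BJ: "?A \<union> ?B \<subseteq> carrier G" using AG by auto
  have J: "subgroup (generate G (?A \<union> ?B)) G" using BJ by (rule generate_is_subgroup)
  have \<tau>J: "\<tau> \<in> generate G (?A \<union> ?B)" using \<tau> by (intro generate.incl) auto
  have gen: "generate G (?A \<union> ?B) = carrier G"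
  proof (rule generate_eq_carrier)
    fix x assume x: "x \<in> E" "adj e x \<or> adj (star e) x"
    show "\<exists>j\<in>generate G (?A \<union> ?B). x = act j e \<or> x = act j (star e)"
    proof (cases "adj e x")
      case True
      then obtain g where "g \<in> ?A" "x = act g e" using a1 x by blast
      then show ?thesis using generate.incl[of g "?A \<union> ?B" G] by blast
    next
      case False
      then have "adj e (act \<tau> x)" using act_adj[of \<tau> "star e" x] x \<tau> \<tau>' by simp
      then obtain g where g: "g \<in> ?A" "act \<tau> x = act g e" using a1[of "act \<tau> x"] x \<tau> by auto
      have "x = act (inv \<tau>) (act \<tau> x)" using x \<tau> by simp
      then have "x = act (inv \<tau> \<otimes> g) e" using g AG \<tau> by (auto simp: act_mult)
      moreover have "inv \<tau> \<otimes> g \<in> generate G (?A \<union> ?B)"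
        using subgroup.m_closed[OF J subgroup.m_inv_closed[OF J \<tau>J]] generate.incl[of g "?A \<union> ?B" G] g by blast
      ultimately show ?thesis by blast
    qed
  next
    fix g assume "g \<in> carrier G" "act g e = star e"
    then show "g \<in> generate G (?A \<union> ?B)" by (intro generate.incl) auto
  next
    show "edge_stab \<subseteq> ?A \<union> ?B" using edge_stab_subset by auto
  qed (rule BJ)
  have mA: "lt (act a (star e)) e" if "a \<in> ?A - edge_stab" for a
    using vertex_stab_moves[of e a] that AG by (auto simp: edge_stab_def)
  have mB: "act b e = star e" if "b \<in> ?B - edge_stab" for b
    using that by (auto simp: edge_stab_def)
  show ?thesis
  \<comment> \<open>Elements of \<open>?B - edge_stab\<close> keep the unoriented edge in place and
    so lie on neither strict side; they are added to Q by hand.\<close>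
  proof (rule splits_as_amalgamI[where P = "side e" and Q = "side (star e) \<union> (?B - edge_stab)"])
    show "subgroup ?A G" "subgroup ?B G" by (simp_all add: subgroup_vertex_stab B)
    have "\<not> adj e (star e)" using star_neq[of e] lt_irrefl by (auto simp: adj_def cov_def)
    then show "edge_stab = ?A \<inter> ?B" using edge_stab_subset
      by (auto simp: edge_stab_def vertex_stab_def)
    show "edge_stab \<noteq> ?A"
    proof
      assume eq: "edge_stab = ?A"
      obtain x where "x \<in> E" "adj e x" "x \<noteq> e" using ex_adj by blast
      then obtain g where "g \<in> ?A" "act g e \<noteq> e" using a1 by blast
      then show False unfolding eq[symmetric] by (simp add: edge_stab_def)
    qed
    have "\<tau> \<in> ?B" "\<tau> \<notin> edge_stab" using \<tau> star_neq[of e] by (simp_all add: edge_stab_def)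
    then show "edge_stab \<noteq> ?B" by blast
    show "generate G (?A \<union> ?B) = carrier G" by (rule gen)
    show "a \<in> side e" if "a \<in> ?A - edge_stab" for a
      using mA[OF that] that AG by (auto simp: side_def)
    show "b \<in> side (star e) \<union> (?B - edge_stab)" if "b \<in> ?B - edge_stab" for b
      using that by blast
    show "a \<otimes> g \<in> side e" if a: "a \<in> ?A - edge_stab" and g: "g \<in> side (star e) \<union> (?B - edge_stab)" for a g
    proof (cases "g \<in> side (star e)")
      case True
      then show ?thesis using side_mult[of a g "star e" e] mA[OF a] a AG by (auto simp: lt_def)
    next
      case False
      then have "g \<in> carrier G" "act g e = star e" using g mB[of g] by blast+
      moreover have "a \<in> carrier G" using a AG by blast
      ultimately have "act (a \<otimes> g) e = act a (star e)" by (simp add: act_mult)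
      then show ?thesis using mA[OF a] g False a AG by (auto simp: side_def)
    qed
    show "b \<otimes> g \<in> side (star e) \<union> (?B - edge_stab)" if "b \<in> ?B - edge_stab" "g \<in> side e" for b g
      using side_mult[of b g e "star e"] mB[OF that(1)] that by (auto simp: le_refl)
    show "\<one> \<notin> side e" "\<one> \<notin> side (star e) \<union> (?B - edge_stab)"
      using not_lt_star[of e] lt_irrefl by (simp_all add: side_def edge_stab_def)
  qed
qed

text \<open>Here t carries the end of e to its initial vertex v, so there is one orbit of vertices.
  The edges starting at v are the translates of e and of f under the stabiliser of v, and the two
  kinds are disjoint because nothing inverts e.\<close>

lemma hnn_one_vertex_orbit:
  assumes no: "\<And>g. g \<in> carrier G \<Longrightarrow> act g e \<noteq> star e"
    and t: "t \<in> carrier G" "adj e (act t (star e))"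
  shows "splits_as_hnn G edge_stab"
proof -
  define f where "f = act t (star e)"
  let ?A = "vertex_stab e" and ?M = edge_stab
  have f [simp]: "f \<in> E" and ef: "adj e f" using t by (simp_all add: f_def)
  have sf: "star f = act t e" using t act_star[of t "star e"] by (simp add: f_def)
  have tf: "act (inv t) f = star e" using t by (simp add: f_def)
  have AG: "?A \<subseteq> carrier G" by (auto simp: vertex_stab_def)
  have AGm: "a \<in> carrier G" if "a \<in> ?A" for a using that AG by auto
  have fe: "adj f e" using adj_sym ef by simp
  have Ae: "adj e (act a e)" if "a \<in> ?A" for a using that by (simp add: vertex_stab_def)
  have Af: "adj e (act a f)" if "a \<in> ?A" for a
    using adj_trans[of e "act a e" "act a f"] act_adj[of a e f] Ae[OF that] AGm[OF that] ef by simp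
  have ne1: "act a e \<noteq> f" if "a \<in> ?A" for a
  proof
    assume "act a e = f"
    then have "act (inv t \<otimes> a) e = star e" using AGm[OF that] t tf by (simp add: act_mult)
    then show False using no[of "inv t \<otimes> a"] AGm[OF that] t by simp
  qed
  have ne2: "act a f \<noteq> e" if "a \<in> ?A" for a
  proof
    assume "act a f = e"
    then have "act (inv a) e = f" using act_inv(1)[of a f] AGm[OF that] by simp
    then show False using ne1[of "inv a"] subgroup.m_inv_closed[OF subgroup_vertex_stab that] by simp
  qed
  have adj_lt: "lt (star y) z" if "y \<in> E" "z \<in> E" "adj e y" "adj e z" "y \<noteq> z" for y z
  proof -
    have "adj y z" using adj_trans[of y e z] adj_sym[of e y] that by simp
    then show ?thesis using that(5) by (simp add: adj_def cov_def)
  qed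
  \<comment> \<open>\<open>inv t\<close> carries f to \<open>star e\<close>. What lies behind an
    edge at v other than f is strictly inside f, and so goes to the far side of e. \<open>s2\<close>
    is the same for t, which carries e to \<open>star f\<close>.\<close>
  have s1: "lt (act (inv t) z) (star e)" if "y \<in> E" "adj e y" "y \<noteq> f" "z \<in> E" "le z (star y)" for y z
  proof -
    have "lt (star y) f" using adj_lt that ef by simp
    then have "lt z f" using le_lt_trans[of z "star y" f] that by simp
    then show ?thesis using act_lt[of "inv t" z f] tf t that by simp
  qed
  have s2: "lt (act t z) (star f)" if "y \<in> E" "adj e y" "y \<noteq> e" "z \<in> E" "le z (star y)" for y z
  proof -
    have "lt (star y) e" using adj_lt that by (simp add: adj_refl)
    then have "lt z e" using le_lt_trans[of z "star y" e] that by simp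
    then show ?thesis using act_lt[of t z e] sf t that by simp
  qed
  \<comment> \<open>\<open>R x\<close> expresses that g moves v beyond x: some edge at the vertex g
    v, in either orientation, is strictly inside the far half-tree of x. \<open>side\<close> would
    not do, since t carries e onto \<open>star f\<close> itself, which is not strictly
    inside.\<close>
  define R where "R x = {g \<in> carrier G. \<exists>z\<in>E. (adj e z \<or> adj e (star z)) \<and> lt (act g z) (star x)}" for x
  have R_D: "\<exists>z\<in>E. (adj e z \<or> adj e (star z)) \<and> lt (act g z) (star x)" "g \<in> carrier G" if "g \<in> R x" for g x
    using that by (simp_all add: R_def)
  have R1: "inv t \<otimes> (a \<otimes> g) \<in> R e" if axg: "a \<in> ?A" "x \<in> E" "g \<in> R x" "adj e (act a x)" "act a x \<noteq> f" for a g x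
  proof -
    obtain z where z: "z \<in> E" "adj e z \<or> adj e (star z)" "lt (act g z) (star x)" "g \<in> carrier G"
      using R_D[OF axg(3)] by blast
    note aG = AGm[OF axg(1)]
    have "lt (act a (act g z)) (star (act a x))"
      using act_lt[of a "act g z" "star x"] z axg aG by (simp add: act_star)
    then have "lt (act (inv t) (act a (act g z))) (star e)"
      using s1[of "act a x" "act a (act g z)"] axg z aG by (simp add: lt_def)
    then show ?thesis using z t aG by (auto simp: R_def act_mult)
  qed
  have R2: "t \<otimes> (a \<otimes> g) \<in> R f" if axg: "a \<in> ?A" "x \<in> E" "g \<in> R x" "adj e (act a x)" "act a x \<noteq> e" for a g x
  proof -
    obtain z where z: "z \<in> E" "adj e z \<or> adj e (star z)" "lt (act g z) (star x)" "g \<in> carrier G"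
      using R_D[OF axg(3)] by blast
    note aG = AGm[OF axg(1)]
    have "lt (act a (act g z)) (star (act a x))"
      using act_lt[of a "act g z" "star x"] z axg aG by (simp add: act_star)
    then have "lt (act t (act a (act g z))) (star f)"
      using s2[of "act a x" "act a (act g z)"] axg z aG by (simp add: lt_def)
    then show ?thesis using z t aG by (auto simp: R_def act_mult)
  qed
  have J: "subgroup (generate G (insert t ?A)) G" using AG t by (intro generate_is_subgroup) auto
  have tJ: "t \<in> generate G (insert t ?A)" and AJ: "?A \<subseteq> generate G (insert t ?A)"
    using generate.incl[of _ "insert t ?A" G] by auto
  have nb: "\<exists>j\<in>generate G (insert t ?A). x = act j e \<or> x = act j (star e)" if x: "x \<in> E" "adj e x" for x
  proof -
    obtain g where g: "g \<in> carrier G" "x = act g e \<or> x = act g (star e)" using orbit[OF x(1)] by blast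
    show ?thesis
    proof (cases "x = act g e")
      case True
      then have "g \<in> ?A" using x g by (simp add: vertex_stab_def)
      then show ?thesis using True AJ by blast
    next
      case False
      then have xg: "x = act g (star e)" using g by simp
      then have "act (g \<otimes> inv t) f = x" using g t tf by (simp add: act_mult)
      then have "adj x (act (g \<otimes> inv t) e)" using act_adj[of "g \<otimes> inv t" f e] fe g t by simp
      then have "adj e (act (g \<otimes> inv t) e)" using adj_trans[of e x] x g t by simp
      then have "g \<otimes> inv t \<in> ?A" using g t by (simp add: vertex_stab_def)
      then have "g \<otimes> inv t \<otimes> t \<in> generate G (insert t ?A)" using subgroup.m_closed[OF J _ tJ] AJ by blast
      then have "g \<in> generate G (insert t ?A)" using g t by (simp add: m_assoc)
      then show ?thesis using xg by blast
    qed
  qed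
  have gen: "generate G (insert t ?A) = carrier G"
  proof (rule generate_eq_carrier)
    fix x assume x: "x \<in> E" "adj e x \<or> adj (star e) x"
    show "\<exists>j\<in>generate G (insert t ?A). x = act j e \<or> x = act j (star e)"
    proof (cases "adj e x")
      case True
      then show ?thesis using nb x by blast
    next
      case False
      then have "adj f (act t x)" using act_adj[of t "star e" x] x t by (simp add: f_def)
      then have "adj e (act t x)" using adj_trans[of e f "act t x"] ef x t by simp
      then obtain j where j: "j \<in> generate G (insert t ?A)" "act t x = act j e \<or> act t x = act j (star e)"
        using nb[of "act t x"] x t by auto
      have jG: "j \<in> carrier G" using j(1) J by (rule subgroup.mem_carrier[rotated])
      have "x = act (inv t) (act t x)" using x t by simp
      then have "x = act (inv t \<otimes> j) e \<or> x = act (inv t \<otimes> j) (star e)" using j jG t by (auto simp: act_mult)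
      moreover have "inv t \<otimes> j \<in> generate G (insert t ?A)"
        using subgroup.m_closed[OF J subgroup.m_inv_closed[OF J tJ] j(1)] .
      ultimately show ?thesis by blast
    qed
  qed (use AG t edge_stab_subset no in auto)
  show ?thesis
  proof (rule splits_as_hnnI[where P = "R e" and Q = "R f"])
    show "subgroup ?A G" by (simp add: subgroup_vertex_stab)
    show "?M \<subseteq> ?A" by (rule edge_stab_subset)
    show "t \<in> carrier G" by (rule t)
    show "generate G (insert t ?A) = carrier G" by (rule gen)
    show "t \<otimes> m \<otimes> inv t \<in> ?A" if m: "m \<in> ?M" for m
    proof -
      have mG: "m \<in> carrier G" "act m (star e) = star e"
        using m edge_stab_star[of m] by (auto simp: edge_stab_def)
      let ?c = "t \<otimes> m \<otimes> inv t"
      have "act ?c f = f" using mG t tf by (simp add: act_mult) (simp add: f_def)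
      then have "adj f (act ?c e)" using act_adj[of ?c f e] fe mG t by simp
      then have "adj e (act ?c e)" using adj_trans[of e f] ef mG t by simp
      then show ?thesis using mG t by (simp add: vertex_stab_def)
    qed
    show "inv t \<otimes> a \<in> R e" if a: "a \<in> ?A" for a
    proof -
      have "lt (act (inv t) (act a (star e))) (star e)"
        using s1[of "act a e" "act a (star e)"] Ae[OF a] ne1[OF a] AGm[OF a]
        by (simp add: act_star le_refl)
      then show ?thesis using AGm[OF a] t by (auto simp: R_def act_mult adj_refl intro!: bexI[of _ "star e"])
    qed
    show "t \<otimes> a \<in> R f" if a: "a \<in> ?A" for a
    proof -
      have "lt (act t (act a (star f))) (star f)"
        using s2[of "act a f" "act a (star f)"] Af[OF a] ne2[OF a] AGm[OF a]
        by (simp add: act_star le_refl)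
      then show ?thesis using AGm[OF a] t ef by (auto simp: R_def act_mult intro!: bexI[of _ "star f"])
    qed
    show "inv t \<otimes> (a \<otimes> g) \<in> R e" if "a \<in> ?A" "g \<in> R e" for a g
      using R1[of a e g] that Ae ne1 by simp
    show "t \<otimes> (a \<otimes> g) \<in> R f" if "a \<in> ?A" "g \<in> R f" for a g
      using R2[of a f g] that Af ne2 by simp
    show "inv t \<otimes> (a \<otimes> g) \<in> R e" if a: "a \<in> ?A" "inv t \<otimes> a \<otimes> t \<notin> ?M" "g \<in> R f" for a g
    proof -
      have "act a f \<noteq> f"
      proof
        assume "act a f = f"
        then have "act (inv t \<otimes> a \<otimes> t) (star e) = star e"
          using AGm[OF a(1)] t tf by (simp add: act_mult m_assoc flip: f_def)
        then show False using a(2) edge_stab_star[of "inv t \<otimes> a \<otimes> t"] AGm[OF a(1)] t by simp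
      qed
      then show ?thesis using R1[of a f g] a Af by simp
    qed
    show "t \<otimes> (a \<otimes> g) \<in> R f" if a: "a \<in> ?A - ?M" "g \<in> R e" for a g
      using R2[of a e g] a Ae[of a] AGm[of a] by (auto simp: edge_stab_def)
    show "R e \<subseteq> carrier G" "R f \<subseteq> carrier G" by (auto simp: R_def)
    show "a \<otimes> g \<noteq> \<one>" if a: "a \<in> ?A" and g: "g \<in> R e \<union> R f" for a g
    proof
      \<comment> \<open>Then z, an edge at v, lies strictly behind another edge y at v, which is
        impossible for either orientation of z.\<close>
      assume 1: "a \<otimes> g = \<one>"
      note aG = AGm[OF a]
      obtain x z where xz: "x = e \<or> x = f" "z \<in> E" "adj e z \<or> adj e (star z)" "lt (act g z) (star x)" "g \<in> carrier G"
        using g by (auto simp: R_def)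
      have xE: "x \<in> E" using xz by auto
      define y where "y = act a x"
      have y: "y \<in> E" "adj e y" using xz Ae[OF a] Af[OF a] aG by (auto simp: y_def)
      have "lt (act a (act g z)) (star y)"
        using act_lt[of a "act g z" "star x"] xz xE aG by (simp add: act_star y_def)
      moreover have "act a (act g z) = z" using act_mult[of a g z] 1 xz aG by simp
      ultimately have l: "lt z (star y)" by simp
      show False
      proof (cases "adj e z")
        case True
        then show False using adj_lt[of y z] l lt_asym[of z "star y"] not_lt_star[of y] y xz by auto
      next
        case False
        then have sz: "adj e (star z)" using xz by simp
        have "lt y (star z)" using lt_star[of z "star y"] l y xz by simp
        then show False using adj_lt[of y "star z"] sz y xz proper'[of y "star z"] by (auto simp: lt_def)
      qed
    qed
  qed
qed

theorem splits_over_edge_stab: "splits_over G edge_stab"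
  using amalgam_two_vertex_orbits amalgam_inversion hnn_one_vertex_orbit subgroup_edge_stab
  unfolding splits_over_def by blast

end

section \<open>Finiteness modulo a subgroup, and boundaries under right multiplication\<close>

section \<open>Sets that are finite modulo a subgroup\<close>

context group
begin

text \<open>For a subgroup J this says that P meets only finitely many cosets Jg. Arbitrary sets J
  are allowed because left cosets \<open>g <# H\<close> take this role in transitivity
  arguments.\<close>

definition fin_over :: "'a set \<Rightarrow> 'a set \<Rightarrow> bool" where
  "fin_over J P \<longleftrightarrow> (\<exists>F. finite F \<and> F \<subseteq> carrier G \<and> P \<subseteq> J <#> F)"

text \<open>The coboundary along right multiplication by a single u, which need not be a generator;
  this frees the calculus from the generating set.\<close>

definition bd :: "'a set \<Rightarrow> 'a \<Rightarrow> 'a set" where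
  "bd A u = {x \<in> carrier G. (x \<in> A) \<noteq> (x \<otimes> u \<in> A)}"

lemma set_multI: "j \<in> J \<Longrightarrow> f \<in> F \<Longrightarrow> j \<otimes> f \<in> J <#> F"
  by (auto simp: set_mult_def)

lemma set_mult_mono: "J \<subseteq> J' \<Longrightarrow> F \<subseteq> F' \<Longrightarrow> J <#> F \<subseteq> J' <#> F'"
  by (fastforce simp: set_mult_def)

lemma set_multE:
  assumes "x \<in> J <#> F"
  obtains j f where "j \<in> J" "f \<in> F" "x = j \<otimes> f"
  using assms by (auto simp: set_mult_def)

lemma fin_overI: "finite F \<Longrightarrow> F \<subseteq> carrier G \<Longrightarrow> P \<subseteq> J <#> F \<Longrightarrow> fin_over J P"
  by (auto simp: fin_over_def)

lemma fin_overE: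
  assumes "fin_over J P"
  obtains F where "finite F" "F \<subseteq> carrier G" "P \<subseteq> J <#> F"
  using assms by (auto simp: fin_over_def)

lemma fin_over_subset: "fin_over J P \<Longrightarrow> Q \<subseteq> P \<Longrightarrow> fin_over J Q"
  by (auto simp: fin_over_def)

lemma fin_over_empty: "fin_over J {}"
  by (auto simp: fin_over_def intro: exI[of _ "{}"])

lemma fin_over_Un:
  assumes "fin_over J P" "fin_over J Q"
  shows "fin_over J (P \<union> Q)"
proof -
  obtain F F' where "finite F" "F \<subseteq> carrier G" "P \<subseteq> J <#> F" "finite F'" "F' \<subseteq> carrier G" "Q \<subseteq> J <#> F'"
    using assms by (auto simp: fin_over_def)
  moreover have "J <#> F \<subseteq> J <#> (F \<union> F')" "J <#> F' \<subseteq> J <#> (F \<union> F')" by (simp_all add: set_mult_mono)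
  ultimately show ?thesis by (intro fin_overI[of "F \<union> F'"]) auto
qed

lemma fin_over_UN: "finite I \<Longrightarrow> (\<And>i. i \<in> I \<Longrightarrow> fin_over J (P i)) \<Longrightarrow> fin_over J (\<Union>i\<in>I. P i)"
  by (induction I rule: finite_induct) (auto simp: fin_over_empty fin_over_Un)

lemma fin_over_rmult:
  assumes "fin_over J P" "J \<subseteq> carrier G" "u \<in> carrier G"
  shows "fin_over J {x \<in> carrier G. x \<otimes> u \<in> P}"
proof -
  obtain F where F: "finite F" "F \<subseteq> carrier G" "P \<subseteq> J <#> F" using assms by (auto simp: fin_over_def)
  have "{x \<in> carrier G. x \<otimes> u \<in> P} \<subseteq> J <#> ((\<lambda>f. f \<otimes> inv u) ` F)"
  proof
    fix x assume x: "x \<in> {x \<in> carrier G. x \<otimes> u \<in> P}"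
    then obtain j f where jf: "j \<in> J" "f \<in> F" "x \<otimes> u = j \<otimes> f" using F(3) by (auto elim!: set_multE)
    then have c: "j \<in> carrier G" "f \<in> carrier G" using F assms by auto
    have "x = (x \<otimes> u) \<otimes> inv u" using x assms by (simp add: m_assoc)
    then have "x = j \<otimes> (f \<otimes> inv u)" using jf(3) c assms by (simp add: m_assoc)
    then show "x \<in> J <#> ((\<lambda>f. f \<otimes> inv u) ` F)" using jf by (auto intro: set_multI)
  qed
  then show ?thesis using F assms by (intro fin_overI[of "(\<lambda>f. f \<otimes> inv u) ` F"]) auto
qed

lemma fin_over_coset_image:
  assumes J: "subgroup J G" and P: "P \<subseteq> carrier G"
  shows "finite (coset_image G J P) \<longleftrightarrow> fin_over J P"
proof
  assume fin: "finite (coset_image G J P)"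
  then obtain F where F: "finite F" "F \<subseteq> P" "coset_image G J P = (\<lambda>x. J #> x) ` F"
    using finite_subset_image[OF fin, of "\<lambda>x. J #> x" P] by (auto simp: coset_image_def)
  have "P \<subseteq> J <#> F"
  proof
    fix x assume "x \<in> P"
    then have "J #> x \<in> coset_image G J P" by (simp add: coset_image_def)
    then have "J #> x \<in> (\<lambda>x. J #> x) ` F" unfolding F(3) .
    have "x \<in> carrier G" using subsetD[OF P \<open>x \<in> P\<close>] .
    obtain f where "f \<in> F" "J #> x = J #> f" using \<open>J #> x \<in> _ ` F\<close> by (elim imageE)
    then have "x \<in> J #> f" using rcos_self[OF \<open>x \<in> carrier G\<close> J] by simp
    then show "x \<in> J <#> F" using \<open>f \<in> F\<close> by (auto simp: r_coset_def set_mult_def)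
  qed
  then show "fin_over J P" using F P by (intro fin_overI[of F]) auto
next
  assume "fin_over J P"
  then obtain F where F: "finite F" "F \<subseteq> carrier G" "P \<subseteq> J <#> F" by (rule fin_overE)
  have "coset_image G J P \<subseteq> (\<lambda>x. J #> x) ` F"
  proof
    fix C assume "C \<in> coset_image G J P"
    then obtain x where x: "x \<in> P" "C = J #> x" by (auto simp: coset_image_def)
    then obtain j f where "j \<in> J" "f \<in> F" "x = j \<otimes> f" using F(3) by (auto elim!: set_multE)
    then have "x \<in> J #> f" by (auto simp: r_coset_def)
    then have "C = J #> f" using repr_independence[of x J f] J x \<open>f \<in> F\<close> F(2) by auto
    then show "C \<in> (\<lambda>x. J #> x) ` F" using \<open>f \<in> F\<close> by auto
  qed
  then show "finite (coset_image G J P)" using F(1) by (simp add: finite_subset)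
qed

lemma bd_subset: "bd A u \<subseteq> carrier G" by (auto simp: bd_def)

lemma bd_compl: "u \<in> carrier G \<Longrightarrow> bd (carrier G - A) u = bd A u"
  by (auto simp: bd_def)

lemma bd_mult:
  "u \<in> carrier G \<Longrightarrow> v \<in> carrier G \<Longrightarrow> bd A (u \<otimes> v) \<subseteq> bd A u \<union> {x \<in> carrier G. x \<otimes> u \<in> bd A v}"
  by (auto simp: bd_def m_assoc)

lemma bd_inv: "u \<in> carrier G \<Longrightarrow> bd A (inv u) \<subseteq> {x \<in> carrier G. x \<otimes> inv u \<in> bd A u}"
  by (auto simp: bd_def m_assoc)

lemma bd_generate:
  assumes J: "J \<subseteq> carrier G" and S: "S \<subseteq> carrier G" and bd: "\<And>s. s \<in> S \<Longrightarrow> fin_over J (bd A s)"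
    and u: "u \<in> generate G S"
  shows "fin_over J (bd A u)"
  using u
proof (induction rule: generate.induct)
  case one
  have "bd A \<one> = {}" by (auto simp: bd_def)
  then show ?case by (simp add: fin_over_empty)
next
  case (incl h)
  then show ?case by (rule bd)
next
  case (inv h)
  then have "h \<in> carrier G" using S by auto
  then show ?case using fin_over_subset[OF fin_over_rmult[OF bd[OF inv] J, of "inv h"] bd_inv] by simp
next
  case (eng h1 h2)
  have c: "h1 \<in> carrier G" "h2 \<in> carrier G" using eng generate_in_carrier[OF S] by auto
  show ?case
    using fin_over_subset[OF fin_over_Un[OF eng.IH(1) fin_over_rmult[OF eng.IH(2) J c(1)]] bd_mult[OF c]] .
qed

end

section \<open>How an almost invariant set produces a second end\<close>

section \<open>Almost invariant sets and ends\<close>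

definition sym_arcs :: "('v, 'e) pre_digraph \<Rightarrow> ('v \<times> 'v) set" where
  "sym_arcs \<Gamma> = (\<Union>e\<in>arcs \<Gamma>. {(tail \<Gamma> e, head \<Gamma> e), (head \<Gamma> e, tail \<Gamma> e)})"

lemma component_mem:
  assumes "u \<in> verts \<Gamma>"
  shows "{v. (u, v) \<in> rtrancl_on (verts \<Gamma>) (sym_arcs \<Gamma>)} \<in> graph_components \<Gamma>"
proof -
  let ?R = "rtrancl_on (verts \<Gamma>) (sym_arcs \<Gamma>)"
  have reach: "reachable (with_proj (mk_symmetric \<Gamma>)) a b \<longleftrightarrow> (a, b) \<in> ?R" for a b
    by (simp add: reachable_def sym_arcs_def mk_symmetric_def)
  have "sym (sym_arcs \<Gamma>)" by (auto simp: sym_arcs_def sym_def)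
  then have "sym ?R" using rtrancl_on_sym by blast
  then have s: "(a, b) \<in> ?R \<Longrightarrow> (b, a) \<in> ?R" for a b by (simp add: sym_def)
  have t: "(a, b) \<in> ?R \<Longrightarrow> (b, c) \<in> ?R \<Longrightarrow> (a, c) \<in> ?R" for a b c by (rule rtrancl_on_trans)
  show ?thesis
    unfolding graph_components_def pre_digraph.sccs_verts_def reach mem_Collect_eq
  proof (intro conjI ballI allI impI)
    show "{v. (u, v) \<in> ?R} \<noteq> {}" using assms by blast
    show "(a, b) \<in> ?R" if "a \<in> {v. (u, v) \<in> ?R}" "b \<in> {v. (u, v) \<in> ?R}" for a b
      using that s t by blast
    fix a b assume "a \<in> {v. (u, v) \<in> ?R}" "(u, b) \<notin> ?R"
    then show "(a, b) \<notin> ?R \<or> (b, a) \<notin> ?R" using t by blast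
  qed
qed

text \<open>Removing F leaves two infinite parts with no edge between them. Every vertex is joined
  to F, so each vertex outside F shares its component with one of the finitely many neighbours of F.
  By pigeonhole some component meets P in an infinite set, and likewise for Q.\<close>

lemma num_ends_neq_1:
  assumes F: "finite F" "F \<subseteq> verts \<Gamma>"
    and PQ: "P \<inter> Q = {}" "P \<union> Q = verts \<Gamma> - F" "infinite P" "infinite Q"
    and sep: "\<And>p q. p \<in> P \<Longrightarrow> q \<in> Q \<Longrightarrow> (p, q) \<notin> sym_arcs \<Gamma>"
    and conn: "\<And>v. v \<in> verts \<Gamma> \<Longrightarrow> \<exists>f\<in>F. (v, f) \<in> (sym_arcs \<Gamma>)\<^sup>*"
    and wf: "sym_arcs \<Gamma> \<subseteq> verts \<Gamma> \<times> verts \<Gamma>"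
    and lf: "finite {v. \<exists>f\<in>F. (v, f) \<in> sym_arcs \<Gamma>}"
  shows "num_ends \<Gamma> \<noteq> 1"
proof -
  let ?W = "verts \<Gamma> - F"
  define \<Delta> where "\<Delta> = induce_subgraph \<Gamma> ?W"
  have vD: "verts \<Delta> = ?W" by (simp add: \<Delta>_def)
  have aD: "sym_arcs \<Delta> = sym_arcs \<Gamma> \<inter> ?W \<times> ?W"
    unfolding sym_arcs_def \<Delta>_def induce_subgraph_def by auto
  define R where "R = rtrancl_on (verts \<Delta>) (sym_arcs \<Delta>)"
  define N where "N = {v. \<exists>f\<in>F. (v, f) \<in> sym_arcs \<Gamma>} - F"
  have reach: "v \<in> F \<or> (\<exists>n\<in>N. (n, v) \<in> R)" if "(v, f) \<in> (sym_arcs \<Gamma>)\<^sup>*" "f \<in> F" for v f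
    using that
  proof (induction rule: converse_rtrancl_induct)
    case (step v w)
    have v: "v \<in> verts \<Gamma>" "w \<in> verts \<Gamma>" using step.hyps(1) wf by auto
    show ?case
    proof (cases "v \<in> F")
      case False
      show ?thesis
      proof (cases "w \<in> F")
        case True
        then have "v \<in> N" using False step.hyps(1) by (auto simp: N_def)
        moreover have "(v, v) \<in> R" using False v unfolding R_def vD by blast
        ultimately show ?thesis by blast
      next
        case wF: False
        then obtain n where n: "n \<in> N" "(n, w) \<in> R" using step.IH step.prems by blast
        have "(w, v) \<in> sym_arcs \<Delta>" using step.hyps(1) False wF v unfolding aD by (auto simp: sym_arcs_def)
        then have "(n, v) \<in> R" using n(2) False v unfolding R_def vD by (blast intro: rtrancl_on_into_rtrancl_on)
        then show ?thesis using n(1) by blast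
      qed
    qed simp
  qed simp
  have finN: "finite N" using lf by (simp add: N_def)
  have inf_comp: "\<exists>C\<in>graph_components \<Delta>. infinite C \<and> C \<inter> A \<noteq> {}" if A: "A \<subseteq> ?W" "infinite A" for A
  proof -
    have "A \<subseteq> (\<Union>n\<in>N. {v. (n, v) \<in> R} \<inter> A)"
    proof
      fix a assume a: "a \<in> A"
      then have "a \<in> verts \<Gamma>" "a \<notin> F" using A(1) by auto
      then show "a \<in> (\<Union>n\<in>N. {v. (n, v) \<in> R} \<inter> A)" using reach conn[of a] a by auto
    qed
    then have "infinite (\<Union>n\<in>N. {v. (n, v) \<in> R} \<inter> A)" using A(2) finite_subset by blast
    then obtain n where n: "n \<in> N" "infinite ({v. (n, v) \<in> R} \<inter> A)" using finN by blast
    then obtain v where "(n, v) \<in> R" by (metis (no_types, lifting) disjoint_iff finite.emptyI mem_Collect_eq)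
    then have "n \<in> verts \<Delta>" unfolding R_def by (rule in_rtrancl_on_in_F)
    then have "{v. (n, v) \<in> R} \<in> graph_components \<Delta>" unfolding R_def by (rule component_mem)
    moreover have "infinite {v. (n, v) \<in> R}" using n(2) by blast
    moreover have "{v. (n, v) \<in> R} \<inter> A \<noteq> {}" using n(2) by (metis finite.emptyI)
    ultimately show ?thesis by blast
  qed
  obtain C1 C2 where C: "C1 \<in> graph_components \<Delta>" "infinite C1" "C1 \<inter> P \<noteq> {}"
    "C2 \<in> graph_components \<Delta>" "infinite C2" "C2 \<inter> Q \<noteq> {}"
    using inf_comp[of P] inf_comp[of Q] PQ by blast
  have side: "v \<in> P" if "(u, v) \<in> R" "u \<in> P" for u v
    using that(1) unfolding R_def
  proof (induction rule: rtrancl_on_induct)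
    case base
    show ?case by (rule that(2))
  next
    case (step y z)
    then show ?case using sep[of y z] PQ unfolding aD vD by blast
  qed
  have "C1 \<noteq> C2"
  proof
    assume "C1 = C2"
    then obtain p q where pq: "p \<in> C1" "p \<in> P" "q \<in> C1" "q \<in> Q" using C by blast
    then have "(p, q) \<in> R" using C(1)
      by (simp add: graph_components_def pre_digraph.sccs_verts_def reachable_def R_def sym_arcs_def mk_symmetric_def)
    then show False using side pq PQ by blast
  qed
  define \<C> where "\<C> = {C \<in> graph_components \<Delta>. infinite C}"
  have "1 < ecard \<C>"
  proof (cases "finite \<C>")
    case True
    have "card {C1, C2} \<le> card \<C>" using True C by (intro card_mono) (auto simp: \<C>_def)
    then show ?thesis using True \<open>C1 \<noteq> C2\<close> by (simp add: ecard_def one_enat_def)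
  qed (simp add: ecard_def)
  also have "ecard \<C> \<le> num_ends \<Gamma>"
    unfolding num_ends_def \<C>_def \<Delta>_def using F by (intro SUP_upper) auto
  finally show ?thesis by auto
qed

lemma (in group) ends_of_pair_neq_1:
  assumes S: "finite S" "S \<subseteq> carrier G" "generate G S = carrier G"
    and K: "subgroup K G" and D: "D \<subseteq> carrier G" "\<And>k d. k \<in> K \<Longrightarrow> d \<in> D \<Longrightarrow> k \<otimes> d \<in> D"
    and bd: "\<And>s. s \<in> S \<Longrightarrow> fin_over K (bd D s)"
    and ni: "\<not> fin_over K D" "\<not> fin_over K (carrier G - D)"
  shows "ends_of_pair G S K \<noteq> 1"
proof -
  let ?\<Gamma> = "quotient_cayley_graph G S K" and ?c = "\<lambda>x. K #> x"
  have KG: "K \<subseteq> carrier G" using K by (rule subgroup.subset)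
  define B where "B = (\<Union>s\<in>S. bd D s)"
  define F where "F = ?c ` B \<union> (\<Union>s\<in>S. ?c ` (\<lambda>x. x \<otimes> s) ` B)"
  have BG: "B \<subseteq> carrier G" by (auto simp: B_def bd_def)
  have "fin_over K B" unfolding B_def using S(1) bd by (rule fin_over_UN)
  then have finB: "finite (?c ` B)" using fin_over_coset_image[OF K BG] by (simp add: coset_image_def)
  have verts: "verts ?\<Gamma> = ?c ` carrier G" by (auto simp: quotient_cayley_graph_def RCOSETS_def)
  have cmult: "?c x #> s = ?c (x \<otimes> s)" if "x \<in> carrier G" "s \<in> carrier G" for x s
    using that KG by (simp add: coset_mult_assoc)
  have SG: "s \<in> S \<Longrightarrow> s \<in> carrier G" for s using S(2) by auto
  have arcs: "sym_arcs ?\<Gamma> = {(?c x, ?c (x \<otimes> s)) |x s. x \<in> carrier G \<and> s \<in> S} \<union> {(?c (x \<otimes> s), ?c x) |x s. x \<in> carrier G \<and> s \<in> S}"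
    by (auto simp: sym_arcs_def quotient_cayley_graph_def RCOSETS_def cmult SG) metis+
  have "?c ` (\<lambda>x. x \<otimes> s) ` B = (\<lambda>C. C #> s) ` ?c ` B" if "s \<in> S" for s
    using that BG by (auto simp: image_image cmult SG subset_iff intro!: image_cong)
  then have finF: "finite F" using finB S(1) by (auto simp: F_def)
  have FV: "F \<subseteq> verts ?\<Gamma>" using BG SG unfolding F_def verts by blast
  have cD: "?c x = ?c y \<Longrightarrow> x \<in> carrier G \<Longrightarrow> y \<in> carrier G \<Longrightarrow> x \<in> D \<Longrightarrow> y \<in> D" for x y
  proof -
    assume xy: "?c x = ?c y" "x \<in> carrier G" "y \<in> carrier G" "x \<in> D"
    then have "y \<in> ?c x" using rcos_self[OF _ K, of y] by simp
    then show "y \<in> D" using D(2) xy(4) by (auto simp: r_coset_def)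
  qed
  define P where "P = ?c ` D - F"
  define Q where "Q = ?c ` (carrier G - D) - F"
  have disj: "?c ` D \<inter> ?c ` (carrier G - D) = {}" using cD D(1) by blast
  have walk: "(?c x, ?c (x \<otimes> g)) \<in> (sym_arcs ?\<Gamma>)\<^sup>*" if "g \<in> generate G S" "x \<in> carrier G" for g x
    using that
  proof (induction arbitrary: x rule: generate.induct)
    case (incl s)
    then show ?case by (intro r_into_rtrancl) (auto simp: arcs)
  next
    case (inv s)
    then have "(?c (x \<otimes> inv s \<otimes> s), ?c (x \<otimes> inv s)) \<in> sym_arcs ?\<Gamma>" using SG unfolding arcs by blast
    then show ?case using inv SG by (simp add: m_assoc r_into_rtrancl)
  next
    case (eng g h)
    have "g \<in> carrier G" "h \<in> carrier G" using eng.hyps generate_in_carrier[OF S(2)] by auto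
    then show ?case using eng.IH(1)[of x] eng.IH(2)[of "x \<otimes> g"] eng.prems by (simp add: m_assoc)
  qed simp
  \<comment> \<open>F must be nonempty for vertices to be joined to it. With \<open>J = {}\<close>
    finiteness means emptiness, so \<open>bd_generate\<close> would spread empty boundaries from S
    to the whole group and make D empty or everything.\<close>
  have "\<exists>b. b \<in> B"
  proof (rule ccontr)
    assume "\<nexists>b. b \<in> B"
    then have e: "bd D s = {}" if "s \<in> S" for s using that by (auto simp: B_def)
    have "bd D g = {}" if "g \<in> generate G S" for g
    proof -
      have "fin_over {} (bd D g)" using bd_generate[of "{}" S D g] e that S(2) fin_over_empty by auto
      then show ?thesis by (auto simp: fin_over_def set_mult_def)
    qed
    then have inv: "x \<in> D \<longleftrightarrow> x \<otimes> g \<in> D" if "x \<in> carrier G" "g \<in> carrier G" for x g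
      using that S(3) unfolding bd_def by blast
    have "D \<noteq> {}" "carrier G - D \<noteq> {}" using ni fin_over_empty by metis+
    then obtain x y where xy: "x \<in> D" "x \<in> carrier G" "y \<in> carrier G" "y \<notin> D" using D by auto
    then show False using inv[of x "inv x \<otimes> y"] by (simp flip: m_assoc)
  qed
  then obtain b where b: "b \<in> B" "b \<in> carrier G" using BG by auto
  show ?thesis unfolding ends_of_pair_def
  proof (rule num_ends_neq_1[OF finF FV, of P Q])
    show "P \<inter> Q = {}" using disj by (auto simp: P_def Q_def)
    show "P \<union> Q = verts ?\<Gamma> - F" using D(1) by (auto simp: P_def Q_def verts)
    show "infinite P" "infinite Q"
      using ni fin_over_coset_image[OF K] D(1) finF by (auto simp: P_def Q_def coset_image_def)
    show "sym_arcs ?\<Gamma> \<subseteq> verts ?\<Gamma> \<times> verts ?\<Gamma>" using SG by (auto simp: arcs verts)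
    show "\<exists>f\<in>F. (v, f) \<in> (sym_arcs ?\<Gamma>)\<^sup>*" if "v \<in> verts ?\<Gamma>" for v
    proof -
      obtain x where x: "x \<in> carrier G" "v = ?c x" using \<open>v \<in> _\<close> by (auto simp: verts)
      then have "(?c x, ?c (x \<otimes> (inv x \<otimes> b))) \<in> (sym_arcs ?\<Gamma>)\<^sup>*" using b S(3) by (intro walk) auto
      then have "(v, ?c b) \<in> (sym_arcs ?\<Gamma>)\<^sup>*" using x b by (simp flip: m_assoc)
      then show ?thesis using b by (auto simp: F_def)
    qed
    show "(p, q) \<notin> sym_arcs ?\<Gamma>" if pq: "p \<in> P" "q \<in> Q" for p q
    proof
      assume "(p, q) \<in> sym_arcs ?\<Gamma>"
      then obtain x s where xs: "x \<in> carrier G" "s \<in> S" "(p = ?c x \<and> q = ?c (x \<otimes> s)) \<or> (q = ?c x \<and> p = ?c (x \<otimes> s))"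
        by (auto simp: arcs)
      have inP: "y \<in> D" if "?c y \<in> P" "y \<in> carrier G" for y
        using that cD D(1) unfolding P_def by blast
      have inQ: "y \<notin> D" if "?c y \<in> Q" "y \<in> carrier G" for y
        using that cD D(1) unfolding Q_def by blast
      have xsG: "x \<otimes> s \<in> carrier G" using xs SG by simp
      have "x \<in> bd D s"
        using xs(3) pq inP[OF _ xs(1)] inP[OF _ xsG] inQ[OF _ xs(1)] inQ[OF _ xsG] xs(1) unfolding bd_def by blast
      then have "x \<in> B" using xs(2) unfolding B_def by blast
      then have "?c x \<in> F" unfolding F_def by blast
      then have "p \<in> F \<or> q \<in> F" using xs(3) by blast
      then show False using pq by (simp add: P_def Q_def)
    qed
    have "{v. \<exists>f\<in>F. (v, f) \<in> sym_arcs ?\<Gamma>} \<subseteq> (\<Union>s\<in>S. (\<lambda>C. C #> s) ` F) \<union> (\<Union>s\<in>S. (\<lambda>C. C #> inv s) ` F)"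
    proof
      fix v assume "v \<in> {v. \<exists>f\<in>F. (v, f) \<in> sym_arcs ?\<Gamma>}"
      then obtain x s f where xs: "x \<in> carrier G" "s \<in> S" "f \<in> F"
        "(f = ?c x \<and> v = ?c (x \<otimes> s)) \<or> (v = ?c x \<and> f = ?c (x \<otimes> s))"
        by (auto simp: arcs)
      then have "v = f #> s \<or> v = f #> inv s" using SG cmult[of x s] cmult[of "x \<otimes> s" "inv s"] by (auto simp: m_assoc)
      then show "v \<in> (\<Union>s\<in>S. (\<lambda>C. C #> s) ` F) \<union> (\<Union>s\<in>S. (\<lambda>C. C #> inv s) ` F)" using xs by blast
    qed
    then show "finite {v. \<exists>f\<in>F. (v, f) \<in> sym_arcs ?\<Gamma>}"
      using finF S(1) by (meson finite_UN finite_UnI finite_imageI finite_subset)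
  qed
qed

section \<open>Left translation, conjugate subgroups and finite index\<close>

section \<open>Translates, stabilisers and commensurability\<close>

no_notation subset_mset (infix \<open><#\<close> 50)

context group
begin

lemma lcos_mem: "g \<in> carrier G \<Longrightarrow> A \<subseteq> carrier G \<Longrightarrow> x \<in> g <# A \<longleftrightarrow> x \<in> carrier G \<and> inv g \<otimes> x \<in> A"
proof
  assume g: "g \<in> carrier G" "A \<subseteq> carrier G"
  {
    assume "x \<in> g <# A"
    then obtain a where "a \<in> A" "x = g \<otimes> a" by (auto simp: l_coset_def)
    moreover have "a \<in> carrier G" using \<open>a \<in> A\<close> g by auto
    ultimately show "x \<in> carrier G \<and> inv g \<otimes> x \<in> A" using g by (simp flip: m_assoc)
  next
    assume x: "x \<in> carrier G \<and> inv g \<otimes> x \<in> A"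
    then have "x = g \<otimes> (inv g \<otimes> x)" using g by (simp flip: m_assoc)
    then show "x \<in> g <# A" using x by (auto simp: l_coset_def)
  }
qed

lemma lcosI: "x \<in> A \<Longrightarrow> g \<otimes> x \<in> g <# A"
  by (auto simp: l_coset_def)

lemma lcos_closed: "g \<in> carrier G \<Longrightarrow> A \<subseteq> carrier G \<Longrightarrow> g <# A \<subseteq> carrier G"
  by (simp add: l_coset_subset_G)

lemma lcos_lcos: "g \<in> carrier G \<Longrightarrow> h \<in> carrier G \<Longrightarrow> A \<subseteq> carrier G \<Longrightarrow> g <# (h <# A) = (g \<otimes> h) <# A"
  by (simp add: lcos_m_assoc)

lemma lcos_inv_cancel [simp]:
  assumes "g \<in> carrier G" "A \<subseteq> carrier G"
  shows "inv g <# (g <# A) = A" "g <# (inv g <# A) = A"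
  using assms by (simp_all add: lcos_lcos lcos_mult_one)

lemma lcos_subset_iff:
  assumes "g \<in> carrier G" "A \<subseteq> carrier G" "B \<subseteq> carrier G"
  shows "g <# A \<subseteq> g <# B \<longleftrightarrow> A \<subseteq> B"
proof -
  have "g <# A \<subseteq> g <# B" if "A \<subseteq> B" for g A B using that by (auto simp: l_coset_def)
  then show ?thesis using assms lcos_inv_cancel(1)[OF assms(1)] by (metis inv_closed)
qed

lemma lcos_eq_iff:
  assumes "g \<in> carrier G" "A \<subseteq> carrier G" "B \<subseteq> carrier G"
  shows "g <# A = g <# B \<longleftrightarrow> A = B"
  using lcos_inv_cancel(1)[OF assms(1)] assms(2,3) by metis

lemma lcos_Diff:
  assumes "g \<in> carrier G" "A \<subseteq> carrier G" "B \<subseteq> carrier G"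
  shows "g <# (A - B) = (g <# A) - (g <# B)"
proof -
  have "A - B \<subseteq> carrier G" using assms by auto
  then show ?thesis using assms by (auto simp: lcos_mem)
qed

lemma lcos_carrier: "g \<in> carrier G \<Longrightarrow> g <# carrier G = carrier G"
  by (auto simp: lcos_mem)

lemma lcos_compl:
  "g \<in> carrier G \<Longrightarrow> A \<subseteq> carrier G \<Longrightarrow> g <# (carrier G - A) = carrier G - (g <# A)"
  by (simp add: lcos_Diff lcos_carrier)

lemma bd_lcos:
  assumes "g \<in> carrier G" "A \<subseteq> carrier G" "u \<in> carrier G"
  shows "bd (g <# A) u = g <# bd A u"
  using assms bd_subset[of A u] by (auto simp: lcos_mem bd_def m_assoc)

definition conj_set :: "'a \<Rightarrow> 'a set \<Rightarrow> 'a set" where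
  "conj_set g J = (\<lambda>j. g \<otimes> j \<otimes> inv g) ` J"

lemma conj_set_closed: "g \<in> carrier G \<Longrightarrow> J \<subseteq> carrier G \<Longrightarrow> conj_set g J \<subseteq> carrier G"
  by (auto simp: conj_set_def)

lemma conj_set_mem:
  assumes "g \<in> carrier G" "J \<subseteq> carrier G"
  shows "x \<in> conj_set g J \<longleftrightarrow> x \<in> carrier G \<and> inv g \<otimes> x \<otimes> g \<in> J"
proof
  assume "x \<in> conj_set g J"
  then obtain j where j: "j \<in> J" "x = g \<otimes> j \<otimes> inv g" by (auto simp: conj_set_def)
  then have "j \<in> carrier G" using assms by auto
  then show "x \<in> carrier G \<and> inv g \<otimes> x \<otimes> g \<in> J" using conj_inv_conj[of "inv g" j] j assms by simp
next
  assume x: "x \<in> carrier G \<and> inv g \<otimes> x \<otimes> g \<in> J"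
  then have "x = g \<otimes> (inv g \<otimes> x \<otimes> g) \<otimes> inv g" using conj_inv_conj assms by simp
  then show "x \<in> conj_set g J" using x unfolding conj_set_def by blast
qed

lemma subgroup_conj_set:
  assumes g: "g \<in> carrier G" and J: "subgroup J G"
  shows "subgroup (conj_set g J) G"
proof -
  have JG: "J \<subseteq> carrier G" using J by (rule subgroup.subset)
  have e: "inv g \<otimes> (a \<otimes> b) \<otimes> g = (inv g \<otimes> a \<otimes> g) \<otimes> (inv g \<otimes> b \<otimes> g)"
    if "a \<in> carrier G" "b \<in> carrier G" for a b
  proof -
    have "g \<otimes> (inv g \<otimes> (b \<otimes> g)) = b \<otimes> g" using that g by (simp flip: m_assoc)
    then show ?thesis using that g by (simp add: m_assoc)
  qed
  show ?thesis
  proof (rule subgroupI)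
    show "conj_set g J \<subseteq> carrier G" using g JG by (rule conj_set_closed)
    show "conj_set g J \<noteq> {}" using subgroup.one_closed[OF J] by (auto simp: conj_set_def)
  next
    fix a assume "a \<in> conj_set g J"
    then have a: "a \<in> carrier G" "inv g \<otimes> a \<otimes> g \<in> J" using conj_set_mem[OF g JG] by auto
    have "inv (inv g \<otimes> a \<otimes> g) = inv g \<otimes> inv a \<otimes> g" using a g by (simp add: inv_mult_group m_assoc)
    then show "inv a \<in> conj_set g J"
      using a conj_set_mem[OF g JG] subgroup.m_inv_closed[OF J a(2)] by simp
  next
    fix a b assume "a \<in> conj_set g J" "b \<in> conj_set g J"
    then show "a \<otimes> b \<in> conj_set g J"
      using conj_set_mem[OF g JG] e subgroup.m_closed[OF J] by simp
  qed
qed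

text \<open>Left translation turns cosets of J into cosets of its conjugate:
  \<open>g j f = (g j g^-1) (g f)\<close>.\<close>

lemma fin_over_lcos:
  assumes "g \<in> carrier G" "J \<subseteq> carrier G" "fin_over J P"
  shows "fin_over (conj_set g J) (g <# P)"
proof -
  obtain F where F: "finite F" "F \<subseteq> carrier G" "P \<subseteq> J <#> F" using assms by (auto elim: fin_overE)
  have "g <# P \<subseteq> conj_set g J <#> (g <# F)"
  proof
    fix x assume "x \<in> g <# P"
    then obtain j f where x: "j \<in> J" "f \<in> F" "x = g \<otimes> (j \<otimes> f)"
      using F(3) by (auto simp: l_coset_def set_mult_def)
    then have c: "j \<in> carrier G" "f \<in> carrier G" using assms F by auto
    have "inv g \<otimes> (g \<otimes> f) = f" using c assms by (simp flip: m_assoc)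
    then have "x = (g \<otimes> j \<otimes> inv g) \<otimes> (g \<otimes> f)" using x(3) c assms by (simp add: m_assoc)
    then show "x \<in> conj_set g J <#> (g <# F)" using x by (auto simp: conj_set_def intro!: set_multI lcosI)
  qed
  moreover have "finite (g <# F)" using F(1) by (auto simp: l_coset_def)
  moreover have "g <# F \<subseteq> carrier G" using assms F by (simp add: lcos_closed)
  ultimately show ?thesis by (intro fin_overI[of "g <# F"])
qed

lemma fin_over_trans:
  assumes "fin_over K J" "fin_over J P" "K \<subseteq> carrier G"
  shows "fin_over K P"
proof -
  obtain F F' where F: "finite F" "F \<subseteq> carrier G" "J \<subseteq> K <#> F"
    and F': "finite F'" "F' \<subseteq> carrier G" "P \<subseteq> J <#> F'"
    using assms by (auto elim!: fin_overE)
  have "P \<subseteq> (K <#> F) <#> F'" using F(3) F'(3) set_mult_mono[of J "K <#> F" F' F'] by auto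
  also have "\<dots> = K <#> (F <#> F')" using set_mult_assoc[of K F F'] assms F F' by simp
  finally have "P \<subseteq> K <#> (F <#> F')" .
  moreover have "finite (F <#> F')" using F F' by (auto simp: set_mult_def)
  moreover have "F <#> F' \<subseteq> carrier G" using F F' by (simp add: set_mult_closed)
  ultimately show ?thesis by (intro fin_overI)
qed

lemma fin_over_refl: "fin_over J J" if "J \<subseteq> carrier G"
proof (intro fin_overI[of "{\<one>}"] subsetI)
  fix x assume "x \<in> J"
  then have "x \<otimes> \<one> \<in> J <#> {\<one>}" by (intro set_multI) auto
  then show "x \<in> J <#> {\<one>}" using \<open>x \<in> J\<close> that by (simp add: subset_iff)
qed auto

lemma fin_over_mono_left: "fin_over J P \<Longrightarrow> J \<subseteq> J' \<Longrightarrow> fin_over J' P"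
  unfolding fin_over_def using set_mult_mono[of J J'] by (metis order_refl order_trans)

text \<open>A coset of A and a coset of B are disjoint or meet in a single coset of the
  intersection.\<close>

lemma fin_over_Int:
  assumes A: "subgroup A G" and B: "subgroup B G" and P: "fin_over A P" "fin_over B P"
  shows "fin_over (A \<inter> B) P"
proof -
  obtain F F' where F: "finite F" "F \<subseteq> carrier G" "P \<subseteq> A <#> F"
    and F': "finite F'" "F' \<subseteq> carrier G" "P \<subseteq> B <#> F'"
    using P by (auto elim!: fin_overE)
  have AG: "A \<subseteq> carrier G" and BG: "B \<subseteq> carrier G" using A B by (auto dest: subgroup.subset)
  have piece: "fin_over (A \<inter> B) ((A #> f) \<inter> (B #> f'))" if f: "f \<in> F" "f' \<in> F'" for f f'
  proof (cases "(A #> f) \<inter> (B #> f') = {}")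
    case False
    then obtain z where z: "z \<in> A #> f" "z \<in> B #> f'" by auto
    then have zG: "z \<in> carrier G" using r_coset_subset_G[OF AG, of f] f F(2) by auto
    have eq: "A #> f = A #> z" "B #> f' = B #> z"
      using repr_independence[of z A f] repr_independence[of z B f'] A B z f F(2) F'(2) by auto
    have "(A #> z) \<inter> (B #> z) \<subseteq> (A \<inter> B) <#> {z}"
    proof
      fix x assume "x \<in> (A #> z) \<inter> (B #> z)"
      then obtain a b where "a \<in> A" "b \<in> B" "x = a \<otimes> z" "x = b \<otimes> z" by (auto simp: r_coset_def)
      moreover from this have "a = b" using AG BG zG by (simp add: subset_iff)
      ultimately show "x \<in> (A \<inter> B) <#> {z}" by (auto intro: set_multI)
    qed
    then show ?thesis using zG unfolding eq by (intro fin_overI[of "{z}"]) auto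
  qed (simp add: fin_over_empty)
  have "P \<subseteq> (\<Union>f\<in>F. \<Union>f'\<in>F'. (A #> f) \<inter> (B #> f'))"
    using F(3) F'(3) by (fastforce simp: set_mult_def r_coset_def)
  moreover have "fin_over (A \<inter> B) (\<Union>f\<in>F. \<Union>f'\<in>F'. (A #> f) \<inter> (B #> f'))"
    using F(1) F'(1) piece by (intro fin_over_UN)
  ultimately show ?thesis by (rule fin_over_subset[rotated])
qed

lemma finite_index_iff:
  assumes "subgroup K G" "H \<subseteq> carrier G"
  shows "finite_index G K H \<longleftrightarrow> fin_over K H"
proof -
  have "rcosets\<^bsub>G\<lparr>carrier := H\<rparr>\<^esub> K = coset_image G K H"
    by (auto simp: RCOSETS_def coset_image_def r_coset_def)
  then show ?thesis using fin_over_coset_image[OF assms] by (simp add: finite_index_def)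
qed

lemma fin_over_avoid:
  assumes "\<not> fin_over J A" "A \<subseteq> carrier G" "finite F" "F \<subseteq> carrier G"
  shows "\<exists>q\<in>A. q \<notin> J <#> F"
  using assms fin_overI by blast

section \<open>Almost inclusion as a partial order\<close>

section \<open>Almost inclusion\<close>

definition stab :: "'a set \<Rightarrow> 'a set" where
  "stab A = {g \<in> carrier G. g <# A = A}"

text \<open>Almost invariance is taken over the full stabiliser, so that translates with different
  stabilisers can be compared without carrying base groups along.\<close>

definition ai :: "'a set \<Rightarrow> bool" where
  "ai A \<longleftrightarrow> A \<subseteq> carrier G \<and> (\<forall>u\<in>carrier G. fin_over (stab A) (bd A u)) \<and>
     \<not> fin_over (stab A) A \<and> \<not> fin_over (stab A) (carrier G - A)"

definition aleq :: "'a set \<Rightarrow> 'a set \<Rightarrow> bool" where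
  "aleq A B \<longleftrightarrow> fin_over (stab A) (A - B)"

text \<open>Almost inclusion is only a preorder. Admitting it when it is strict, and separating
  almost equal sets by true inclusion, makes the relation antisymmetric.\<close>

definition sub_le :: "'a set \<Rightarrow> 'a set \<Rightarrow> bool" where
  "sub_le A B \<longleftrightarrow> A \<subseteq> B \<or> (aleq A B \<and> \<not> aleq B A)"

lemma stab_closed: "stab A \<subseteq> carrier G" by (auto simp: stab_def)

lemma subgroup_stab: "A \<subseteq> carrier G \<Longrightarrow> subgroup (stab A) G"
proof (rule subgroupI)
  assume A: "A \<subseteq> carrier G"
  show "stab A \<subseteq> carrier G" by (rule stab_closed)
  show "stab A \<noteq> {}" using lcos_mult_one[OF A] by (auto simp: stab_def)
  show "inv g \<in> stab A" if "g \<in> stab A" for g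
    using that lcos_inv_cancel(1)[of g A] A by (auto simp: stab_def)
  show "g \<otimes> h \<in> stab A" if "g \<in> stab A" "h \<in> stab A" for g h
    using that lcos_lcos[of g h A] A by (auto simp: stab_def)
qed

lemma stab_mult: "A \<subseteq> carrier G \<Longrightarrow> j \<in> stab A \<Longrightarrow> x \<in> carrier G \<Longrightarrow> j \<otimes> x \<in> A \<longleftrightarrow> x \<in> A"
proof -
  assume A: "A \<subseteq> carrier G" and j: "j \<in> stab A" and x: "x \<in> carrier G"
  have jG: "j \<in> carrier G" "j <# A = A" using j by (auto simp: stab_def)
  then have "j \<otimes> x \<in> j <# A \<longleftrightarrow> x \<in> A" using lcos_mem[OF jG(1) A, of "j \<otimes> x"] x by (simp flip: m_assoc)
  then show ?thesis using jG(2) by simp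
qed

lemma stab_compl: "A \<subseteq> carrier G \<Longrightarrow> stab (carrier G - A) = stab A"
proof -
  assume A: "A \<subseteq> carrier G"
  have "carrier G - (g <# A) = carrier G - A \<longleftrightarrow> g <# A = A" if "g \<in> carrier G" for g
    using lcos_closed[OF that A] A by (metis double_diff order_refl)
  then show ?thesis using A by (auto simp: stab_def lcos_compl)
qed

lemma stab_lcos:
  assumes g: "g \<in> carrier G" and A: "A \<subseteq> carrier G"
  shows "stab (g <# A) = conj_set g (stab A)"
proof -
  have "h <# (g <# A) = g <# A \<longleftrightarrow> (inv g \<otimes> h \<otimes> g) <# A = A" if h: "h \<in> carrier G" for h
  proof -
    have "(inv g \<otimes> h \<otimes> g) <# A = inv g <# (h <# (g <# A))"
      using g h A by (simp add: lcos_lcos lcos_closed m_assoc)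
    moreover have "A = inv g <# (g <# A)" using g A by simp
    ultimately show ?thesis using lcos_eq_iff[of "inv g" "h <# (g <# A)" "g <# A"] g h A
      by (simp add: lcos_closed)
  qed
  then show ?thesis using conj_set_mem[OF g stab_closed[of A]] g by (auto simp: stab_def)
qed

lemma ai_compl: "ai A \<Longrightarrow> ai (carrier G - A)"
  unfolding ai_def by (auto simp: stab_compl bd_compl double_diff)

lemma conj_set_inv:
  assumes "g \<in> carrier G" "J \<subseteq> carrier G"
  shows "conj_set (inv g) (conj_set g J) = J"
proof -
  have "x \<in> conj_set (inv g) (conj_set g J) \<longleftrightarrow> x \<in> J" for x
  proof (cases "x \<in> carrier G")
    case True
    then have "inv g \<otimes> (g \<otimes> x \<otimes> inv g) \<otimes> g = x" using conj_inv_conj[of "inv g" x] assms by simp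
    then show ?thesis using True assms by (simp add: conj_set_mem conj_set_closed)
  next
    case False
    then show ?thesis using assms conj_set_closed[of "inv g" "conj_set g J"] conj_set_closed[of g J] by auto
  qed
  then show ?thesis by blast
qed

lemma fin_over_lcos_iff:
  assumes "g \<in> carrier G" "J \<subseteq> carrier G" "P \<subseteq> carrier G"
  shows "fin_over (conj_set g J) (g <# P) \<longleftrightarrow> fin_over J P"
  using fin_over_lcos[of "inv g" "conj_set g J" "g <# P"] fin_over_lcos[of g J P] assms
  by (auto simp: conj_set_inv conj_set_closed)

lemma ai_lcos:
  assumes "ai A" "g \<in> carrier G"
  shows "ai (g <# A)"
proof -
  have A: "A \<subseteq> carrier G" using assms by (simp add: ai_def)
  have "fin_over (stab (g <# A)) (bd (g <# A) u)" if "u \<in> carrier G" for u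
    using assms that A by (simp add: ai_def stab_lcos bd_lcos fin_over_lcos stab_closed)
  then show ?thesis using assms A
    by (simp add: ai_def stab_lcos fin_over_lcos_iff stab_closed lcos_closed flip: lcos_compl)
qed

text \<open>Since \<open>A\<close> is not \<open>stab A\<close>-finite, every point of \<open>A\<close> is a bounded distance from a point
  of \<open>A\<close> outside a given \<open>stab A\<close>-finite set.\<close>

lemma small_corner_switch:
  assumes A: "ai A" and B: "ai B" and s: "fin_over (stab A) (A \<inter> B)"
  shows "fin_over (stab B) (A \<inter> B)"
proof -
  have AG: "A \<subseteq> carrier G" and BG: "B \<subseteq> carrier G" using A B by (auto simp: ai_def)
  obtain F where F: "finite F" "F \<subseteq> carrier G" "A \<inter> B \<subseteq> stab A <#> F" using s by (rule fin_overE)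
  obtain q where q: "q \<in> A" "q \<notin> stab A <#> F"
    using fin_over_avoid[of "stab A" A F] A F AG by (auto simp: ai_def)
  have qG: "q \<in> carrier G" using q AG by auto
  have "A \<inter> B \<subseteq> (\<Union>f\<in>F. bd B (inv f \<otimes> q))"
  proof
    fix p assume p: "p \<in> A \<inter> B"
    then obtain j f where jf: "j \<in> stab A" "f \<in> F" "p = j \<otimes> f" using F(3) by (auto elim!: set_multE)
    have c: "j \<in> carrier G" "f \<in> carrier G" using jf F stab_closed by auto
    \<comment> \<open>Right multiplication by one of the finitely many
      \<open>inv f \<otimes> q\<close> moves p to \<open>j \<otimes> q\<close>, a point of A off the
      small set and hence outside B.\<close>
    have e: "p \<otimes> (inv f \<otimes> q) = j \<otimes> q"
    proof -
      have "f \<otimes> (inv f \<otimes> q) = q" using c qG by (simp flip: m_assoc)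
      then show ?thesis using c qG jf(3) by (simp add: m_assoc)
    qed
    have "j \<otimes> q \<in> A" using stab_mult[OF AG jf(1) qG] q by simp
    moreover have "j \<otimes> q \<notin> stab A <#> F"
    proof
      assume "j \<otimes> q \<in> stab A <#> F"
      then obtain j' f' where j': "j' \<in> stab A" "f' \<in> F" "j \<otimes> q = j' \<otimes> f'" by (auto elim!: set_multE)
      then have "q = inv j \<otimes> (j' \<otimes> f')" using c qG by (metis inv_closed inv_solve_left m_closed)
      then have "q = (inv j \<otimes> j') \<otimes> f'" using j' c F stab_closed[of A] by (simp add: m_assoc subset_iff)
      moreover have "inv j \<otimes> j' \<in> stab A" using subgroup_stab[OF AG] jf(1) j'(1)
        by (simp add: subgroup.m_closed subgroup.m_inv_closed)
      ultimately show False using q(2) j'(2) by (auto intro: set_multI)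
    qed
    ultimately have "j \<otimes> q \<notin> B" using F(3) by auto
    then have "p \<in> bd B (inv f \<otimes> q)" using p BG e by (auto simp: bd_def)
    then show "p \<in> (\<Union>f\<in>F. bd B (inv f \<otimes> q))" using jf(2) by blast
  qed
  moreover have "fin_over (stab B) (\<Union>f\<in>F. bd B (inv f \<otimes> q))"
    using F B qG by (intro fin_over_UN) (auto simp: ai_def)
  ultimately show ?thesis by (rule fin_over_subset[rotated])
qed

lemma aleq_compl:
  assumes "ai A" "ai B" "aleq A B"
  shows "aleq (carrier G - B) (carrier G - A)"
proof -
  have sub: "A \<subseteq> carrier G" "B \<subseteq> carrier G" using assms by (auto simp: ai_def)
  have e: "A - B = A \<inter> (carrier G - B)" "(carrier G - B) - (carrier G - A) = A \<inter> (carrier G - B)" using sub by auto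
  show ?thesis using small_corner_switch[OF assms(1) ai_compl[OF assms(2)]] assms(3)
    unfolding aleq_def e by blast
qed

lemma aleq_fin_over_right:
  assumes "ai A" "ai B" "aleq A B"
  shows "fin_over (stab B) (A - B)"
proof -
  have sub: "A \<subseteq> carrier G" "B \<subseteq> carrier G" using assms by (auto simp: ai_def)
  then have "(carrier G - B) - (carrier G - A) = A - B" by auto
  then show ?thesis using aleq_compl[OF assms] sub by (simp add: aleq_def stab_compl)
qed

text \<open>\<open>A - D\<close> lies in \<open>(A - B) \<union> (B - D)\<close>, which is finite
  over the stabiliser of B. A point q outside B and outside this set can be translated to within
  bounded distance of any p in \<open>A - D\<close>, and the translate is not in A. So p is near the
  boundary of A, which is finite over the stabiliser of A.\<close>

lemma aleq_trans:
  assumes A: "ai A" and B: "ai B" and D: "ai D" and AB: "aleq A B" and BD: "aleq B D"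
  shows "aleq A D"
proof -
  have AG: "A \<subseteq> carrier G" and BG: "B \<subseteq> carrier G" using A B by (auto simp: ai_def)
  have "fin_over (stab B) ((A - B) \<union> (B - D))"
    using aleq_fin_over_right[OF A B AB] BD by (auto simp: aleq_def intro: fin_over_Un)
  then obtain F where F: "finite F" "F \<subseteq> carrier G" "(A - B) \<union> (B - D) \<subseteq> stab B <#> F" by (rule fin_overE)
  obtain q where q: "q \<in> carrier G" "q \<notin> B" "q \<notin> stab B <#> F"
    using fin_over_avoid[of "stab B" "carrier G - B" F] B F by (auto simp: ai_def)
  have "A - D \<subseteq> (\<Union>f\<in>F. bd A (inv f \<otimes> q))"
  proof
    fix p assume p: "p \<in> A - D"
    then have "p \<in> stab B <#> F" using F(3) by auto
    then obtain j f where jf: "j \<in> stab B" "f \<in> F" "p = j \<otimes> f" by (auto elim!: set_multE)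
    have c: "j \<in> carrier G" "f \<in> carrier G" using jf F stab_closed by auto
    have e: "p \<otimes> (inv f \<otimes> q) = j \<otimes> q"
    proof -
      have "f \<otimes> (inv f \<otimes> q) = q" using c q by (simp flip: m_assoc)
      then show ?thesis using c q jf(3) by (simp add: m_assoc)
    qed
    have "j \<otimes> q \<notin> B" using stab_mult[OF BG jf(1) q(1)] q by simp
    moreover have "j \<otimes> q \<notin> stab B <#> F"
    proof
      assume "j \<otimes> q \<in> stab B <#> F"
      then obtain j' f' where j': "j' \<in> stab B" "f' \<in> F" "j \<otimes> q = j' \<otimes> f'" by (auto elim!: set_multE)
      then have "q = inv j \<otimes> (j' \<otimes> f')" using c q by (metis inv_closed inv_solve_left m_closed)
      then have "q = (inv j \<otimes> j') \<otimes> f'" using j' c F stab_closed[of B] by (simp add: m_assoc subset_iff)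
      moreover have "inv j \<otimes> j' \<in> stab B" using subgroup_stab[OF BG] jf(1) j'(1)
        by (simp add: subgroup.m_closed subgroup.m_inv_closed)
      ultimately show False using q(3) j'(2) by (auto intro: set_multI)
    qed
    ultimately have "j \<otimes> q \<notin> A" using F(3) by auto
    then have "p \<in> bd A (inv f \<otimes> q)" using p AG e by (auto simp: bd_def)
    then show "p \<in> (\<Union>f\<in>F. bd A (inv f \<otimes> q))" using jf(2) by blast
  qed
  moreover have "fin_over (stab A) (\<Union>f\<in>F. bd A (inv f \<otimes> q))"
    using F A q by (intro fin_over_UN) (auto simp: ai_def)
  ultimately show ?thesis unfolding aleq_def by (rule fin_over_subset[rotated])
qed

lemma subset_aleq: "A \<subseteq> B \<Longrightarrow> aleq A B"
  by (simp add: aleq_def fin_over_empty Diff_eq_empty_iff[THEN iffD2])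

lemma aleq_proper: "ai A \<Longrightarrow> aleq A B \<Longrightarrow> aleq A (carrier G - B) \<Longrightarrow> False"
proof -
  assume A: "ai A" and "aleq A B" "aleq A (carrier G - B)"
  then have "fin_over (stab A) ((A - B) \<union> (A - (carrier G - B)))"
    by (simp add: aleq_def fin_over_Un)
  moreover have "A \<subseteq> (A - B) \<union> (A - (carrier G - B))" by auto
  ultimately show False using A fin_over_subset by (auto simp: ai_def)
qed

lemma aleq_lcos:
  assumes "g \<in> carrier G" "A \<subseteq> carrier G" "B \<subseteq> carrier G"
  shows "aleq (g <# A) (g <# B) \<longleftrightarrow> aleq A B"
proof -
  have "A - B \<subseteq> carrier G" using assms by auto
  then show ?thesis using assms
    by (simp add: aleq_def stab_lcos fin_over_lcos_iff stab_closed flip: lcos_Diff)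
qed

lemma sub_le_imp_aleq: "sub_le A B \<Longrightarrow> aleq A B"
  using subset_aleq by (auto simp: sub_le_def)

lemma sub_le_antisym: "sub_le A B \<Longrightarrow> sub_le B A \<Longrightarrow> A = B"
  using subset_aleq by (auto simp: sub_le_def)

lemma sub_le_trans: "ai A \<Longrightarrow> ai B \<Longrightarrow> ai D \<Longrightarrow> sub_le A B \<Longrightarrow> sub_le B D \<Longrightarrow> sub_le A D"
  using aleq_trans[of A B D] aleq_trans[of D A B] aleq_trans[of B D A] subset_aleq
  unfolding sub_le_def by (metis order_trans)

lemma sub_le_compl:
  assumes "ai A" "ai B" "sub_le A B"
  shows "sub_le (carrier G - B) (carrier G - A)"
proof -
  have sub: "A \<subseteq> carrier G" "B \<subseteq> carrier G" using assms by (auto simp: ai_def)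
  have "aleq B A" if "aleq (carrier G - A) (carrier G - B)"
    using aleq_compl[OF ai_compl[OF assms(1)] ai_compl[OF assms(2)] that] sub by (simp add: double_diff)
  then show ?thesis using assms aleq_compl[of A B] unfolding sub_le_def by blast
qed

end

section \<open>The pocset axioms for the translates of Y\<close>

section \<open>From a nested almost invariant set to a splitting\<close>

context group
begin

text \<open>A one-sided condition: \<open>H \<inter> gHg^-1\<close> has finite index in
  \<open>gHg^-1\<close>. Closure under products is formal, closure under inverses is an assumption
  of the locales below.\<close>

definition commensurator :: "'a set \<Rightarrow> 'a set" where
  "commensurator H = {g \<in> carrier G. fin_over H (g <# H)}"

lemma lcos_set_mult:
  assumes "g \<in> carrier G" "J \<subseteq> carrier G" "F \<subseteq> carrier G"
  shows "g <# (J <#> F) = (g <# J) <#> F"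
proof -
  have "g \<otimes> (j \<otimes> f) = (g \<otimes> j) \<otimes> f" if "j \<in> J" "f \<in> F" for j f
    using assms that by (simp add: m_assoc subset_iff)
  then show ?thesis by (auto simp: l_coset_def set_mult_def)
qed

lemma lcos_mono: "A \<subseteq> B \<Longrightarrow> g <# A \<subseteq> g <# B"
  by (auto simp: l_coset_def)

lemma fin_over_lcos_both:
  assumes "g \<in> carrier G" "J \<subseteq> carrier G" "fin_over J P"
  shows "fin_over (g <# J) (g <# P)"
proof -
  obtain F where F: "finite F" "F \<subseteq> carrier G" "P \<subseteq> J <#> F" using assms by (auto elim: fin_overE)
  have "g <# P \<subseteq> (g <# J) <#> F" using lcos_mono[OF F(3), of g] lcos_set_mult[of g J F] assms F by simp
  then show ?thesis using F by (intro fin_overI[of F])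
qed

lemma fin_over_commensurator:
  assumes "H \<subseteq> carrier G" "c \<in> commensurator H" "fin_over H P"
  shows "fin_over H (c <# P)"
  using fin_over_trans[of H "c <# H" "c <# P"] fin_over_lcos_both[of c H P] assms
  by (simp add: commensurator_def)

text \<open>Orbit and stabiliser; inverses occur because \<open>inv h <# Y\<close>, not
  \<open>h <# Y\<close>, depends only on the right coset of h.\<close>

lemma fin_over_finite_orbit:
  assumes H: "subgroup H G" and Y: "Y \<subseteq> carrier G" and fin: "finite ((\<lambda>h. h <# Y) ` H)"
  shows "fin_over (H \<inter> stab Y) H"
proof -
  let ?L = "H \<inter> stab Y"
  have HG: "H \<subseteq> carrier G" using H by (rule subgroup.subset)
  have L: "subgroup ?L G" using H subgroup_stab[OF Y] by (rule subgroups_Inter_pair)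
  have eq: "?L #> h = ?L #> h'" if h: "h \<in> H" "h' \<in> H" "inv h <# Y = inv h' <# Y" for h h'
  proof -
    have c: "h \<in> carrier G" "h' \<in> carrier G" using h HG by auto
    have "(h \<otimes> inv h') <# Y = h <# (inv h' <# Y)" using c Y by (simp add: lcos_lcos)
    also have "\<dots> = Y" using c Y h(3)[symmetric] by simp
    finally have "h \<otimes> inv h' \<in> ?L"
      using H h c by (simp add: stab_def subgroup.m_closed subgroup.m_inv_closed)
    then have "h \<otimes> inv h' \<otimes> h' \<in> ?L #> h'" by (auto simp: r_coset_def)
    then have "h \<in> ?L #> h'" using c by (simp add: m_assoc)
    then show ?thesis using repr_independence[of h ?L h'] L c by simp
  qed
  define \<phi> where "\<phi> Z = ?L #> (SOME h. h \<in> H \<and> inv h <# Y = Z)" for Z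
  have "coset_image G ?L H \<subseteq> \<phi> ` (\<lambda>h. h <# Y) ` H"
  proof
    fix C assume "C \<in> coset_image G ?L H"
    then obtain h where h: "h \<in> H" "C = ?L #> h" by (auto simp: coset_image_def)
    define h' where "h' = (SOME k. k \<in> H \<and> inv k <# Y = inv h <# Y)"
    have "h' \<in> H \<and> inv h' <# Y = inv h <# Y" unfolding h'_def by (rule someI[of _ h]) (simp add: h)
    then have "C = ?L #> h'" using eq[of h h'] h by simp
    then have "C = \<phi> (inv h <# Y)" unfolding \<phi>_def h'_def .
    moreover have "inv h \<in> H" using H h by (simp add: subgroup.m_inv_closed)
    ultimately show "C \<in> \<phi> ` (\<lambda>h. h <# Y) ` H" by blast
  qed
  then have "finite (coset_image G ?L H)" using fin by (meson finite_imageI finite_subset)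
  then show ?thesis using fin_over_coset_image[OF L HG] by simp
qed

text \<open>Connectedness of the Cayley graph of H for T: a property that varies on H already
  changes across one generator. Finite generation of H is exploited through this.\<close>

lemma const_on_subgroup:
  assumes T: "T \<subseteq> carrier G" "H = generate G T"
    and step: "\<And>h t. h \<in> H \<Longrightarrow> t \<in> T \<Longrightarrow> P h \<longleftrightarrow> P (h \<otimes> t)"
    and h: "h \<in> H"
  shows "P h \<longleftrightarrow> P \<one>"
proof -
  have H: "subgroup H G" using T generate_is_subgroup by simp
  have HG: "H \<subseteq> carrier G" using H by (rule subgroup.subset)
  have "\<forall>k\<in>H. P k \<longleftrightarrow> P (k \<otimes> h)" if "h \<in> generate G T"
    using that
  proof (induction rule: generate.induct)
    case one
    then show ?case using HG by (simp add: subset_iff)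
  next
    case (incl t)
    then show ?case using step by simp
  next
    case (inv t)
    have "P k \<longleftrightarrow> P (k \<otimes> inv t)" if k: "k \<in> H" for k
    proof -
      have t: "t \<in> carrier G" "t \<in> H" using inv T generate.incl[of t T G] by auto
      have kG: "k \<in> carrier G" using k HG by auto
      have "k \<otimes> inv t \<in> H" using H k t by (simp add: subgroup.m_closed subgroup.m_inv_closed)
      then show ?thesis using step[of "k \<otimes> inv t" t] inv t(1) kG by (simp add: m_assoc)
    qed
    then show ?case by simp
  next
    case (eng h1 h2)
    have c: "h1 \<in> H" "h2 \<in> H" using eng T by auto
    have "P k \<longleftrightarrow> P (k \<otimes> (h1 \<otimes> h2))" if k: "k \<in> H" for k
    proof -
      have "k \<otimes> (h1 \<otimes> h2) = k \<otimes> h1 \<otimes> h2" using k c HG by (simp add: m_assoc subset_iff)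
      moreover have "k \<otimes> h1 \<in> H" using H k c by (simp add: subgroup.m_closed)
      ultimately show ?thesis using eng.IH k by simp
    qed
    then show ?case by simp
  qed
  then have "P \<one> \<longleftrightarrow> P (\<one> \<otimes> h)" using h T(2) subgroup.one_closed[OF H] by simp
  then show ?thesis using h HG by (simp add: subset_iff)
qed

end

text \<open>What is required of Y. A finite H-orbit replaces invariance under H, since the cut that
  yields Y need not be fixed by H. \<open>not_comm\<close> carries what is left of the vanishing
  strong self-intersection.\<close>

locale nested_set = group G for G :: "('a, 'm) monoid_scheme" (structure) +
  fixes S H T Y :: "'a set"
  assumes S: "finite S" "S \<subseteq> carrier G" "generate G S = carrier G"
    and H: "subgroup H G" and T: "finite T" "T \<subseteq> carrier G" "H = generate G T"
    and comm_inv: "g \<in> commensurator H \<Longrightarrow> inv g \<in> commensurator H"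
    and ends: "subgroup K G \<Longrightarrow> K \<subseteq> H \<Longrightarrow> \<not> fin_over K H \<Longrightarrow> ends_of_pair G S K = 1"
    and Y: "Y \<subseteq> carrier G" and bdY: "u \<in> carrier G \<Longrightarrow> fin_over H (bd Y u)"
    and niY: "\<not> fin_over H Y" "\<not> fin_over H (carrier G - Y)"
    and finite_orbit: "finite ((\<lambda>h. h <# Y) ` H)"
    and comm_nested: "c \<in> commensurator H \<Longrightarrow> nested_in (carrier G) Y (c <# Y)"
    and not_comm: "g \<in> carrier G - commensurator H \<Longrightarrow> g <# H \<subseteq> Y \<or> g <# H \<subseteq> carrier G - Y"
begin

abbreviation M where "M \<equiv> stab Y"

definition L where "L = H \<inter> M"

definition sides where "sides = {Y, carrier G - Y}"

definition E where "E = {g <# Z |g Z. g \<in> carrier G \<and> Z \<in> sides}"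

lemma HG: "H \<subseteq> carrier G" using H by (rule subgroup.subset)

lemma MG: "M \<subseteq> carrier G" by (rule stab_closed)

lemma subgroup_M: "subgroup M G" using Y by (rule subgroup_stab)

lemma subgroup_L: "subgroup L G" unfolding L_def using H subgroup_M by (rule subgroups_Inter_pair)

lemma LG: "L \<subseteq> carrier G" using subgroup_L by (rule subgroup.subset)

lemma L_sub: "L \<subseteq> H" "L \<subseteq> M" by (auto simp: L_def)

lemma fin_L_H: "fin_over L H"
  unfolding L_def by (rule fin_over_finite_orbit[OF H Y finite_orbit])

lemma ex_bd: "\<exists>u\<in>carrier G. \<exists>x\<in>carrier G. x \<in> bd Y u"
proof -
  have "Y \<noteq> {}" "carrier G - Y \<noteq> {}" using niY fin_over_empty by metis+
  then obtain x y where xy: "x \<in> Y" "y \<in> carrier G" "y \<notin> Y" by auto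
  then have x: "x \<in> carrier G" using Y by auto
  then have "x \<otimes> (inv x \<otimes> y) = y" using xy by (simp flip: m_assoc)
  then have "x \<in> bd Y (inv x \<otimes> y)" using xy x by (simp add: bd_def)
  then show ?thesis using x xy by blast
qed

text \<open>Elements of M carry a fixed boundary point of Y to boundary points, and these form an
  H-finite set.\<close>

lemma fin_H_M: "fin_over H M"
proof -
  obtain u x where ux: "u \<in> carrier G" "x \<in> carrier G" "x \<in> bd Y u" using ex_bd by blast
  have "M \<subseteq> {m \<in> carrier G. m \<otimes> x \<in> bd Y u}"
  proof
    fix m assume m: "m \<in> M"
    then have mG: "m \<in> carrier G" using MG by auto
    have "m \<otimes> x \<otimes> u = m \<otimes> (x \<otimes> u)" using mG ux by (simp add: m_assoc)
    then show "m \<in> {m \<in> carrier G. m \<otimes> x \<in> bd Y u}"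
      using ux mG stab_mult[OF Y m] by (auto simp: bd_def)
  qed
  then show ?thesis using fin_over_rmult[OF bdY[OF ux(1)] HG ux(2)] fin_over_subset by blast
qed

lemma fin_M_H: "fin_over M H"
  using fin_over_mono_left[OF fin_L_H L_sub(2)] .

lemma fin_M_iff: "fin_over M P \<longleftrightarrow> fin_over H P"
  using fin_over_trans[OF fin_M_H _ MG] fin_over_trans[OF fin_H_M _ HG] by blast

lemma sidesD:
  assumes "Z \<in> sides"
  shows "Z \<subseteq> carrier G" "u \<in> carrier G \<Longrightarrow> bd Z u = bd Y u" "stab Z = M"
    "\<not> fin_over H Z" "\<not> fin_over H (carrier G - Z)" "carrier G - Z \<in> sides"
  using assms Y niY by (auto simp: sides_def bd_compl stab_compl double_diff)

lemma Y_sides: "Y \<in> sides" "carrier G - Y \<in> sides" by (auto simp: sides_def)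

lemma side_cases: "Z \<in> sides \<Longrightarrow> A \<subseteq> Y \<or> A \<subseteq> carrier G - Y \<Longrightarrow> A \<subseteq> Z \<or> A \<subseteq> carrier G - Z"
  using Y by (auto simp: sides_def)

lemma ai_side: "Z \<in> sides \<Longrightarrow> ai Z"
  unfolding ai_def using sidesD[of Z] bdY by (auto simp: fin_M_iff)

lemma lcos_side_stab:
  assumes "Z \<in> sides" "l \<in> M"
  shows "l <# Z = Z"
proof -
  have "l \<in> stab Z" using assms sidesD(3)[of Z] by simp
  then show ?thesis by (simp add: stab_def)
qed

lemma ends_trivial:
  assumes K: "subgroup K G" "K \<subseteq> H" "\<not> fin_over K H"
    and D: "D \<subseteq> carrier G" "\<And>k d. k \<in> K \<Longrightarrow> d \<in> D \<Longrightarrow> k \<otimes> d \<in> D"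
    and bd: "\<And>u. u \<in> carrier G \<Longrightarrow> fin_over K (bd D u)"
  shows "fin_over K D \<or> fin_over K (carrier G - D)"
proof (rule ccontr)
  assume "\<not> ?thesis"
  then have "ends_of_pair G S K \<noteq> 1"
    using S K D bd by (intro ends_of_pair_neq_1[of S K D]) auto
  then show False using ends[OF K] by simp
qed

text \<open>A boundary point of the corner that is not on the boundary of Z lies in Z and is reached
  from gH by a step f out of a finite set. As gH avoids Z, this step crosses the boundary of Z, so
  the point is near an H-finite set.\<close>

lemma corner_bd:
  assumes Z: "Z \<in> sides" and W: "W \<in> sides" and g: "g \<in> carrier G"
    and gH: "g <# H \<subseteq> carrier G - Z" and u: "u \<in> carrier G"
  shows "fin_over H (bd (Z \<inter> (g <# W)) u)"
proof -
  have WG: "W \<subseteq> carrier G" using W sidesD(1) by auto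
  obtain F where F: "finite F" "F \<subseteq> carrier G" "bd W u \<subseteq> H <#> F"
    using bdY[OF u] sidesD(2)[OF W u] by (auto elim: fin_overE)
  define R where "R = (\<Union>f\<in>F. {x \<in> carrier G. x \<otimes> inv f \<in> bd Z f \<union> bd Z (f \<otimes> u)})"
  have "fin_over H (bd Z f \<union> bd Z (f \<otimes> u))" if "f \<in> F" for f
    using that F(2) u sidesD(2)[OF Z] bdY by (auto intro!: fin_over_Un)
  then have "fin_over H R" unfolding R_def using F HG by (intro fin_over_UN fin_over_rmult) auto
  then have fin: "fin_over H (bd Z u \<union> R)" using sidesD(2)[OF Z u] bdY[OF u] by (simp add: fin_over_Un)
  have "bd (Z \<inter> (g <# W)) u \<subseteq> bd Z u \<union> R"
  proof
    fix x assume x: "x \<in> bd (Z \<inter> (g <# W)) u"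
    show "x \<in> bd Z u \<union> R"
    proof (cases "x \<in> bd Z u")
      case False
      have xG: "x \<in> carrier G" using x by (simp add: bd_def)
      have "x \<in> bd (g <# W) u" "x \<in> Z" "x \<otimes> u \<in> Z" using x False by (auto simp: bd_def)
      then have "x \<in> g <# (H <#> F)" using bd_lcos[OF g WG u] lcos_mono[OF F(3)] by auto
      then obtain h f where hf: "h \<in> H" "f \<in> F" "x = g \<otimes> (h \<otimes> f)" by (auto simp: l_coset_def set_mult_def)
      have c: "h \<in> carrier G" "f \<in> carrier G" using hf HG F by auto
      have e: "x \<otimes> inv f = g \<otimes> h" "g \<otimes> h \<otimes> f = x" using hf(3) c g by (simp_all add: m_assoc)
      have "g \<otimes> h \<notin> Z" using gH hf(1) lcosI[of h H g] by auto
      then have "x \<otimes> inv f \<in> bd Z f" using e \<open>x \<in> Z\<close> g c by (simp add: bd_def)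
      then show ?thesis using hf(2) xG by (auto simp: R_def)
    qed simp
  qed
  then show ?thesis using fin fin_over_subset by blast
qed

text \<open>Applied from both sides, \<open>corner_bd\<close> makes the boundary of the corner
  finite over L and over its conjugate by g, hence over their intersection. This has infinite index
  in H since g is not in the commensurator, so the ends hypothesis makes the corner or its
  complement small, and the complement contains that of Z.\<close>

lemma small_corner:
  assumes Z: "Z \<in> sides" and W: "W \<in> sides" and g: "g \<in> carrier G" "g \<notin> commensurator H"
    and gH: "g <# H \<subseteq> carrier G - Z" "inv g <# H \<subseteq> carrier G - W"
  shows "fin_over H (Z \<inter> (g <# W))"
proof -
  have ZG: "Z \<subseteq> carrier G" and WG: "W \<subseteq> carrier G" using Z W sidesD(1) by auto
  let ?D = "Z \<inter> (g <# W)" and ?K = "L \<inter> conj_set g L"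
  have K: "subgroup ?K G" using subgroup_L subgroup_conj_set[OF g(1) subgroup_L] by (rule subgroups_Inter_pair)
  have DG: "?D \<subseteq> carrier G" using ZG by auto
  have bd1: "fin_over L (bd ?D u)" if "u \<in> carrier G" for u
    using fin_over_trans[OF fin_L_H corner_bd[OF Z W g(1) gH(1) that] LG] .
  have bd2: "fin_over (conj_set g L) (bd ?D u)" if u: "u \<in> carrier G" for u
  proof -
    have igG: "inv g \<in> carrier G" using g by simp
    have "fin_over L (bd (W \<inter> (inv g <# Z)) u)"
      using fin_over_trans[OF fin_L_H corner_bd[OF W Z igG gH(2) u] LG] .
    then have "fin_over (conj_set g L) (g <# bd (W \<inter> (inv g <# Z)) u)"
      using fin_over_lcos[OF g(1) LG] by simp
    moreover have "W \<inter> (inv g <# Z) \<subseteq> carrier G" using WG by auto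
    moreover have "g <# (W \<inter> (inv g <# Z)) = ?D"
    proof -
      have "W \<inter> (inv g <# Z) \<subseteq> carrier G" "inv g <# Z \<subseteq> carrier G" using WG ZG g by (auto simp: lcos_closed)
      then show ?thesis using g ZG WG by (auto simp: lcos_mem simp flip: m_assoc)
    qed
    ultimately show ?thesis using bd_lcos[OF g(1) _ u, of "W \<inter> (inv g <# Z)"] by simp
  qed
  have ni: "\<not> fin_over ?K H"
  proof
    assume "fin_over ?K H"
    then have "fin_over (conj_set g H) H"
      using fin_over_mono_left[of ?K H "conj_set g H"] L_sub by (auto simp: conj_set_def)
    then have "fin_over (conj_set (inv g) (conj_set g H)) (inv g <# H)"
      using fin_over_lcos[of "inv g" "conj_set g H" H] g HG by (simp add: conj_set_closed)
    then have "fin_over H (inv g <# H)" using conj_set_inv[OF g(1) HG] by simp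
    then have "inv g \<in> commensurator H" using g by (simp add: commensurator_def)
    then show False using comm_inv[of "inv g"] g by simp
  qed
  have "fin_over ?K ?D \<or> fin_over ?K (carrier G - ?D)"
  proof (rule ends_trivial[OF K _ ni DG])
    show "?K \<subseteq> H" using L_sub by auto
    show "fin_over ?K (bd ?D u)" if "u \<in> carrier G" for u
      using fin_over_Int[OF subgroup_L subgroup_conj_set[OF g(1) subgroup_L] bd1[OF that] bd2[OF that]] .
    show "k \<otimes> d \<in> ?D" if "k \<in> ?K" "d \<in> ?D" for k d
    proof -
      have d: "d \<in> Z" "d \<in> carrier G" "inv g \<otimes> d \<in> W" using that ZG lcos_mem[OF g(1) WG] by auto
      have k: "k \<in> M" "k \<in> carrier G" "inv g \<otimes> k \<otimes> g \<in> M"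
        using that L_sub LG conj_set_mem[OF g(1) LG] by auto
      have "k \<otimes> d \<in> Z" using stab_mult[OF ZG, of k d] sidesD(3)[OF Z] k d by simp
      moreover have "(inv g \<otimes> k \<otimes> g) \<otimes> (inv g \<otimes> d) \<in> W"
        using stab_mult[OF WG, of _ "inv g \<otimes> d"] sidesD(3)[OF W] k d g by simp
      moreover have "(inv g \<otimes> k \<otimes> g) \<otimes> (inv g \<otimes> d) = inv g \<otimes> (k \<otimes> d)"
      proof -
        have "g \<otimes> (inv g \<otimes> d) = d" using g d by (simp flip: m_assoc)
        then show ?thesis using g k d by (simp add: m_assoc)
      qed
      ultimately show ?thesis using lcos_mem[OF g(1) WG] k d by simp
    qed
  qed
  moreover have KH: "?K \<subseteq> H" using L_sub by auto
  moreover have "\<not> fin_over ?K (carrier G - ?D)"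
  proof
    assume "fin_over ?K (carrier G - ?D)"
    then have "fin_over H (carrier G - ?D)" using KH by (rule fin_over_mono_left)
    moreover have "carrier G - Z \<subseteq> carrier G - ?D" by auto
    ultimately show False using sidesD(5)[OF Z] fin_over_subset by blast
  qed
  ultimately show ?thesis using fin_over_mono_left by blast
qed

text \<open>Almost equality makes the boundary of kW finite over H. It contains \<open>k m x\<close>
  for every m in M and a boundary point x of Y, so kM and then kH are H-finite. Almost inclusions
  outside the commensurator are therefore strict.\<close>

lemma comm_of_almost_equal:
  assumes Z: "Z \<in> sides" and W: "W \<in> sides" and k: "k \<in> carrier G"
    and eq: "aleq Z (k <# W)" "aleq (k <# W) Z"
  shows "k \<in> commensurator H"
proof -
  let ?B = "k <# W"
  have WG: "W \<subseteq> carrier G" using W sidesD(1) by auto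
  have aiB: "ai ?B" using ai_lcos[OF ai_side[OF W] k] .
  have "fin_over M (Z - ?B)" "fin_over M (?B - Z)"
    using eq(1) aleq_fin_over_right[OF aiB ai_side[OF Z] eq(2)] sidesD(3)[OF Z] by (simp_all add: aleq_def)
  then have d: "fin_over H ((Z - ?B) \<union> (?B - Z))" using fin_M_iff fin_over_Un by blast
  obtain u x where ux: "u \<in> carrier G" "x \<in> carrier G" "x \<in> bd Y u" using ex_bd by blast
  have "bd ?B u \<subseteq> ((Z - ?B) \<union> (?B - Z)) \<union> bd Z u \<union> {x \<in> carrier G. x \<otimes> u \<in> (Z - ?B) \<union> (?B - Z)}"
    by (auto simp: bd_def)
  moreover have "fin_over H (((Z - ?B) \<union> (?B - Z)) \<union> bd Z u \<union> {x \<in> carrier G. x \<otimes> u \<in> (Z - ?B) \<union> (?B - Z)})"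
    using d bdY[OF ux(1)] fin_over_rmult[OF d HG ux(1)] unfolding sidesD(2)[OF Z ux(1)]
    by (intro fin_over_Un[of H "_ \<union> bd Y u"] fin_over_Un[of H _ "bd Y u"])
  ultimately have finB: "fin_over H (bd ?B u)" using fin_over_subset by blast
  have "k <# M \<subseteq> {z \<in> carrier G. z \<otimes> x \<in> bd ?B u}"
  proof
    fix z assume "z \<in> k <# M"
    then obtain m where m: "m \<in> M" "z = k \<otimes> m" by (auto simp: l_coset_def)
    then have mG: "m \<in> carrier G" using MG by auto
    have "m \<otimes> x \<in> bd Y u" using ux mG stab_mult[OF Y m(1)] by (simp add: bd_def m_assoc)
    then have "k \<otimes> (m \<otimes> x) \<in> bd ?B u" using bd_lcos[OF k WG ux(1)] sidesD(2)[OF W ux(1)] lcosI by simp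
    then show "z \<in> {z \<in> carrier G. z \<otimes> x \<in> bd ?B u}" using m mG k ux by (simp add: m_assoc)
  qed
  then have "fin_over H (k <# M)" using fin_over_rmult[OF finB HG ux(2)] fin_over_subset by blast
  moreover have "fin_over (k <# M) (k <# H)" using fin_over_lcos_both[OF k MG fin_M_H] .
  ultimately have "fin_over H (k <# H)" using fin_over_trans HG by blast
  then show ?thesis using k by (simp add: commensurator_def)
qed

lemma not_comm_side:
  assumes "g \<in> carrier G" "g \<notin> commensurator H"
  shows "\<exists>Z\<in>sides. g <# H \<subseteq> carrier G - Z"
  using not_comm[of g] assms Y_sides Y by (metis DiffI double_diff order_refl)

lemma not_comm_inv: "g \<in> carrier G \<Longrightarrow> g \<notin> commensurator H \<Longrightarrow> inv g \<notin> commensurator H"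
  using comm_inv[of "inv g"] by auto

definition nested4 where
  "nested4 A B \<longleftrightarrow> sub_le A B \<or> sub_le A (carrier G - B) \<or> sub_le (carrier G - A) B
     \<or> sub_le (carrier G - A) (carrier G - B)"

lemma nested4_compl:
  "A \<subseteq> carrier G \<Longrightarrow> nested4 (carrier G - A) B \<longleftrightarrow> nested4 A B"
  "B \<subseteq> carrier G \<Longrightarrow> nested4 A (carrier G - B) \<longleftrightarrow> nested4 A B"
  unfolding nested4_def by (simp_all add: double_diff) blast+

lemma sub_le_lcos:
  assumes "g \<in> carrier G" "A \<subseteq> carrier G" "B \<subseteq> carrier G"
  shows "sub_le (g <# A) (g <# B) \<longleftrightarrow> sub_le A B"
  using assms by (simp add: sub_le_def lcos_subset_iff aleq_lcos)

lemma nested4_lcos: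
  assumes "g \<in> carrier G" "A \<subseteq> carrier G" "B \<subseteq> carrier G"
  shows "nested4 (g <# A) (g <# B) \<longleftrightarrow> nested4 A B"
  using assms sub_le_lcos[of g] by (simp add: nested4_def flip: lcos_compl)

lemma small_corner_sub_le:
  assumes Z: "Z \<in> sides" and W: "W \<in> sides" and g: "g \<in> carrier G" "g \<notin> commensurator H"
    and gH: "g <# H \<subseteq> carrier G - Z" "inv g <# H \<subseteq> carrier G - W"
  shows "sub_le Z (g <# (carrier G - W))"
proof -
  have ZG: "Z \<subseteq> carrier G" and WG: "W \<subseteq> carrier G" using Z W sidesD(1) by auto
  have "Z - (g <# (carrier G - W)) = Z \<inter> (g <# W)" using ZG WG g by (auto simp: lcos_compl)
  then have "aleq Z (g <# (carrier G - W))"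
    using small_corner[OF assms] sidesD(3)[OF Z] by (simp add: aleq_def fin_M_iff)
  moreover have "\<not> aleq (g <# (carrier G - W)) Z"
    using comm_of_almost_equal[OF Z sidesD(6)[OF W] g(1)] g(2) calculation by blast
  ultimately show ?thesis by (simp add: sub_le_def)
qed

lemma nested4_Y:
  assumes k: "k \<in> carrier G"
  shows "nested4 Y (k <# Y)"
proof (cases "k \<in> commensurator H")
  case True
  have kY: "k <# Y \<subseteq> carrier G" using k Y by (rule lcos_closed)
  have "Y \<subseteq> k <# Y \<or> carrier G - Y \<subseteq> carrier G - (k <# Y) \<or> Y \<subseteq> carrier G - (k <# Y) \<or> carrier G - Y \<subseteq> k <# Y"
    using comm_nested[OF True] Y kY unfolding nested_in_def by blast
  then show ?thesis unfolding nested4_def sub_le_def by blast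
next
  case False
  obtain Z W where ZW: "Z \<in> sides" "W \<in> sides" "k <# H \<subseteq> carrier G - Z" "inv k <# H \<subseteq> carrier G - W"
    using not_comm_side[OF k False] not_comm_side[of "inv k"] not_comm_inv[OF k False] k by blast
  have kY: "k <# Y \<subseteq> carrier G" using k Y by (rule lcos_closed)
  have "nested4 Z (k <# (carrier G - W))"
    using small_corner_sub_le[OF ZW(1,2) k False ZW(3,4)] by (simp add: nested4_def)
  then show ?thesis
    using ZW(1,2) Y kY k by (auto simp: sides_def lcos_compl nested4_compl double_diff)
qed

lemma E_side: "Z \<in> sides \<Longrightarrow> Z \<in> E"
  using lcos_mult_one[of Z] sidesD(1)[of Z] one_closed unfolding E_def by force

lemma E_D:
  assumes "A \<in> E"
  shows "A \<subseteq> carrier G" "ai A" "carrier G - A \<in> E" "g \<in> carrier G \<Longrightarrow> g <# A \<in> E"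
proof -
  obtain k Z where kZ: "k \<in> carrier G" "Z \<in> sides" "A = k <# Z" using assms by (auto simp: E_def)
  have ZG: "Z \<subseteq> carrier G" using kZ sidesD(1) by simp
  show "A \<subseteq> carrier G" "ai A" using kZ ZG lcos_closed ai_lcos ai_side by auto
  have "carrier G - A = k <# (carrier G - Z)" using kZ ZG by (simp add: lcos_compl)
  then show "carrier G - A \<in> E" using kZ sidesD(6)[OF kZ(2)] by (auto simp: E_def)
  show "g <# A \<in> E" if g: "g \<in> carrier G"
  proof -
    have "g <# A = (g \<otimes> k) <# Z" using kZ ZG g by (simp add: lcos_lcos)
    then show ?thesis using kZ g unfolding E_def by blast
  qed
qed

lemma nested4_E:
  assumes "A \<in> E" "B \<in> E"
  shows "nested4 A B"
proof -
  obtain a Z b W where aZ: "a \<in> carrier G" "Z \<in> sides" "A = a <# Z" and bW: "b \<in> carrier G" "W \<in> sides" "B = b <# W"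
    using assms by (auto simp: E_def)
  have aY: "a <# Y \<subseteq> carrier G" "b <# Y \<subseteq> carrier G" using aZ bW Y by (auto simp: lcos_closed)
  have c: "inv a \<otimes> b \<in> carrier G" using aZ bW by simp
  have "b <# Y = a <# ((inv a \<otimes> b) <# Y)" using aZ bW Y by (simp add: lcos_lcos flip: m_assoc)
  then have "nested4 (a <# Y) (b <# Y)"
    using nested4_lcos[OF aZ(1) Y, of "(inv a \<otimes> b) <# Y"] nested4_Y[OF c] lcos_closed[OF c Y] by simp
  then show ?thesis using aZ bW aY Y by (auto simp: sides_def lcos_compl nested4_compl)
qed

text \<open>Two translates are exactly nested as soon as thickened copies of their coboundaries, which
  are connected because \<open>H\<close> is finitely generated, do not meet.\<close>

lemma exactly_nested:
  "\<exists>F. finite F \<and> F \<subseteq> carrier G \<and> (\<forall>g\<in>carrier G. g \<notin> (H <#> F) <#> H \<longrightarrow> inv g \<notin> (H <#> F) <#> H \<longrightarrow>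
     (\<exists>Z\<in>sides. \<exists>W\<in>sides. Z \<inter> (g <# W) = {}))"
proof -
  have "fin_over H (\<Union>s\<in>S \<union> (\<lambda>s. inv s) ` S. bd Y s)" using S bdY by (intro fin_over_UN) auto
  then obtain F0 where F0: "finite F0" "F0 \<subseteq> carrier G" "(\<Union>s\<in>S \<union> (\<lambda>s. inv s) ` S. bd Y s) \<subseteq> H <#> F0"
    by (rule fin_overE)
  \<comment> \<open>Taking F0 along with T keeps the whole thickened coset
    \<open>g <# (H <#> F0)\<close>, not just gH, on one side of Y once g is outside HFH.\<close>
  have "fin_over H (\<Union>u\<in>T \<union> F0. bd Y u)" using T F0 bdY by (intro fin_over_UN) auto
  then obtain F where F: "finite F" "F \<subseteq> carrier G" "(\<Union>u\<in>T \<union> F0. bd Y u) \<subseteq> H <#> F" by (rule fin_overE)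
  have const: "\<exists>Z\<in>sides. g <# (H <#> F0) \<subseteq> carrier G - Z"
    if g: "g \<in> carrier G" "g \<notin> (H <#> F) <#> H" for g
  proof -
    have no: "g \<otimes> h \<notin> bd Y u" if "h \<in> H" "u \<in> T \<union> F0" for h u
    proof
      assume "g \<otimes> h \<in> bd Y u"
      then have "g \<otimes> h \<in> H <#> F" using F(3) that by blast
      moreover have "inv h \<in> H" using that H by (simp add: subgroup.m_inv_closed)
      ultimately have "g \<otimes> h \<otimes> inv h \<in> (H <#> F) <#> H" by (rule set_multI)
      moreover have "g \<otimes> h \<otimes> inv h = g" using g that HG by (simp add: m_assoc subset_iff)
      ultimately show False using g(2) by simp
    qed
    have st: "g \<otimes> h \<in> Y \<longleftrightarrow> g \<otimes> (h \<otimes> u) \<in> Y" if "h \<in> H" "u \<in> T \<union> F0" for h u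
    proof -
      have "h \<in> carrier G" "u \<in> carrier G" using that HG T F0 by auto
      then show ?thesis using no[OF that] g by (simp add: bd_def m_assoc)
    qed
    have "g \<otimes> h \<in> Y \<longleftrightarrow> g \<otimes> \<one> \<in> Y" if "h \<in> H" for h
      by (rule const_on_subgroup[OF T(2,3) _ that]) (use st in auto)
    then have "g \<otimes> (h \<otimes> f) \<in> Y \<longleftrightarrow> g \<otimes> \<one> \<in> Y" if "h \<in> H" "f \<in> F0" for h f
      using st[of h f] that by auto
    then have "g <# (H <#> F0) \<subseteq> Y \<or> (g <# (H <#> F0)) \<inter> Y = {}" by (auto simp: l_coset_def set_mult_def)
    moreover have "g <# (H <#> F0) \<subseteq> carrier G" using g HG F0 by (simp add: lcos_closed set_mult_closed)
    ultimately have "g <# (H <#> F0) \<subseteq> carrier G - (carrier G - Y) \<or> g <# (H <#> F0) \<subseteq> carrier G - Y"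
      by blast
    then show ?thesis using Y_sides by blast
  qed
  have "\<exists>Z\<in>sides. \<exists>W\<in>sides. Z \<inter> (g <# W) = {}"
    if g: "g \<in> carrier G" "g \<notin> (H <#> F) <#> H" "inv g \<notin> (H <#> F) <#> H" for g
  proof -
    obtain Z W where Z: "Z \<in> sides" "g <# (H <#> F0) \<subseteq> carrier G - Z"
      and W: "W \<in> sides" "inv g <# (H <#> F0) \<subseteq> carrier G - W"
      using const[OF g(1,2)] const[of "inv g"] g by auto
    have ZG: "Z \<subseteq> carrier G" and WG: "W \<subseteq> carrier G" using Z W sidesD(1) by auto
    have W': "x \<notin> g <# W" if "x \<in> H <#> F0" for x
      using lcosI[OF that, of "inv g"] W(2) lcos_mem[OF g(1) WG] by auto
    \<comment> \<open>An edge leaving the corner would start on the boundary of Z, which avoids gW,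
      or on the boundary of gW, which avoids Z. So the corner is closed under the generators and
      their inverses, hence empty or everything.\<close>
    have step: "x \<otimes> s \<in> Z \<inter> (g <# W)" if x: "x \<in> Z \<inter> (g <# W)" and s: "s \<in> S \<union> (\<lambda>s. inv s) ` S" for x s
    proof -
      have sG: "s \<in> carrier G" using s S(2) by auto
      have xG: "x \<in> carrier G" using x ZG by auto
      have b: "bd Y s \<subseteq> H <#> F0" using F0(3) s by blast
      have "x \<notin> bd Z s" using W'[of x] x b sidesD(2)[OF Z(1) sG] by auto
      moreover have "bd (g <# W) s \<subseteq> g <# (H <#> F0)"
        using bd_lcos[OF g(1) WG sG] sidesD(2)[OF W(1) sG] lcos_mono[OF b] by simp
      then have "x \<notin> bd (g <# W) s" using x Z(2) by auto
      ultimately show ?thesis using x xG by (auto simp: bd_def)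
    qed
    have inv: "x \<otimes> v \<in> Z \<inter> (g <# W)" if "v \<in> generate G S" "x \<in> Z \<inter> (g <# W)" for v x
      using that
    proof (induction arbitrary: x rule: generate.induct)
      case one
      then show ?case using ZG by auto
    next
      case (incl h)
      then show ?case using step by blast
    next
      case (inv h)
      then show ?case using step by blast
    next
      case (eng h1 h2)
      have "h1 \<in> carrier G" "h2 \<in> carrier G" "x \<in> carrier G"
        using eng.hyps eng.prems generate_in_carrier[OF S(2)] ZG by auto
      then show ?case using eng.IH(2)[OF eng.IH(1)[OF eng.prems]] by (simp add: m_assoc)
    qed
    have "Z \<inter> (g <# W) = {}"
    proof (rule ccontr)
      assume "Z \<inter> (g <# W) \<noteq> {}"
      then obtain x where x: "x \<in> Z \<inter> (g <# W)" by blast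
      then have xG: "x \<in> carrier G" using ZG by auto
      have "y \<in> Z" if "y \<in> carrier G" for y
        using inv[of "inv x \<otimes> y" x] x xG that S(3) by (simp flip: m_assoc)
      then have "carrier G - Z = {}" by auto
      then show False using sidesD(5)[OF Z(1)] fin_over_empty by metis
    qed
    then show ?thesis using Z W by blast
  qed
  then show ?thesis using F by blast
qed

text \<open>Write D as gV. If g and its inverse are outside HFH, one corner is truly empty, and
  strict almost inclusion leaves only \<open>Z \<subseteq> D\<close> among the four possibilities.
  Otherwise g is hfk with f or its inverse in F, and kV runs through finitely many sets.\<close>

lemma finite_inexact:
  "\<exists>\<D>. finite \<D> \<and> (\<forall>D\<in>\<D>. D \<subseteq> carrier G) \<and> (\<forall>Z\<in>sides. \<forall>D\<in>E. sub_le Z D \<longrightarrow> \<not> Z \<subseteq> D \<longrightarrow> (\<exists>h\<in>H. \<exists>D0\<in>\<D>. D = h <# D0))"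
proof -
  obtain F where F: "finite F" "F \<subseteq> carrier G"
    "\<And>g. g \<in> carrier G \<Longrightarrow> g \<notin> (H <#> F) <#> H \<Longrightarrow> inv g \<notin> (H <#> F) <#> H \<Longrightarrow>
     (\<exists>Z\<in>sides. \<exists>W\<in>sides. Z \<inter> (g <# W) = {})"
    using exactly_nested by blast
  define \<W> where "\<W> = (\<lambda>h. h <# Y) ` H \<union> (\<lambda>h. carrier G - (h <# Y)) ` H"
  define \<D> where "\<D> = (\<Union>f\<in>F \<union> (\<lambda>f. inv f) ` F. (\<lambda>W. f <# W) ` \<W>)"
  have "(\<lambda>h. carrier G - (h <# Y)) ` H = (\<lambda>A. carrier G - A) ` (\<lambda>h. h <# Y) ` H" by (simp add: image_image)
  then have "finite \<W>" using finite_orbit by (simp add: \<W>_def)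
  then have fin: "finite \<D>" using F(1) by (simp add: \<D>_def)
  have WG: "W \<subseteq> carrier G" if "W \<in> \<W>" for W
    using that lcos_closed[OF subsetD[OF HG] Y] unfolding \<W>_def by blast
  have DG: "D \<subseteq> carrier G" if "D \<in> \<D>" for D
    using that F(2) WG lcos_closed unfolding \<D>_def by blast
  have hW: "h <# W \<in> \<W>" if "h \<in> H" "W \<in> sides" for h W
    using that HG Y by (auto simp: \<W>_def sides_def lcos_compl subset_iff)
  have mem: "\<exists>h\<in>H. \<exists>D0\<in>\<D>. g <# W = h <# D0" if g: "g \<in> carrier G" "g \<in> (H <#> F) <#> H \<or> inv g \<in> (H <#> F) <#> H" and W: "W \<in> sides" for g W
  proof -
    obtain h f k where hfk: "h \<in> H" "f \<in> F \<union> (\<lambda>f. inv f) ` F" "k \<in> H" "g = h \<otimes> f \<otimes> k"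
    proof (cases "g \<in> (H <#> F) <#> H")
      case True
      then obtain h f k where "h \<in> H" "f \<in> F" "k \<in> H" "g = h \<otimes> f \<otimes> k" by (auto elim!: set_multE)
      then show ?thesis using that by blast
    next
      case False
      then obtain h f k where hfk: "h \<in> H" "f \<in> F" "k \<in> H" "inv g = h \<otimes> f \<otimes> k"
        using g(2) by (auto elim!: set_multE)
      then have c: "h \<in> carrier G" "f \<in> carrier G" "k \<in> carrier G" using HG F by auto
      have "g = inv (h \<otimes> f \<otimes> k)" using g(1) hfk(4) by (metis inv_inv)
      then have "g = inv k \<otimes> inv f \<otimes> inv h" using c by (simp add: inv_mult_group m_assoc)
      moreover have "inv k \<in> H" "inv h \<in> H" using hfk H by (auto simp: subgroup.m_inv_closed)
      ultimately show ?thesis using that[of "inv k" "inv f" "inv h"] hfk(2) by blast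
    qed
    have c: "h \<in> carrier G" "f \<in> carrier G" "k \<in> carrier G" using hfk HG F by auto
    have "g <# W = h <# (f <# (k <# W))"
      using hfk(4) c sidesD(1)[OF W] by (simp add: lcos_lcos lcos_closed m_assoc)
    moreover have "f <# (k <# W) \<in> \<D>" using hW[OF hfk(3) W] hfk(2) unfolding \<D>_def by blast
    ultimately show ?thesis using hfk(1) by blast
  qed
  have "\<exists>h\<in>H. \<exists>D0\<in>\<D>. D = h <# D0" if Z: "Z \<in> sides" and D: "D \<in> E" and le: "sub_le Z D" "\<not> Z \<subseteq> D" for Z D
  proof -
    obtain g V where gV: "g \<in> carrier G" "V \<in> sides" "D = g <# V" using D by (auto simp: E_def)
    have aiZ: "ai Z" and aiD: "ai D" using ai_side[OF Z] E_D(2)[OF D] by auto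
    have sub: "Z \<subseteq> carrier G" "D \<subseteq> carrier G" using aiZ aiD by (auto simp: ai_def)
    have al: "aleq Z D" "\<not> aleq D Z" using le by (auto simp: sub_le_def)
    have "g \<in> (H <#> F) <#> H \<or> inv g \<in> (H <#> F) <#> H"
    proof (rule ccontr)
      assume "\<not> ?thesis"
      then obtain Z' W' where ZW: "Z' \<in> sides" "W' \<in> sides" "Z' \<inter> (g <# W') = {}" using F(3)[OF gV(1)] by blast
      have Z': "Z' = Z \<or> Z' = carrier G - Z" using ZW(1) Z Y by (auto simp: sides_def)
      have "W' = V \<or> W' = carrier G - V" using ZW(2) gV(2) Y by (auto simp: sides_def)
      then have D': "g <# W' = D \<or> g <# W' = carrier G - D"
        using gV sidesD(1)[OF gV(2)] by (auto simp: lcos_compl)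
      have "Z \<inter> D = {} \<or> Z \<inter> (carrier G - D) = {} \<or> (carrier G - Z) \<inter> D = {} \<or> (carrier G - Z) \<inter> (carrier G - D) = {}"
        using ZW(3) Z' D' by auto
      then have "Z \<subseteq> carrier G - D \<or> Z \<subseteq> D \<or> D \<subseteq> Z \<or> carrier G - D \<subseteq> Z" using sub by blast
      moreover have "\<not> Z \<subseteq> carrier G - D" using aleq_proper[OF aiZ al(1)] subset_aleq by blast
      moreover have "\<not> D \<subseteq> Z" using al(2) subset_aleq by blast
      moreover have "\<not> carrier G - D \<subseteq> Z"
        using aleq_proper[OF ai_compl[OF aiD] _ aleq_compl[OF aiZ aiD al(1)]] subset_aleq by blast
      ultimately show False using le(2) by blast
    qed
    then show ?thesis using mem[OF gV(1) _ gV(2)] gV(3) by simp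
  qed
  then show ?thesis by (intro exI[of _ \<D>] conjI fin) (simp_all add: DG)
qed

text \<open>The translates above Z that do not contain Z are L-translates of finitely many sets,
  each missing only an M-finite part of Z. The union of these defects and their M-translates is
  still M-finite, and any point of Z outside it serves. One witness for all upper bounds is what
  makes intervals finite.\<close>

lemma deep_point:
  assumes Z: "Z \<in> sides"
  shows "\<exists>a\<in>Z. \<forall>D\<in>E. sub_le Z D \<longrightarrow> a \<in> D"
proof -
  have ZG: "Z \<subseteq> carrier G" using sidesD(1)[OF Z] .
  obtain \<D> where \<D>: "finite \<D>" "\<And>D. D \<in> \<D> \<Longrightarrow> D \<subseteq> carrier G"
    "\<forall>Z\<in>sides. \<forall>D\<in>E. sub_le Z D \<longrightarrow> \<not> Z \<subseteq> D \<longrightarrow> (\<exists>h\<in>H. \<exists>D0\<in>\<D>. D = h <# D0)"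
    using finite_inexact by (elim exE conjE) simp
  have \<D>3: "\<exists>h\<in>H. \<exists>D0\<in>\<D>. D = h <# D0" if "D \<in> E" "sub_le Z D" "\<not> Z \<subseteq> D" for D
    using \<D>(3) Z that by simp
  obtain R where R: "finite R" "R \<subseteq> carrier G" "H \<subseteq> L <#> R" using fin_L_H by (rule fin_overE)
  \<comment> \<open>\<open>finite_inexact\<close> works up to H, but only L is known to preserve Z;
    the representatives R of L in H absorb the difference.\<close>
  define \<D>' where "\<D>' = {D \<in> (\<Union>r\<in>R. (\<lambda>D. r <# D) ` \<D>). fin_over M (Z - D)}"
  have fin: "finite \<D>'" using R(1) \<D>(1) by (simp add: \<D>'_def)
  \<comment> \<open>Saturation by M lets a single point be tested against all L-translates of a
    defect.\<close>
  define U where "U = (\<Union>D\<in>\<D>'. M <#> (Z - D))"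
  have "fin_over M (M <#> P)" if "fin_over M P" for P
  proof -
    obtain F where F: "finite F" "F \<subseteq> carrier G" "P \<subseteq> M <#> F" using \<open>fin_over M P\<close> by (rule fin_overE)
    have "M <#> P \<subseteq> M <#> (M <#> F)" using set_mult_mono[OF order_refl F(3)] .
    also have "\<dots> = M <#> F" using set_mult_assoc[OF MG MG F(2)] subgroup_mult_id[OF subgroup_M] by simp
    finally show ?thesis using F by (intro fin_overI[of F])
  qed
  then have "fin_over M U" unfolding U_def using fin by (intro fin_over_UN) (auto simp: \<D>'_def)
  have "\<not> Z \<subseteq> U" using \<open>fin_over M U\<close> sidesD(4)[OF Z] fin_M_iff fin_over_subset by blast
  then obtain a where a: "a \<in> Z" "a \<notin> U" by blast
  have "a \<in> D" if D: "D \<in> E" "sub_le Z D" for D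
  proof (rule ccontr)
    assume aD: "a \<notin> D"
    then obtain h D0 where hD: "h \<in> H" "D0 \<in> \<D>" "D = h <# D0" using \<D>3[OF D] a(1) by blast
    obtain l r where lr: "l \<in> L" "r \<in> R" "h = l \<otimes> r" using hD(1) R(3) by (auto elim!: set_multE)
    have lM: "l \<in> M" and lG: "l \<in> carrier G" and rG: "r \<in> carrier G" using lr L_sub LG R(2) by auto
    have D0: "D0 \<subseteq> carrier G" using \<D>(2) hD by blast
    define D1 where "D1 = r <# D0"
    have D1: "D1 \<subseteq> carrier G" using rG D0 by (simp add: D1_def lcos_closed)
    have DD1: "D = l <# D1" using hD(3) lr(3) lG rG D0 by (simp add: D1_def lcos_lcos)
    have ilM: "inv l \<in> M" using subgroup_M lM by (simp add: subgroup.m_inv_closed)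
    have "inv l <# (Z - D) = Z - D1"
      using DD1 lG ZG D1 lcos_side_stab[OF Z ilM] by (simp add: lcos_Diff lcos_closed)
    moreover have "fin_over M (Z - D)" using sub_le_imp_aleq[OF D(2)] sidesD(3)[OF Z] by (simp add: aleq_def)
    then have "fin_over (inv l <# M) (inv l <# (Z - D))" using fin_over_lcos_both MG lG by simp
    moreover have "inv l <# M = M" using coset_join3[OF _ subgroup_M ilM] lG by simp
    ultimately have "fin_over M (Z - D1)" by simp
    then have "D1 \<in> \<D>'" using lr(2) hD(2) unfolding \<D>'_def D1_def by blast
    have aG: "a \<in> carrier G" using a ZG by auto
    have "inv l \<otimes> a \<in> Z" using stab_mult[OF ZG, of "inv l" a] sidesD(3)[OF Z] ilM aG a by simp
    moreover have "inv l \<otimes> a \<notin> D1" using aD DD1 lcos_mem[OF lG D1] aG by simp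
    ultimately have "l \<otimes> (inv l \<otimes> a) \<in> M <#> (Z - D1)" using lM by (intro set_multI) auto
    then have "a \<in> U" using \<open>D1 \<in> \<D>'\<close> lG aG by (auto simp: U_def simp flip: m_assoc)
    then show False using a(2) by simp
  qed
  then show ?thesis using a by blast
qed

lemma deep_point_E:
  assumes A: "A \<in> E"
  shows "\<exists>a\<in>A. \<forall>D\<in>E. sub_le A D \<longrightarrow> a \<in> D"
proof -
  obtain g Z where gZ: "g \<in> carrier G" "Z \<in> sides" "A = g <# Z" using A by (auto simp: E_def)
  have ZG: "Z \<subseteq> carrier G" using sidesD(1)[OF gZ(2)] .
  obtain a where a: "a \<in> Z" "\<And>D. D \<in> E \<Longrightarrow> sub_le Z D \<Longrightarrow> a \<in> D" using deep_point[OF gZ(2)] by blast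
  have "g \<otimes> a \<in> D" if D: "D \<in> E" "sub_le A D" for D
  proof -
    have DG: "D \<subseteq> carrier G" using E_D(1)[OF D(1)] .
    have "sub_le Z (inv g <# D)" using D(2) sub_le_lcos[of "inv g" A D] gZ ZG DG by (simp add: lcos_closed)
    then have "a \<in> inv g <# D" using a(2)[of "inv g <# D"] E_D(4)[OF D(1)] gZ by simp
    then show ?thesis using lcos_mem[of "inv g" D a] gZ DG by simp
  qed
  then show ?thesis using lcosI[OF a(1), of g] gZ by blast
qed

text \<open>If gW separates a from b, then \<open>inv g \<otimes> a\<close> lies on a boundary
  covered by HF. So g is \<open>a f^-1 h^-1\<close> with f in F, and the finite H-orbit of Y takes
  care of h.\<close>

lemma finite_separating:
  assumes "a \<in> carrier G" "b \<in> carrier G"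
  shows "finite {D \<in> E. a \<in> D \<and> b \<notin> D}"
proof -
  define v where "v = inv a \<otimes> b"
  have v: "v \<in> carrier G" "a \<otimes> v = b" using assms by (simp_all add: v_def flip: m_assoc)
  obtain F where F: "finite F" "F \<subseteq> carrier G" "bd Y v \<subseteq> H <#> F" using bdY[OF v(1)] by (rule fin_overE)
  define \<W> where "\<W> = (\<lambda>h. h <# Y) ` H \<union> (\<lambda>h. carrier G - (h <# Y)) ` H"
  have "(\<lambda>h. carrier G - (h <# Y)) ` H = (\<lambda>A. carrier G - A) ` (\<lambda>h. h <# Y) ` H" by (simp add: image_image)
  then have finW: "finite \<W>" using finite_orbit by (simp add: \<W>_def)
  have hW: "h <# W \<in> \<W>" if "h \<in> H" "W \<in> sides" for h W
    using that HG Y by (auto simp: \<W>_def sides_def lcos_compl subset_iff)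
  have "{D \<in> E. a \<in> D \<and> b \<notin> D} \<subseteq> (\<Union>f\<in>F. (\<lambda>W. (a \<otimes> inv f) <# W) ` \<W>)"
  proof
    fix D assume D: "D \<in> {D \<in> E. a \<in> D \<and> b \<notin> D}"
    then obtain g W where gW: "g \<in> carrier G" "W \<in> sides" "D = g <# W" by (auto simp: E_def)
    have WG: "W \<subseteq> carrier G" using sidesD(1)[OF gW(2)] .
    have "inv g \<otimes> a \<in> W" "inv g \<otimes> b \<notin> W" using D gW lcos_mem[OF gW(1) WG] assms by auto
    moreover have "inv g \<otimes> a \<otimes> v = inv g \<otimes> b" using gW assms v by (simp add: m_assoc)
    moreover have "inv g \<otimes> a \<in> carrier G" using gW assms by simp
    ultimately have "inv g \<otimes> a \<in> bd W v" unfolding bd_def by simp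
    then have "inv g \<otimes> a \<in> bd Y v" using sidesD(2)[OF gW(2) v(1)] by simp
    then obtain h f where hf: "h \<in> H" "f \<in> F" "inv g \<otimes> a = h \<otimes> f" using F(3) by (auto elim!: set_multE)
    have c: "h \<in> carrier G" "f \<in> carrier G" using hf HG F by auto
    have "inv (inv g \<otimes> a) = inv (h \<otimes> f)" using hf(3) by simp
    then have "inv a \<otimes> g = inv f \<otimes> inv h" using gW(1) assms c by (simp add: inv_mult_group)
    then have "a \<otimes> (inv a \<otimes> g) = a \<otimes> (inv f \<otimes> inv h)" by simp
    then have "g = (a \<otimes> inv f) \<otimes> inv h" using gW(1) assms c by (simp add: m_assoc flip: m_assoc[of a "inv a" g])
    then have "D = (a \<otimes> inv f) <# (inv h <# W)" using gW(3) WG assms c by (simp add: lcos_lcos)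
    moreover have "inv h <# W \<in> \<W>" using hW[of "inv h" W] hf H gW by (simp add: subgroup.m_inv_closed)
    ultimately show "D \<in> (\<Union>f\<in>F. (\<lambda>W. (a \<otimes> inv f) <# W) ` \<W>)" using hf(2) by blast
  qed
  then show ?thesis using F(1) finW by (meson finite_UN_I finite_imageI finite_subset)
qed

text \<open>All members of the interval contain a deep point of A and miss a deep point of the
  complement of B.\<close>

lemma finite_sub_le_interval:
  assumes A: "A \<in> E" and B: "B \<in> E"
  shows "finite {D \<in> E. sub_le A D \<and> sub_le D B}"
proof -
  obtain a where a: "a \<in> A" "\<And>D. D \<in> E \<Longrightarrow> sub_le A D \<Longrightarrow> a \<in> D" using deep_point_E[OF A] by blast
  obtain b where b: "b \<in> carrier G - B" "\<And>D. D \<in> E \<Longrightarrow> sub_le (carrier G - B) D \<Longrightarrow> b \<in> D"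
    using deep_point_E[OF E_D(3)[OF B]] by blast
  have "{D \<in> E. sub_le A D \<and> sub_le D B} \<subseteq> {D \<in> E. a \<in> D \<and> b \<notin> D}"
  proof
    fix D assume D: "D \<in> {D \<in> E. sub_le A D \<and> sub_le D B}"
    then have "sub_le (carrier G - B) (carrier G - D)" using sub_le_compl[of D B] E_D(2) B by simp
    then have "b \<in> carrier G - D" using b(2)[of "carrier G - D"] E_D(3)[of D] D by blast
    then show "D \<in> {D \<in> E. a \<in> D \<and> b \<notin> D}" using a(2) D by simp
  qed
  moreover have "a \<in> carrier G" "b \<in> carrier G" using a b E_D(1)[OF A] by auto
  ultimately show ?thesis using finite_separating finite_subset by blast
qed

text \<open>A boundary point x of Y is moved by k to a point g deep inside Z, so that kZ has a
  boundary edge with both ends in Z. For k in the commensurator exact nestedness then puts kZ or its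
  complement properly inside Z. Otherwise k itself lies in Z, as g avoids
  \<open>bd Z (inv x)\<close>, so all of kH does and a small corner puts kW strictly below
  Z.\<close>

lemma ex_below:
  assumes Z: "Z \<in> sides"
  shows "\<exists>D\<in>E. sub_le D Z \<and> D \<noteq> Z"
proof -
  have ZG: "Z \<subseteq> carrier G" using sidesD(1)[OF Z] .
  obtain u x where ux: "u \<in> carrier G" "x \<in> carrier G" "x \<in> bd Y u" using ex_bd by blast
  have "fin_over H (bd Z u \<union> bd Z (inv x))" using bdY ux sidesD(2)[OF Z] by (simp add: fin_over_Un)
  then have "\<not> Z \<subseteq> bd Z u \<union> bd Z (inv x)" using sidesD(4)[OF Z] fin_over_subset by blast
  then obtain g where g: "g \<in> Z" "g \<notin> bd Z u" "g \<notin> bd Z (inv x)" by blast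
  then have gG: "g \<in> carrier G" using ZG by auto
  define k where "k = g \<otimes> inv x"
  have k: "k \<in> carrier G" "k \<otimes> x = g" using gG ux by (simp_all add: k_def m_assoc)
  have gu: "g \<otimes> u \<in> Z" "k \<in> Z" using g gG by (auto simp: bd_def k_def)
  have "g \<in> bd (k <# Z) u"
    using bd_lcos[OF k(1) ZG ux(1)] sidesD(2)[OF Z ux(1)] lcosI[OF ux(3), of k] k(2) by simp
  then have gb: "(g \<in> k <# Z) \<noteq> (g \<otimes> u \<in> k <# Z)" by (simp add: bd_def)
  have guG: "g \<otimes> u \<in> carrier G" using gG ux by simp
  show ?thesis
  proof (cases "k \<in> commensurator H")
    case True
    have "nested_in (carrier G) Z (k <# Z)"
    proof (cases "Z = Y")
      case False
      have kY: "k <# Y \<subseteq> carrier G" using k Y by (simp add: lcos_closed)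
      have "Z = carrier G - Y" using Z False by (simp add: sides_def)
      then show ?thesis using comm_nested[OF True] Y kY k unfolding nested_in_def by (auto simp: lcos_compl)
    qed (use comm_nested[OF True] in simp)
    then consider "Z \<subseteq> k <# Z" | "k <# Z \<subseteq> Z" | "Z \<inter> (k <# Z) = {}" | "Z \<union> (k <# Z) = carrier G"
      by (auto simp: nested_in_def)
    then show ?thesis
    proof cases
      case 1
      then show ?thesis using gb g(1) gu by blast
    next
      case 2
      moreover have "k <# Z \<noteq> Z" using gb g(1) gu by blast
      moreover have "k <# Z \<in> E" using k Z by (auto simp: E_def)
      ultimately show ?thesis by (auto simp: sub_le_def)
    next
      case 3
      then show ?thesis using gb g(1) gu by blast
    next
      case 4
      then have "carrier G - (k <# Z) \<subseteq> Z" by blast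
      moreover have "carrier G - (k <# Z) \<noteq> Z" using gb g(1) gu gG guG by blast
      moreover have "carrier G - (k <# Z) \<in> E" using E_D(3)[of "k <# Z"] k Z by (auto simp: E_def)
      ultimately show ?thesis by (auto simp: sub_le_def)
    qed
  next
    case False
    have "\<one> \<in> H" using H by (rule subgroup.one_closed)
    then have "k \<in> k <# H" using k lcosI[of \<one> H k] by simp
    then have "k <# H \<subseteq> Z" using side_cases[OF Z not_comm[of k]] k False gu by blast
    then have kH: "k <# H \<subseteq> carrier G - (carrier G - Z)" using ZG by (simp add: double_diff)
    obtain W where W: "W \<in> sides" "inv k <# H \<subseteq> carrier G - W"
      using not_comm_side[of "inv k"] not_comm_inv[OF k(1) False] k by auto
    have WG: "W \<subseteq> carrier G" using sidesD(1)[OF W(1)] .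
    have kW: "k <# W \<in> E" "k <# W \<subseteq> carrier G" using k W WG by (auto simp: E_def lcos_closed)
    have le: "sub_le (carrier G - Z) (k <# (carrier G - W))"
      by (rule small_corner_sub_le[OF sidesD(6)[OF Z] W(1) k(1) False kH W(2)])
    have e: "k <# (carrier G - W) = carrier G - (k <# W)" using k WG by (simp add: lcos_compl)
    have "sub_le (k <# W) Z"
      using sub_le_compl[OF _ _ le] ai_side[OF sidesD(6)[OF Z]] ai_compl[OF E_D(2)[OF kW(1)]] e kW ZG
      by (simp add: double_diff)
    moreover have "k <# W \<noteq> Z"
      using comm_of_almost_equal[OF Z W(1) k(1)] subset_aleq[of Z "k <# W"] subset_aleq[of "k <# W" Z] False by auto
    ultimately show ?thesis using kW by blast
  qed
qed

sublocale pocset_action E sub_le "\<lambda>A. carrier G - A" G "\<lambda>g A. g <# A" Y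
proof
  show "sub_le A A" for A by (simp add: sub_le_def)
  show "A = B" if "sub_le A B" "sub_le B A" for A B using that by (rule sub_le_antisym)
  show "sub_le A D" if "A \<in> E" "B \<in> E" "D \<in> E" "sub_le A B" "sub_le B D" for A B D
    using that sub_le_trans E_D(2) by blast
  show "carrier G - A \<in> E" if "A \<in> E" for A using that by (rule E_D)
  show "carrier G - (carrier G - A) = A" if "A \<in> E" for A using E_D(1)[OF that] by (simp add: double_diff)
  show "sub_le (carrier G - B) (carrier G - A)" if "A \<in> E" "B \<in> E" "sub_le A B" for A B
    using that sub_le_compl E_D(2) by blast
  show "sub_le A B \<or> sub_le A (carrier G - B) \<or> sub_le (carrier G - A) B \<or> sub_le (carrier G - A) (carrier G - B)"
    if "A \<in> E" "B \<in> E" for A B using nested4_E[OF that] by (simp add: nested4_def)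
  show False if "A \<in> E" "B \<in> E" "sub_le A B" "sub_le A (carrier G - B)" for A B
    using that aleq_proper sub_le_imp_aleq E_D(2) by blast
  show "finite {D \<in> E. sub_le A D \<and> sub_le D B}" if "A \<in> E" "B \<in> E" for A B
    using that by (rule finite_sub_le_interval)
  show "g <# A \<in> E" if "g \<in> carrier G" "A \<in> E" for g A using that E_D(4) by blast
  show "\<one> <# A = A" if "A \<in> E" for A using E_D(1)[OF that] by (rule lcos_mult_one)
  show "(g \<otimes> h) <# A = g <# (h <# A)" if "g \<in> carrier G" "h \<in> carrier G" "A \<in> E" for g h A
    using that E_D(1) by (simp add: lcos_lcos)
  show "sub_le (g <# A) (g <# B)" if "g \<in> carrier G" "A \<in> E" "B \<in> E" "sub_le A B" for g A B
    using that E_D(1) by (simp add: sub_le_lcos)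
  show "g <# (carrier G - A) = carrier G - (g <# A)" if "g \<in> carrier G" "A \<in> E" for g A
    using that E_D(1) by (simp add: lcos_compl)
  show "Y \<in> E" using Y_sides by (simp add: E_side)
  show "\<exists>g\<in>carrier G. A = g <# Y \<or> A = g <# (carrier G - Y)" if "A \<in> E" for A
    using that by (auto simp: E_def sides_def)
  show "\<exists>D\<in>E. sub_le D Y \<and> D \<noteq> Y" "\<exists>D\<in>E. sub_le D (carrier G - Y) \<and> D \<noteq> carrier G - Y"
    using ex_below Y_sides by auto
qed

theorem splits_over_stab: "splits_over G M \<and> commensurable G M H"
proof
  have "edge_stab = M" by (auto simp: edge_stab_def stab_def)
  then show "splits_over G M" using splits_over_edge_stab by simp
  have "fin_over L M" using fin_over_trans[OF fin_L_H fin_H_M LG] .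
  then show "commensurable G M H"
    using finite_index_iff[OF subgroup_L] fin_L_H MG HG
    by (simp add: commensurable_def L_def Int_commute)
qed

end

section \<open>Adjusting X to the cosets outside the commensurator\<close>

section \<open>Good position with respect to the commensurator\<close>

context group
begin

lemma fin_over_saturate:
  assumes H: "subgroup H G" and P: "fin_over H P"
  shows "fin_over H (H <#> P)"
proof -
  have HG: "H \<subseteq> carrier G" using H by (rule subgroup.subset)
  obtain F where F: "finite F" "F \<subseteq> carrier G" "P \<subseteq> H <#> F" using P by (rule fin_overE)
  have "H <#> P \<subseteq> H <#> (H <#> F)" using set_mult_mono[OF order_refl F(3)] .
  also have "\<dots> = H <#> F" using set_mult_assoc[OF HG HG F(2)] subgroup_mult_id[OF H] by simp
  finally show ?thesis using F by (intro fin_overI[of F])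
qed

lemma commensurator_closed: "commensurator H \<subseteq> carrier G" by (auto simp: commensurator_def)

lemma commensurator_mult:
  assumes "H \<subseteq> carrier G" "g \<in> commensurator H" "h \<in> commensurator H"
  shows "g \<otimes> h \<in> commensurator H"
proof -
  have "g \<in> carrier G" "h \<in> carrier G" using assms commensurator_closed by auto
  moreover from this have "(g \<otimes> h) <# H = g <# (h <# H)" using assms(1) by (simp add: lcos_lcos)
  ultimately show ?thesis
    using fin_over_commensurator[OF assms(1,2), of "h <# H"] assms(3) by (simp add: commensurator_def)
qed

lemma subgroup_lcos_self: "subgroup H G \<Longrightarrow> h \<in> H \<Longrightarrow> h <# H = H"
  using coset_join3 subgroup.mem_carrier by metis

lemma subgroup_commensurator: "subgroup H G \<Longrightarrow> H \<subseteq> commensurator H"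
  using fin_over_refl subgroup.subset[of H G] by (auto simp: commensurator_def subgroup_lcos_self)

end

text \<open>Common setting of the next two constructions; the vanishing number itself enters through
  \<open>dich\<close> in \<open>good_position\<close>.\<close>

locale si_zero = group G for G :: "('a, 'm) monoid_scheme" (structure) +
  fixes S H T :: "'a set"
  assumes S: "finite S" "S \<subseteq> carrier G" "generate G S = carrier G"
    and H: "subgroup H G" and T: "finite T" "T \<subseteq> carrier G" "H = generate G T"
    and comm_inv: "g \<in> commensurator H \<Longrightarrow> inv g \<in> commensurator H"
    and ends: "subgroup K G \<Longrightarrow> K \<subseteq> H \<Longrightarrow> \<not> fin_over K H \<Longrightarrow> ends_of_pair G S K = 1"
begin

abbreviation C where "C \<equiv> commensurator H"

lemma HG: "H \<subseteq> carrier G" using H by (rule subgroup.subset)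

lemma CG: "C \<subseteq> carrier G" by (rule commensurator_closed)

lemma HC: "H \<subseteq> C" using H by (rule subgroup_commensurator)

lemma C_mult: "c \<in> C \<Longrightarrow> d \<in> C \<Longrightarrow> c \<otimes> d \<in> C" using HG by (rule commensurator_mult)

lemma C_mult_iff:
  assumes "c \<in> C" "g \<in> carrier G"
  shows "c \<otimes> g \<in> C \<longleftrightarrow> g \<in> C" "g \<otimes> c \<in> C \<longleftrightarrow> g \<in> C"
proof -
  have c: "c \<in> carrier G" and ic: "inv c \<in> C" using assms CG comm_inv by auto
  have e: "inv c \<otimes> (c \<otimes> g) = g" using c assms(2) by (simp flip: m_assoc)
  have f: "g \<otimes> c \<otimes> inv c = g" using c assms(2) by (simp add: m_assoc)
  show "c \<otimes> g \<in> C \<longleftrightarrow> g \<in> C"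
    using C_mult[OF ic, of "c \<otimes> g"] C_mult[OF assms(1), of g] unfolding e by blast
  show "g \<otimes> c \<in> C \<longleftrightarrow> g \<in> C"
    using C_mult[OF _ ic, of "g \<otimes> c"] C_mult[OF _ assms(1), of g] unfolding f by blast
qed

text \<open>Outside C membership in X' is decided by the whole coset gH, according to the side that
  almost contains it. If g changes status, gH meets X and its complement, for gH is not H-finite; by
  finite generation some gh lies on the boundary of X across a generator. So gH is kfH with k in H
  and f from a finite set, and the changed points lie in the small parts of such cosets.\<close>

lemma good_position:
  assumes X: "X \<subseteq> carrier G" and HX: "\<And>h. h \<in> H \<Longrightarrow> h <# X = X"
    and bdX: "\<And>u. u \<in> carrier G \<Longrightarrow> fin_over H (bd X u)"
    and niX: "\<not> fin_over H X" "\<not> fin_over H (carrier G - X)"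
    and dich: "\<And>g. g \<in> carrier G - C \<Longrightarrow> fin_over H ((g <# H) \<inter> X) \<or> fin_over H ((g <# H) - X)"
  shows "\<exists>X'. X' \<subseteq> carrier G \<and> (\<forall>h\<in>H. h <# X' = X') \<and> (\<forall>u\<in>carrier G. fin_over H (bd X' u)) \<and>
    \<not> fin_over H X' \<and> \<not> fin_over H (carrier G - X') \<and>
    (\<forall>g\<in>carrier G - C. g <# H \<subseteq> X' \<or> g <# H \<subseteq> carrier G - X')"
proof -
  define X' where "X' = (X \<inter> C) \<union> {g \<in> carrier G - C. fin_over H ((g <# H) - X)}"
  define \<Delta> where "\<Delta> = (X - X') \<union> (X' - X)"
  have X'G: "X' \<subseteq> carrier G" using X by (auto simp: X'_def)
  have "fin_over H (\<Union>t\<in>T. bd X t)" using T bdX by (intro fin_over_UN) auto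
  then obtain F where F: "finite F" "F \<subseteq> carrier G" "(\<Union>t\<in>T. bd X t) \<subseteq> H <#> F" by (rule fin_overE)
  define U where "U = (\<Union>f\<in>{f\<in>F. fin_over H ((f <# H) \<inter> X)}. H <#> ((f <# H) \<inter> X)) \<union>
     (\<Union>f\<in>{f\<in>F. fin_over H ((f <# H) - X)}. H <#> ((f <# H) - X))"
  have finU: "fin_over H U" unfolding U_def
    using F(1) by (intro fin_over_Un fin_over_UN fin_over_saturate H) auto
  have HX_mem: "h \<otimes> x \<in> X \<longleftrightarrow> x \<in> X" if "h \<in> H" "x \<in> carrier G" for h x
    using stab_mult[OF X, of h x] HX[OF that(1)] that HG by (auto simp: stab_def)
  have "\<Delta> \<subseteq> U"
  proof
    fix g assume g: "g \<in> \<Delta>"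
    then have gG: "g \<in> carrier G" using X X'G by (auto simp: \<Delta>_def)
    have gC: "g \<notin> C" using g by (auto simp: \<Delta>_def X'_def)
    then have ni: "\<not> fin_over H (g <# H)" using gG by (simp add: commensurator_def)
    have g_cases: "(g \<in> X \<and> fin_over H ((g <# H) \<inter> X)) \<or> (g \<notin> X \<and> fin_over H ((g <# H) - X))"
      using g gC gG dich[of g] by (auto simp: \<Delta>_def X'_def)
    have "\<exists>h\<in>H. \<exists>t\<in>T. g \<otimes> h \<in> bd X t"
    proof (rule ccontr)
      assume no: "\<not> ?thesis"
      have "g \<otimes> h \<in> X \<longleftrightarrow> g \<otimes> \<one> \<in> X" if "h \<in> H" for h
      proof (rule const_on_subgroup[OF T(2,3) _ that])
        fix h t assume ht: "h \<in> H" "t \<in> T"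
        then have "h \<in> carrier G" "t \<in> carrier G" using HG T(2) by auto
        then show "g \<otimes> h \<in> X \<longleftrightarrow> g \<otimes> (h \<otimes> t) \<in> X" using no ht gG by (auto simp: bd_def m_assoc)
      qed
      then have "\<forall>x\<in>g <# H. x \<in> X \<longleftrightarrow> g \<in> X" using gG by (auto simp: l_coset_def)
      then have "(g <# H) \<inter> X = (if g \<in> X then g <# H else {})" "(g <# H) - X = (if g \<in> X then {} else g <# H)" by auto
      then show False using g_cases ni by (auto split: if_splits)
    qed
    then obtain h where h: "h \<in> H" "g \<otimes> h \<in> H <#> F" using F(3) by blast
    then obtain k f where kf: "k \<in> H" "f \<in> F" "g \<otimes> h = k \<otimes> f" by (auto elim!: set_multE)
    have c: "h \<in> carrier G" "k \<in> carrier G" "f \<in> carrier G" using h kf HG F by auto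
    have ik: "inv k \<in> H" "inv h \<in> H" using H kf h by (auto simp: subgroup.m_inv_closed)
    have "g = k \<otimes> (f \<otimes> inv h)"
    proof -
      have "g = g \<otimes> h \<otimes> inv h" using gG c by (simp add: m_assoc)
      then show ?thesis using kf(3) c by (simp add: m_assoc)
    qed
    then have e: "inv k \<otimes> g = f \<otimes> inv h" using c by (simp flip: m_assoc)
    \<comment> \<open>As X is H-invariant, translation by \<open>inv k\<close> carries the
      exceptional part of gH to that of fH.\<close>
    have "f <# H = inv k <# (g <# H)"
    proof -
      have "inv k <# (g <# H) = (f \<otimes> inv h) <# H" using e c gG HG by (simp add: lcos_lcos)
      also have "\<dots> = f <# (inv h <# H)" using c HG by (simp add: lcos_lcos)
      finally show ?thesis using subgroup_lcos_self[OF H ik(2)] by simp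
    qed
    moreover have "inv k <# X = X" using HX ik by simp
    moreover have gHG: "g <# H \<subseteq> carrier G" using gG HG by (simp add: lcos_closed)
    ultimately have D: "(f <# H) - X = inv k <# ((g <# H) - X)" using lcos_Diff[of "inv k" "g <# H" X] c X by simp
    have "(f <# H) \<inter> X = (f <# H) - (carrier G - X)" "(g <# H) \<inter> X = (g <# H) - (carrier G - X)"
      using X gHG \<open>f <# H = _\<close> lcos_closed[of f H] c HG by auto
    then have I: "(f <# H) \<inter> X = inv k <# ((g <# H) \<inter> X)"
      using lcos_Diff[of "inv k" "g <# H" "carrier G - X"] c X gHG \<open>f <# H = _\<close> \<open>inv k <# X = X\<close> by (simp add: lcos_compl)
    have fin: "fin_over H (inv k <# P)" if "fin_over H P" for P
      using fin_over_commensurator[OF HG _ that] ik HC by auto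
    have "inv k \<otimes> g \<in> f <# H" using e ik(2) lcosI by simp
    moreover have "inv k \<otimes> g \<in> X \<longleftrightarrow> g \<in> X" using HX_mem ik gG by simp
    moreover have "k \<otimes> (inv k \<otimes> g) = g" using c gG by (simp flip: m_assoc)
    ultimately have "(g \<in> X \<longrightarrow> g \<in> H <#> ((f <# H) \<inter> X)) \<and> (g \<notin> X \<longrightarrow> g \<in> H <#> ((f <# H) - X))"
      using set_multI[OF kf(1), of "inv k \<otimes> g"] by auto
    moreover have "(g \<in> X \<longrightarrow> fin_over H ((f <# H) \<inter> X)) \<and> (g \<notin> X \<longrightarrow> fin_over H ((f <# H) - X))"
      using g_cases fin unfolding D I by blast
    ultimately show "g \<in> U" using kf(2) unfolding U_def by blast
  qed
  then have fin\<Delta>: "fin_over H \<Delta>" using finU fin_over_subset by blast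
  have HX'1: "h \<otimes> g \<in> X'" if h: "h \<in> H" and g: "g \<in> X'" for h g
  proof -
    have c: "h \<in> carrier G" "g \<in> carrier G" "h \<in> C" using h g HG X'G HC by auto
    show ?thesis
    proof (cases "g \<in> C")
      case True
      then have "g \<in> X" using g by (auto simp: X'_def)
      then show ?thesis using True HX_mem[OF h c(2)] C_mult_iff(1)[OF c(3,2)] by (simp add: X'_def)
    next
      case False
      then have "fin_over H (h <# ((g <# H) - X))"
        using g fin_over_commensurator[OF HG c(3)] by (auto simp: X'_def)
      moreover have "h <# ((g <# H) - X) = ((h \<otimes> g) <# H) - X"
        using HX[OF h] c HG X by (simp add: lcos_Diff lcos_closed lcos_lcos)
      ultimately show ?thesis using False c C_mult_iff(1)[OF c(3,2)] by (simp add: X'_def)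
    qed
  qed
  have HX': "h <# X' = X'" if h: "h \<in> H" for h
  proof
    have hG: "h \<in> carrier G" and ih: "inv h \<in> H" using h HG H by (auto simp: subgroup.m_inv_closed)
    show "h <# X' \<subseteq> X'" using HX'1[OF h] by (auto simp: l_coset_def)
    show "X' \<subseteq> h <# X'"
    proof
      fix x assume "x \<in> X'"
      then show "x \<in> h <# X'" using HX'1[OF ih] lcos_mem[OF hG X'G] X'G by auto
    qed
  qed
  have bdX': "fin_over H (bd X' u)" if u: "u \<in> carrier G" for u
  proof -
    have "bd X' u \<subseteq> (\<Delta> \<union> bd X u) \<union> {x \<in> carrier G. x \<otimes> u \<in> \<Delta>}" by (auto simp: bd_def \<Delta>_def)
    moreover have "fin_over H ((\<Delta> \<union> bd X u) \<union> {x \<in> carrier G. x \<otimes> u \<in> \<Delta>})"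
      using fin\<Delta> bdX[OF u] fin_over_rmult[OF fin\<Delta> HG u] by (intro fin_over_Un)
    ultimately show ?thesis using fin_over_subset by blast
  qed
  have ni1: "\<not> fin_over H X'"
  proof
    assume "fin_over H X'"
    then have "fin_over H (X' \<union> \<Delta>)" using fin\<Delta> by (rule fin_over_Un)
    moreover have "X \<subseteq> X' \<union> \<Delta>" by (auto simp: \<Delta>_def)
    ultimately show False using niX(1) fin_over_subset by blast
  qed
  have ni2: "\<not> fin_over H (carrier G - X')"
  proof
    assume "fin_over H (carrier G - X')"
    then have "fin_over H ((carrier G - X') \<union> \<Delta>)" using fin\<Delta> by (rule fin_over_Un)
    moreover have "carrier G - X \<subseteq> (carrier G - X') \<union> \<Delta>" by (auto simp: \<Delta>_def)
    ultimately show False using niX(2) fin_over_subset by blast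
  qed
  have "g <# H \<subseteq> X' \<or> g <# H \<subseteq> carrier G - X'" if g: "g \<in> carrier G - C" for g
  proof -
    have "g \<otimes> h \<in> X' \<longleftrightarrow> fin_over H ((g <# H) - X)" if h: "h \<in> H" for h
    proof -
      have hG: "h \<in> carrier G" "h \<in> C" using h HG HC by auto
      have "(g \<otimes> h) <# H = g <# (h <# H)" using g hG HG by (simp add: lcos_lcos)
      then have "(g \<otimes> h) <# H = g <# H" using subgroup_lcos_self[OF H h] by simp
      then show ?thesis using g hG C_mult_iff(2)[OF hG(2), of g] by (auto simp: X'_def)
    qed
    then have "\<forall>x\<in>g <# H. x \<in> X' \<longleftrightarrow> fin_over H ((g <# H) - X)" by (auto simp: l_coset_def)
    moreover have "g <# H \<subseteq> carrier G" using g HG by (simp add: lcos_closed)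
    ultimately show ?thesis by blast
  qed
  then show ?thesis using X'G HX' bdX' ni1 ni2 by (intro exI[of _ X']) simp
qed

end

section \<open>The dual graph and the lifting of its cuts\<close>

section \<open>The graph dual to the translates under the commensurator\<close>

locale good_set = si_zero +
  fixes X :: "'a set"
  assumes X: "X \<subseteq> carrier G" and HX: "h \<in> H \<Longrightarrow> h <# X = X"
    and bdX: "u \<in> carrier G \<Longrightarrow> fin_over H (bd X u)"
    and niX: "\<not> fin_over H X" "\<not> fin_over H (carrier G - X)"
    and sep: "g \<in> carrier G - C \<Longrightarrow> g <# H \<subseteq> X \<or> g <# H \<subseteq> carrier G - X"
begin

definition \<A> where "\<A> = (\<lambda>c. c <# X) ` C"

text \<open>Encoding a class by the translates that contain it lets C act on classes by translating
  their members, which is \<open>\<phi>\<close>.\<close>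

definition \<pi> where "\<pi> x = {A \<in> \<A>. x \<in> A}"

definition V where "V = \<pi> ` carrier G"

definition S' where "S' = S \<union> (\<lambda>s. inv s) ` S"

definition E where "E = {(\<pi> x, \<pi> (x \<otimes> s)) |x s. x \<in> carrier G \<and> s \<in> S'}"

text \<open>Smallness is measured in the group, on the union of fibres. A single vertex may fail to
  be negligible, as its fibre can contain a coset gH with g outside C.\<close>

definition I where "I U \<longleftrightarrow> fin_over H {x \<in> carrier G. \<pi> x \<in> U}"

definition \<phi> where "\<phi> c p = (\<lambda>A. c <# A) ` p" for c and p :: "'a set set"

lemma S'G: "s \<in> S' \<Longrightarrow> s \<in> carrier G" using S(2) by (auto simp: S'_def)

lemma S'_inv: "s \<in> S' \<Longrightarrow> inv s \<in> S'" using S(2) by (auto simp: S'_def)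

lemma finite_S': "finite S'" using S(1) by (simp add: S'_def)

lemma \<A>G: "A \<in> \<A> \<Longrightarrow> A \<subseteq> carrier G" using lcos_closed[OF subsetD[OF CG] X] unfolding \<A>_def by blast

lemma X_\<A>: "X \<in> \<A>"
proof -
  have "\<one> \<in> C" using HC subgroup.one_closed[OF H] by auto
  then show ?thesis using lcos_mult_one[OF X] by (force simp: \<A>_def)
qed

lemma \<A>_lcos:
  assumes "c \<in> C" "A \<in> \<A>"
  shows "c <# A \<in> \<A>"
proof -
  obtain d where d: "d \<in> C" "A = d <# X" using assms by (auto simp: \<A>_def)
  then have "c <# A = (c \<otimes> d) <# X" using assms CG X by (simp add: lcos_lcos subset_iff)
  then show ?thesis using C_mult[OF assms(1) d(1)] by (auto simp: \<A>_def)
qed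

lemma bd_\<A>:
  assumes "A \<in> \<A>" "u \<in> carrier G"
  shows "fin_over H (bd A u)"
proof -
  obtain c where c: "c \<in> C" "A = c <# X" using assms by (auto simp: \<A>_def)
  then have "bd A u = c <# bd X u" using bd_lcos[of c X u] CG X assms by auto
  then show ?thesis using fin_over_commensurator[OF HG c(1) bdX[OF assms(2)]] by simp
qed

text \<open>As \<open>inv c\<close> is in C, \<open>inv c <# H\<close> is covered by finitely many
  cosets Hf, and H-invariance of X leaves only the values \<open>inv f <# X\<close> for hcX.\<close>

lemma finite_H_orbit:
  assumes "A \<in> \<A>"
  shows "finite ((\<lambda>h. h <# A) ` H)"
proof -
  obtain c where c: "c \<in> C" "A = c <# X" using assms by (auto simp: \<A>_def)
  have cG: "c \<in> carrier G" using c CG by auto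
  have "inv c \<in> C" using comm_inv c by simp
  then have "fin_over H (inv c <# H)" by (simp add: commensurator_def)
  then obtain F where F: "finite F" "F \<subseteq> carrier G" "inv c <# H \<subseteq> H <#> F" by (rule fin_overE)
  have "(\<lambda>h. h <# A) ` H \<subseteq> (\<lambda>f. inv f <# X) ` F"
  proof
    fix B assume "B \<in> (\<lambda>h. h <# A) ` H"
    then obtain h where h: "h \<in> H" "B = h <# A" by blast
    have ih: "inv h \<in> H" "h \<in> carrier G" using H h HG by (auto simp: subgroup.m_inv_closed)
    have "inv c \<otimes> inv h \<in> H <#> F" using F(3) lcosI[OF ih(1)] by blast
    then obtain k f where kf: "k \<in> H" "f \<in> F" "inv c \<otimes> inv h = k \<otimes> f" by (auto elim!: set_multE)
    have kG: "k \<in> carrier G" "f \<in> carrier G" "inv k \<in> H" using kf HG F H by (auto simp: subgroup.m_inv_closed)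
    have "h \<otimes> c = inv (inv c \<otimes> inv h)" using cG ih by (simp add: inv_mult_group)
    then have "h \<otimes> c = inv f \<otimes> inv k" using kf(3) kG by (simp add: inv_mult_group)
    moreover have "B = (h \<otimes> c) <# X" using h c cG ih X by (simp add: lcos_lcos)
    moreover have "(inv f \<otimes> inv k) <# X = inv f <# (inv k <# X)" using kG X by (simp add: lcos_lcos)
    ultimately have "B = inv f <# X" using HX[OF kG(3)] by simp
    then show "B \<in> (\<lambda>f. inv f <# X) ` F" using kf(2) by blast
  qed
  then show ?thesis using F(1) finite_surj by blast
qed

text \<open>By H-invariance of X the set cX depends only on cH, and a boundary point at x forces cH
  to be \<open>x f^-1 H\<close> with f from a finite set.\<close>

lemma finite_separators:
  assumes x: "x \<in> carrier G" and u: "u \<in> carrier G"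
  shows "finite {A \<in> \<A>. x \<in> bd A u}"
proof -
  obtain F where F: "finite F" "F \<subseteq> carrier G" "bd X u \<subseteq> H <#> F" using bdX[OF u] by (rule fin_overE)
  have "{A \<in> \<A>. x \<in> bd A u} \<subseteq> (\<lambda>f. (x \<otimes> inv f) <# X) ` F"
  proof
    fix A assume "A \<in> {A \<in> \<A>. x \<in> bd A u}"
    then obtain c where c: "c \<in> C" "A = c <# X" "x \<in> bd A u" by (auto simp: \<A>_def)
    have cG: "c \<in> carrier G" using c CG by auto
    have "inv c \<otimes> x \<in> bd X u" using bd_lcos[OF cG X u] c lcos_mem[OF cG bd_subset] by auto
    then obtain h f where hf: "h \<in> H" "f \<in> F" "inv c \<otimes> x = h \<otimes> f" using F(3) by (auto elim!: set_multE)
    have hG: "h \<in> carrier G" "f \<in> carrier G" "inv h \<in> H" using hf HG F H by (auto simp: subgroup.m_inv_closed)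
    have "inv x \<otimes> c = inv (inv c \<otimes> x)" using cG x by (simp add: inv_mult_group)
    then have "inv x \<otimes> c = inv f \<otimes> inv h" using hf(3) hG by (simp add: inv_mult_group)
    then have "x \<otimes> (inv x \<otimes> c) = x \<otimes> (inv f \<otimes> inv h)" by simp
    then have "c = (x \<otimes> inv f) \<otimes> inv h" using cG x hG by (simp add: m_assoc flip: m_assoc[of x "inv x" c])
    then have "A = (x \<otimes> inv f) <# (inv h <# X)" using c(2) x hG X by (simp add: lcos_lcos)
    then have "A = (x \<otimes> inv f) <# X" using HX[OF hG(3)] by simp
    then show "A \<in> (\<lambda>f. (x \<otimes> inv f) <# X) ` F" using hf(2) by blast
  qed
  then show ?thesis using F(1) finite_surj by blast
qed

text \<open>Here the finite generation of \<open>H\<close> enters: the translates separating two points of \<open>Hx\<close>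
  are those separating \<open>hx\<close> from \<open>htx\<close> for some generator \<open>t\<close>, hence finite in number.\<close>

lemma finite_orbit_image:
  assumes x: "x \<in> carrier G"
  shows "finite (\<pi> ` (\<lambda>h. h \<otimes> x) ` H)"
proof -
  define \<S> where "\<S> = (\<Union>t\<in>T. {A \<in> \<A>. x \<in> bd A (inv x \<otimes> (t \<otimes> x))})"
  define \<F> where "\<F> = (\<Union>A\<in>\<S>. (\<lambda>h. h <# A) ` H)"
  have "finite \<S>" unfolding \<S>_def using T x by (intro finite_UN_I finite_separators) auto
  moreover have "\<S> \<subseteq> \<A>" by (auto simp: \<S>_def)
  ultimately have finF: "finite \<F>" unfolding \<F>_def using finite_H_orbit by blast
  have const: "h \<otimes> x \<in> A \<longleftrightarrow> \<one> \<otimes> x \<in> A" if A: "A \<in> \<A>" "A \<notin> \<F>" and h: "h \<in> H" for A h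
  proof (rule const_on_subgroup[OF T(2,3) _ h])
    fix h t assume ht: "h \<in> H" "t \<in> T"
    have c: "h \<in> carrier G" "t \<in> carrier G" "inv h \<in> H" using ht HG T H by (auto simp: subgroup.m_inv_closed)
    have AG: "A \<subseteq> carrier G" using \<A>G A by simp
    have iA: "inv h <# A \<in> \<A>" using \<A>_lcos[OF _ A(1)] c HC by blast
    have e: "x \<otimes> (inv x \<otimes> (t \<otimes> x)) = t \<otimes> x" using x c by (simp flip: m_assoc)
    show "h \<otimes> x \<in> A \<longleftrightarrow> h \<otimes> t \<otimes> x \<in> A"
    proof (rule ccontr)
      assume "(h \<otimes> x \<in> A) \<noteq> (h \<otimes> t \<otimes> x \<in> A)"
      then have "(x \<in> inv h <# A) \<noteq> (t \<otimes> x \<in> inv h <# A)"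
        using lcos_mem[of "inv h" A] c x AG by (simp add: m_assoc)
      then have "x \<in> bd (inv h <# A) (inv x \<otimes> (t \<otimes> x))" using x e by (simp add: bd_def)
      then have "inv h <# A \<in> \<S>" using iA ht(2) by (auto simp: \<S>_def)
      moreover have "h <# (inv h <# A) = A" using c AG by simp
      ultimately have "A \<in> \<F>" using ht(1) unfolding \<F>_def by force
      then show False using A(2) by simp
    qed
  qed
  \<comment> \<open>Outside the finite family \<open>\<F>\<close> membership does not depend on h,
    so \<open>\<pi> (h \<otimes> x)\<close> is determined by a subset of
    \<open>\<F>\<close>.\<close>
  have "\<pi> (h \<otimes> x) = {A \<in> \<F> \<inter> \<A>. h \<otimes> x \<in> A} \<union> {A \<in> \<A> - \<F>. x \<in> A}" if "h \<in> H" for h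
    using const[OF _ _ that] x by (auto simp: \<pi>_def)
  then have "\<pi> ` (\<lambda>h. h \<otimes> x) ` H \<subseteq> (\<lambda>Q. Q \<union> {A \<in> \<A> - \<F>. x \<in> A}) ` Pow (\<F> \<inter> \<A>)" by blast
  then show ?thesis using finF by (meson finite_Int finite_Pow_iff finite_surj)
qed

lemma finite_\<pi>_image:
  assumes "fin_over H P"
  shows "finite (\<pi> ` P)"
proof -
  obtain F where F: "finite F" "F \<subseteq> carrier G" "P \<subseteq> H <#> F" using assms by (rule fin_overE)
  have "\<pi> ` P \<subseteq> (\<Union>f\<in>F. \<pi> ` (\<lambda>h. h \<otimes> f) ` H)" using F(3) by (fastforce simp: set_mult_def)
  moreover have "finite (\<Union>f\<in>F. \<pi> ` (\<lambda>h. h \<otimes> f) ` H)" using F finite_orbit_image by (intro finite_UN_I) auto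
  ultimately show ?thesis by (rule finite_subset)
qed

lemma \<pi>_walk:
  assumes "g \<in> generate G S" "x \<in> carrier G"
  shows "(\<pi> x, \<pi> (x \<otimes> g)) \<in> E\<^sup>*"
  using assms
proof (induction arbitrary: x rule: generate.induct)
  case (incl s)
  then show ?case by (intro r_into_rtrancl) (auto simp: E_def S'_def)
next
  case (inv s)
  then show ?case by (intro r_into_rtrancl) (auto simp: E_def S'_def)
next
  case (eng g h)
  have "g \<in> carrier G" "h \<in> carrier G" using eng.hyps generate_in_carrier[OF S(2)] by auto
  then show ?case using eng.IH(1)[of x] eng.IH(2)[of "x \<otimes> g"] eng.prems by (simp add: m_assoc)
qed simp

lemma E_symD: "(p, q) \<in> E \<Longrightarrow> (q, p) \<in> E"
proof -
  assume "(p, q) \<in> E"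
  then obtain x s where xs: "x \<in> carrier G" "s \<in> S'" "p = \<pi> x" "q = \<pi> (x \<otimes> s)" by (auto simp: E_def)
  then have "x \<otimes> s \<otimes> inv s = x" using S'G by (simp add: m_assoc)
  then have "p = \<pi> (x \<otimes> s \<otimes> inv s)" using xs by simp
  then show "(q, p) \<in> E" using xs S'G S'_inv unfolding E_def by blast
qed

sublocale dual: cut_graph V E I
proof
  show "E \<subseteq> V \<times> V" using S'G by (auto simp: E_def V_def)
  show "sym E" using E_symD by (auto simp: sym_def)
  show "(p, q) \<in> E\<^sup>*" if pq: "p \<in> V" "q \<in> V" for p q
  proof -
    obtain x y where xy: "x \<in> carrier G" "y \<in> carrier G" "p = \<pi> x" "q = \<pi> y" using pq by (auto simp: V_def)
    then have "(\<pi> x, \<pi> (x \<otimes> (inv x \<otimes> y))) \<in> E\<^sup>*" using S(3) by (intro \<pi>_walk) auto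
    then show ?thesis using xy by (simp flip: m_assoc)
  qed
  show "I {}" by (simp add: I_def fin_over_empty)
  show "I U" if "I W" "U \<subseteq> W" for U W
    using that(1) unfolding I_def by (rule fin_over_subset) (use that(2) in auto)
  show "I (U \<union> W)" if "I U" "I W" for U W
  proof -
    have "{x \<in> carrier G. \<pi> x \<in> U \<union> W} = {x \<in> carrier G. \<pi> x \<in> U} \<union> {x \<in> carrier G. \<pi> x \<in> W}" by auto
    then show ?thesis using that fin_over_Un unfolding I_def by simp
  qed
qed

lemma \<pi>_lcos:
  assumes c: "c \<in> C" and x: "x \<in> carrier G"
  shows "\<pi> (c \<otimes> x) = \<phi> c (\<pi> x)"
proof -
  have cG: "c \<in> carrier G" "inv c \<in> C" using c CG comm_inv by auto
  show ?thesis
  proof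
    show "\<phi> c (\<pi> x) \<subseteq> \<pi> (c \<otimes> x)" using \<A>_lcos[OF c] lcosI by (auto simp: \<phi>_def \<pi>_def)
    show "\<pi> (c \<otimes> x) \<subseteq> \<phi> c (\<pi> x)"
    proof
      fix A assume "A \<in> \<pi> (c \<otimes> x)"
      then have A: "A \<in> \<A>" "c \<otimes> x \<in> A" "A \<subseteq> carrier G" using \<A>G by (auto simp: \<pi>_def)
      have "x \<in> inv c <# A" using lcos_mem[of "inv c" A x] A cG x by simp
      then have "inv c <# A \<in> \<pi> x" using \<A>_lcos[OF cG(2) A(1)] by (simp add: \<pi>_def)
      moreover have "A = c <# (inv c <# A)" using cG A by simp
      ultimately show "A \<in> \<phi> c (\<pi> x)" unfolding \<phi>_def by blast
    qed
  qed
qed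

lemma \<phi>_V:
  assumes c: "c \<in> C" and p: "p \<in> V"
  shows "\<phi> c p \<in> V" "\<phi> (inv c) (\<phi> c p) = p" "\<phi> c (\<phi> (inv c) p) = p"
proof -
  obtain x where x: "x \<in> carrier G" "p = \<pi> x" using p by (auto simp: V_def)
  have cG: "c \<in> carrier G" "inv c \<in> C" using c CG comm_inv by auto
  show "\<phi> c p \<in> V" using x cG \<pi>_lcos[OF c x(1), symmetric] by (simp add: V_def)
  show "\<phi> (inv c) (\<phi> c p) = p"
    using \<pi>_lcos[OF cG(2), of "c \<otimes> x"] \<pi>_lcos[OF c x(1)] x cG by (simp flip: m_assoc)
  show "\<phi> c (\<phi> (inv c) p) = p"
    using \<pi>_lcos[OF c, of "inv c \<otimes> x"] \<pi>_lcos[OF cG(2) x(1)] x cG by (simp flip: m_assoc)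
qed

lemma \<phi>_E:
  assumes c: "c \<in> C" and pq: "(p, q) \<in> E"
  shows "(\<phi> c p, \<phi> c q) \<in> E"
proof -
  obtain x s where xs: "x \<in> carrier G" "s \<in> S'" "p = \<pi> x" "q = \<pi> (x \<otimes> s)" using pq by (auto simp: E_def)
  have cG: "c \<in> carrier G" using c CG by auto
  have "\<phi> c p = \<pi> (c \<otimes> x)" "\<phi> c q = \<pi> (c \<otimes> x \<otimes> s)"
    using xs S'G cG \<pi>_lcos[OF c] by (simp_all add: m_assoc)
  then show ?thesis using xs cG unfolding E_def by blast
qed

lemma preimage_\<phi>:
  assumes c: "c \<in> C" and U: "U \<subseteq> V"
  shows "{x \<in> carrier G. \<pi> x \<in> \<phi> c ` U} = c <# {x \<in> carrier G. \<pi> x \<in> U}"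
proof -
  have cG: "c \<in> carrier G" "inv c \<in> C" using c CG comm_inv by auto
  have "\<pi> x \<in> \<phi> c ` U \<longleftrightarrow> \<pi> (inv c \<otimes> x) \<in> U" if x: "x \<in> carrier G" for x
  proof -
    have "\<pi> x \<in> V" using x by (simp add: V_def)
    then have "\<phi> c (\<phi> (inv c) (\<pi> x)) = \<pi> x" by (rule \<phi>_V(3)[OF c])
    moreover have "\<phi> (inv c) (\<phi> c p) = p" if "p \<in> U" for p using \<phi>_V(2)[OF c] U that by blast
    ultimately have "\<pi> x \<in> \<phi> c ` U \<longleftrightarrow> \<phi> (inv c) (\<pi> x) \<in> U" by force
    then show ?thesis using \<pi>_lcos[OF cG(2) x] by simp
  qed
  then have "x \<in> {x \<in> carrier G. \<pi> x \<in> \<phi> c ` U} \<longleftrightarrow> x \<in> c <# {x \<in> carrier G. \<pi> x \<in> U}" for x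
    using lcos_mem[OF cG(1), of "{x \<in> carrier G. \<pi> x \<in> U}" x] cG by auto
  then show ?thesis by blast
qed

lemma \<phi>_aut:
  assumes c: "c \<in> C"
  shows "dual.cut_aut (\<phi> c)"
  unfolding dual.cut_aut_def
proof (intro conjI ballI allI impI)
  have ic: "inv c \<in> C" "inv (inv c) = c" using c comm_inv CG by auto
  show "bij_betw (\<phi> c) V V"
    by (rule bij_betw_byWitness[where f' = "\<phi> (inv c)"]) (use \<phi>_V[OF c] \<phi>_V(1)[OF ic(1)] in auto)
  show "(p, q) \<in> E \<longleftrightarrow> (\<phi> c p, \<phi> c q) \<in> E" if "p \<in> V" "q \<in> V" for p q
    using \<phi>_E[OF c, of p q] \<phi>_E[OF ic(1), of "\<phi> c p" "\<phi> c q"] \<phi>_V(2)[OF c] that by auto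
  show "I (\<phi> c ` U) \<longleftrightarrow> I U" if U: "U \<subseteq> V" for U
  proof -
    let ?P = "{x \<in> carrier G. \<pi> x \<in> U}"
    have "inv c <# (c <# ?P) = ?P" using c CG by (intro lcos_inv_cancel) auto
    then have "fin_over H (c <# ?P) \<longleftrightarrow> fin_over H ?P"
      using fin_over_commensurator[OF HG c, of ?P] fin_over_commensurator[OF HG ic(1), of "c <# ?P"] by auto
    then show ?thesis unfolding I_def preimage_\<phi>[OF c U] .
  qed
qed

text \<open>X is a union of classes, and its H-finite boundary has finite image in the dual graph by
  \<open>finite_\<pi>_image\<close>.\<close>

lemma ex_cut: "\<exists>U. dual.cut U"
proof -
  define U where "U = {p \<in> V. X \<in> p}"
  have mem: "\<pi> x \<in> U \<longleftrightarrow> x \<in> X" if "x \<in> carrier G" for x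
    using that X_\<A> by (auto simp: U_def V_def \<pi>_def)
  have "outb E U \<subseteq> (\<Union>s\<in>S'. (\<pi> ` bd X s) \<times> (\<pi> ` {y \<in> carrier G. y \<otimes> inv s \<in> bd X s}))"
  proof
    fix e assume "e \<in> outb E U"
    then obtain x s where xs: "x \<in> carrier G" "s \<in> S'" "e = (\<pi> x, \<pi> (x \<otimes> s))" "\<pi> x \<in> U" "\<pi> (x \<otimes> s) \<notin> U"
      by (auto simp: outb_def E_def)
    have sG: "s \<in> carrier G" using xs S'G by simp
    have "x \<in> bd X s" using xs mem sG by (simp add: bd_def)
    moreover have "x \<otimes> s \<otimes> inv s = x" using xs sG by (simp add: m_assoc)
    ultimately have "x \<otimes> s \<in> {y \<in> carrier G. y \<otimes> inv s \<in> bd X s}" using xs sG by simp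
    then show "e \<in> (\<Union>s\<in>S'. (\<pi> ` bd X s) \<times> (\<pi> ` {y \<in> carrier G. y \<otimes> inv s \<in> bd X s}))"
      using xs(2,3) \<open>x \<in> bd X s\<close> by blast
  qed
  moreover have "finite (\<Union>s\<in>S'. (\<pi> ` bd X s) \<times> (\<pi> ` {y \<in> carrier G. y \<otimes> inv s \<in> bd X s}))"
    using finite_S' S'G bdX HG by (intro finite_UN_I finite_cartesian_product finite_\<pi>_image fin_over_rmult) auto
  ultimately have "finite (outb E U)" by (rule finite_subset)
  moreover have "{x \<in> carrier G. \<pi> x \<in> U} = X" using mem X by auto
  moreover have "{x \<in> carrier G. \<pi> x \<in> V - U} = carrier G - X" using mem by (auto simp: V_def)
  moreover have "U \<subseteq> V" by (auto simp: U_def)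
  ultimately have "dual.cut U" using niX by (simp add: dual.cut_def I_def)
  then show ?thesis by blast
qed

text \<open>The way back from finite edge sets to H-finite boundaries: distinct vertices differ in
  some translate A, and every point over the edge lies on the boundary of A. A loop provides no such
  A, hence \<open>p \<noteq> q\<close>.\<close>

lemma fin_over_edge_fibre:
  assumes "p \<noteq> q" "s \<in> carrier G"
  shows "fin_over H {x \<in> carrier G. \<pi> x = p \<and> \<pi> (x \<otimes> s) = q}"
proof (cases "{x \<in> carrier G. \<pi> x = p \<and> \<pi> (x \<otimes> s) = q} = {}")
  case False
  then have "p \<subseteq> \<A>" "q \<subseteq> \<A>" by (auto simp: \<pi>_def)
  then obtain A where A: "A \<in> \<A>" "(A \<in> p) \<noteq> (A \<in> q)" using assms(1) by blast
  have "{x \<in> carrier G. \<pi> x = p \<and> \<pi> (x \<otimes> s) = q} \<subseteq> bd A s" using A by (auto simp: bd_def \<pi>_def)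
  then show ?thesis using bd_\<A>[OF A(1) assms(2)] fin_over_subset by blast
next
  case True
  show ?thesis unfolding True by (rule fin_over_empty)
qed

lemma ex_nested_set: "\<exists>Y. nested_set G S H T Y"
proof -
  obtain U where U: "dual.cut U" and nest: "\<And>f. dual.cut_aut f \<Longrightarrow> nested_in V U (f ` U)"
    using ex_cut dual.invariant_nested_cut by metis
  have UV: "U \<subseteq> V" and finU: "finite (outb E U)" and niU: "\<not> I U" "\<not> I (V - U)"
    using U by (auto simp: dual.cut_def)
  define Y where "Y = {x \<in> carrier G. \<pi> x \<in> U}"
  have YG: "Y \<subseteq> carrier G" by (auto simp: Y_def)
  have lY: "c <# Y = {x \<in> carrier G. \<pi> x \<in> \<phi> c ` U}" if "c \<in> C" for c
    using preimage_\<phi>[OF that UV] by (simp add: Y_def)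
  have compl: "carrier G - Y = {x \<in> carrier G. \<pi> x \<in> V - U}" by (auto simp: Y_def V_def)
  have bd_s: "fin_over H (bd Y s)" if s: "s \<in> S" for s
  proof -
    have sG: "s \<in> carrier G" using s S by auto
    let ?f = "\<lambda>(p, q). {x \<in> carrier G. \<pi> x = p \<and> \<pi> (x \<otimes> s) = q} \<union> {x \<in> carrier G. \<pi> x = q \<and> \<pi> (x \<otimes> s) = p}"
    have "bd Y s \<subseteq> (\<Union>e\<in>outb E U. ?f e)"
    proof
      fix x assume x: "x \<in> bd Y s"
      then have xG: "x \<in> carrier G" "(\<pi> x \<in> U) \<noteq> (\<pi> (x \<otimes> s) \<in> U)" using sG by (auto simp: bd_def Y_def)
      have "(\<pi> x, \<pi> (x \<otimes> s)) \<in> E" using xG s by (auto simp: E_def S'_def)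
      then have "(\<pi> x, \<pi> (x \<otimes> s)) \<in> outb E U \<or> (\<pi> (x \<otimes> s), \<pi> x) \<in> outb E U"
        using xG(2) E_symD by (auto simp: outb_def)
      then show "x \<in> (\<Union>e\<in>outb E U. ?f e)"
      proof
        assume "(\<pi> x, \<pi> (x \<otimes> s)) \<in> outb E U"
        then show ?thesis using xG(1) by (intro UN_I) auto
      next
        assume "(\<pi> (x \<otimes> s), \<pi> x) \<in> outb E U"
        then show ?thesis using xG(1) by (intro UN_I) auto
      qed
    qed
    moreover have "fin_over H (\<Union>e\<in>outb E U. ?f e)"
    proof (rule fin_over_UN[OF finU])
      fix e assume "e \<in> outb E U"
      then obtain p q where "e = (p, q)" "p \<noteq> q" by (auto simp: outb_def)
      then show "fin_over H (?f e)" using fin_over_edge_fibre sG by (auto intro!: fin_over_Un)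
    qed
    ultimately show ?thesis using fin_over_subset by blast
  qed
  \<comment> \<open>These cuts are determined by their boundaries, and under H the ends of the
    boundary edges stay in a finite set of vertices by \<open>finite_orbit_image\<close>.\<close>
  have "finite ((\<lambda>h. \<phi> h ` U) ` H)"
  proof (rule finite_imageD)
    define D where "D = (\<Union>p\<in>Field (outb E U). (\<lambda>h. \<phi> h p) ` H)"
    have FV: "Field (outb E U) \<subseteq> V" using dual.E_sub by (auto simp: Field_def outb_def)
    have "finite ((\<lambda>h. \<phi> h p) ` H)" if p: "p \<in> Field (outb E U)" for p
    proof -
      obtain x where x: "x \<in> carrier G" "p = \<pi> x" using p FV by (auto simp: V_def)
      have "\<phi> h p = \<pi> (h \<otimes> x)" if "h \<in> H" for h using \<pi>_lcos[OF _ x(1)] that HC x by auto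
      then have "(\<lambda>h. \<phi> h p) ` H = \<pi> ` (\<lambda>h. h \<otimes> x) ` H" by (simp add: image_image)
      then show ?thesis using finite_orbit_image[OF x(1)] by simp
    qed
    then have finD: "finite D" unfolding D_def using finU by (intro finite_UN_I finite_Field)
    have "outb E (\<phi> h ` U) \<subseteq> D \<times> D" if h: "h \<in> H" for h
    proof -
      have "h \<in> C" using h HC by auto
      have "(\<phi> h a, \<phi> h b) \<in> D \<times> D" if "(a, b) \<in> outb E U" for a b
        using that h unfolding D_def Field_def by blast
      then show ?thesis unfolding dual.outb_image[OF \<phi>_aut[OF \<open>h \<in> C\<close>] UV] by auto
    qed
    then have "outb E ` (\<lambda>h. \<phi> h ` U) ` H \<subseteq> Pow (D \<times> D)" by blast
    then show "finite (outb E ` (\<lambda>h. \<phi> h ` U) ` H)" using finD by (meson finite_Pow_iff finite_SigmaI finite_subset)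
    show "inj_on (outb E) ((\<lambda>h. \<phi> h ` U) ` H)"
    proof (rule inj_onI)
      fix A B assume AB: "A \<in> (\<lambda>h. \<phi> h ` U) ` H" "B \<in> (\<lambda>h. \<phi> h ` U) ` H" "outb E A = outb E B"
      then obtain h where h: "h \<in> H" "A = \<phi> h ` U" by blast
      have sub: "A \<subseteq> V" "B \<subseteq> V" using AB(1,2) \<phi>_V(1) UV HC by blast+
      obtain p q where "p \<in> U" "q \<in> V - U" using niU dual.I_empty by (metis ex_in_conv)
      then have "outb E U \<noteq> {}" using dual.outb_nonempty UV by blast
      then have "outb E A \<noteq> {}" using dual.outb_image[OF \<phi>_aut UV, of h] h HC by auto
      then show "A = B" using dual.outb_eq_imp_eq sub AB(3) by blast
    qed
  qed
  then have "finite ((\<lambda>P. {x \<in> carrier G. \<pi> x \<in> P}) ` (\<lambda>h. \<phi> h ` U) ` H)" by (rule finite_imageI)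
  moreover have "(\<lambda>h. h <# Y) ` H = (\<lambda>P. {x \<in> carrier G. \<pi> x \<in> P}) ` (\<lambda>h. \<phi> h ` U) ` H"
    unfolding image_image using lY HC by (intro image_cong) auto
  ultimately have orb: "finite ((\<lambda>h. h <# Y) ` H)" by simp
  have "nested_set G S H T Y"
  proof (intro nested_set.intro nested_set_axioms.intro)
    show "group G" by (rule group_axioms)
    show "finite S" "S \<subseteq> carrier G" "generate G S = carrier G" "subgroup H G" "finite T" "T \<subseteq> carrier G"
      "H = generate G T" by (rule S H T)+
    show "inv g \<in> C" if "g \<in> C" for g using that by (rule comm_inv)
    show "ends_of_pair G S K = 1" if "subgroup K G" "K \<subseteq> H" "\<not> fin_over K H" for K using that by (rule ends)
    show "Y \<subseteq> carrier G" by (rule YG)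
    show "fin_over H (bd Y u)" if "u \<in> carrier G" for u
      using bd_generate[OF HG S(2) bd_s] that S(3) by simp
    show "\<not> fin_over H Y" using niU(1) by (simp add: I_def Y_def)
    show "\<not> fin_over H (carrier G - Y)" using niU(2) by (simp add: I_def compl)
    show "finite ((\<lambda>h. h <# Y) ` H)" by (rule orb)
    show "nested_in (carrier G) Y (c <# Y)" if c: "c \<in> C" for c
    proof -
      consider "U \<subseteq> \<phi> c ` U" | "\<phi> c ` U \<subseteq> U" | "U \<inter> \<phi> c ` U = {}" | "U \<union> \<phi> c ` U = V"
        using nest[OF \<phi>_aut[OF c]] by (auto simp: nested_in_def)
      then show ?thesis
      proof cases
        case 4
        have "Y \<union> (c <# Y) = carrier G"
        proof
          show "carrier G \<subseteq> Y \<union> (c <# Y)"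
          proof
            fix x assume x: "x \<in> carrier G"
            then have "\<pi> x \<in> U \<union> \<phi> c ` U" unfolding 4 V_def by simp
            then show "x \<in> Y \<union> (c <# Y)" using x unfolding lY[OF c] by (auto simp: Y_def)
          qed
        qed (use YG lY[OF c] in auto)
        then show ?thesis by (simp add: nested_in_def)
      qed (unfold nested_in_def lY[OF c], auto simp: Y_def)
    qed
    show "g <# H \<subseteq> Y \<or> g <# H \<subseteq> carrier G - Y" if g: "g \<in> carrier G - C" for g
    proof -
      \<comment> \<open>Good position passes from X to each translate cX because
        \<open>inv c \<otimes> g\<close> is again outside C. So gH lies in one fibre, and Y, a union
        of fibres, cannot separate its points.\<close>
      have "\<pi> (g \<otimes> h) = \<pi> g" if h: "h \<in> H" for h
      proof -
        have hG: "h \<in> carrier G" using h HG by auto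
        have "g \<otimes> h \<in> A \<longleftrightarrow> g \<in> A" if A: "A \<in> \<A>" for A
        proof -
          obtain c where c: "c \<in> C" "A = c <# X" using A by (auto simp: \<A>_def)
          have cG: "c \<in> carrier G" "inv c \<in> C" using c CG comm_inv by auto
          have "inv c \<otimes> g \<in> carrier G - C" using g cG C_mult_iff(1)[OF cG(2), of g] by simp
          then have s: "(inv c \<otimes> g) <# H \<subseteq> X \<or> (inv c \<otimes> g) <# H \<subseteq> carrier G - X" by (rule sep)
          have "inv c \<otimes> g \<otimes> h \<in> (inv c \<otimes> g) <# H" using h by (rule lcosI)
          moreover have "inv c \<otimes> g \<otimes> \<one> \<in> (inv c \<otimes> g) <# H" using subgroup.one_closed[OF H] by (rule lcosI)
          ultimately have "inv c \<otimes> g \<otimes> h \<in> X \<longleftrightarrow> inv c \<otimes> g \<otimes> \<one> \<in> X" using s by blast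
          then show ?thesis using c(2) lcos_mem[OF cG(1) X] g hG cG by (simp add: m_assoc)
        qed
        then show ?thesis by (auto simp: \<pi>_def)
      qed
      then have "\<forall>x\<in>g <# H. \<pi> x = \<pi> g" by (auto simp: l_coset_def)
      moreover have "g <# H \<subseteq> carrier G" using g HG by (simp add: lcos_closed)
      ultimately show ?thesis unfolding Y_def by (cases "\<pi> g \<in> U") auto
    qed
  qed
  then show ?thesis by blast
qed

end

section \<open>From strong crossing to cosets almost on one side\<close>

section \<open>Vanishing strong self-intersection\<close>

context group
begin

text \<open>For x in \<open>bd X u\<close> the coset of \<open>x \<otimes> u\<close> lies in the
  symmetric difference of the image of X and its right translate by u, because H-invariance makes
  membership in X a property of cosets.\<close>

lemma H_almost_invariantD:
  assumes H: "subgroup H G" and X: "H_almost_invariant G H X"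
  shows "X \<subseteq> carrier G" "h \<in> H \<Longrightarrow> h <# X = X" "u \<in> carrier G \<Longrightarrow> fin_over H (bd X u)"
proof -
  show XG: "X \<subseteq> carrier G" and inv: "h \<in> H \<Longrightarrow> h <# X = X" for h
    using X by (auto simp: H_almost_invariant_def)
  have HG: "H \<subseteq> carrier G" using H by (rule subgroup.subset)
  assume u: "u \<in> carrier G"
  let ?P = "coset_image G H X" and ?r = "\<lambda>C. C #> u"
  have fin: "finite ((?r ` ?P - ?P) \<union> (?P - ?r ` ?P))"
    using X u by (auto simp: H_almost_invariant_def almost_invariant_def almost_equal_def)
  have mem: "x \<in> X" if "x \<in> carrier G" "y \<in> X" "H #> x = H #> y" for x y
  proof -
    have "x \<in> H #> y" using rcos_self[OF that(1) H] that(3) by simp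
    then obtain h where "h \<in> H" "x = h \<otimes> y" by (auto simp: r_coset_def)
    then show ?thesis using lcosI[OF that(2), of h] inv by simp
  qed
  have r: "?r (H #> x) = H #> (x \<otimes> u)" if "x \<in> carrier G" for x
    using that u HG by (simp add: coset_mult_assoc)
  have cancel: "H #> x = H #> y" if "x \<in> carrier G" "y \<in> carrier G" "H #> (x \<otimes> u) = H #> (y \<otimes> u)" for x y
  proof -
    have "H #> x = H #> (x \<otimes> u) #> inv u" "H #> y = H #> (y \<otimes> u) #> inv u"
      using that(1,2) u HG by (simp_all add: coset_mult_assoc m_assoc)
    then show ?thesis using that(3) by simp
  qed
  have "(\<lambda>x. H #> (x \<otimes> u)) ` bd X u \<subseteq> (?r ` ?P - ?P) \<union> (?P - ?r ` ?P)"
  proof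
    fix C assume "C \<in> (\<lambda>x. H #> (x \<otimes> u)) ` bd X u"
    then obtain x where x: "x \<in> carrier G" "(x \<in> X) \<noteq> (x \<otimes> u \<in> X)" "C = H #> (x \<otimes> u)" by (auto simp: bd_def)
    show "C \<in> (?r ` ?P - ?P) \<union> (?P - ?r ` ?P)"
    proof (cases "x \<in> X")
      case True
      then have "C \<in> ?r ` ?P" using r[OF x(1)] x(3) by (force simp: coset_image_def)
      moreover have "C \<notin> ?P" using mem[of "x \<otimes> u"] x True u by (auto simp: coset_image_def)
      ultimately show ?thesis by blast
    next
      case False
      then have "C \<in> ?P" using x by (auto simp: coset_image_def)
      moreover have "C \<notin> ?r ` ?P"
      proof
        assume "C \<in> ?r ` ?P"
        then obtain y where y: "y \<in> X" "C = ?r (H #> y)" by (auto simp: coset_image_def)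
        then have "y \<in> carrier G" using XG by auto
        then have "H #> x = H #> y" using cancel[of x y] x y r by simp
        then show False using mem[OF x(1) y(1)] False by simp
      qed
      ultimately show ?thesis by blast
    qed
  qed
  then have "finite ((\<lambda>x. H #> (x \<otimes> u)) ` bd X u)" using fin by (rule finite_subset)
  then have "finite (coset_image G H ((\<lambda>x. x \<otimes> u) ` bd X u))" by (simp add: coset_image_def image_image)
  moreover have "(\<lambda>x. x \<otimes> u) ` bd X u \<subseteq> carrier G" using u by (auto simp: bd_def)
  ultimately have "fin_over H ((\<lambda>x. x \<otimes> u) ` bd X u)" using fin_over_coset_image[OF H] by blast
  then have "fin_over H {x \<in> carrier G. x \<otimes> u \<in> (\<lambda>x. x \<otimes> u) ` bd X u}" using HG u by (rule fin_over_rmult)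
  moreover have "bd X u \<subseteq> {x \<in> carrier G. x \<otimes> u \<in> (\<lambda>x. x \<otimes> u) ` bd X u}" by (auto simp: bd_def)
  ultimately show "fin_over H (bd X u)" by (rule fin_over_subset)
qed

lemma ex_bd_generator:
  assumes S: "S \<subseteq> carrier G" "generate G S = carrier G"
    and X: "X \<subseteq> carrier G" "X \<noteq> {}" "X \<noteq> carrier G"
  shows "\<exists>s\<in>S. \<exists>x. x \<in> bd X s"
proof (rule ccontr)
  assume "\<not> ?thesis"
  then have e: "bd X s = {}" if "s \<in> S" for s using that by auto
  have b: "bd X g = {}" if "g \<in> carrier G" for g
  proof -
    have "fin_over {} (bd X g)" using bd_generate[of "{}" S X g] e that S fin_over_empty by auto
    then show ?thesis by (auto simp: fin_over_def set_mult_def)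
  qed
  obtain x y where xy: "x \<in> X" "y \<in> carrier G" "y \<notin> X" using X by blast
  then have x: "x \<in> carrier G" using X by auto
  then have "x \<otimes> (inv x \<otimes> y) = y" using xy by (simp flip: m_assoc)
  then have "x \<in> bd X (inv x \<otimes> y)" using xy x by (simp add: bd_def)
  then show False using b[of "inv x \<otimes> y"] xy x by simp
qed

text \<open>A fixed boundary point x of X puts all points \<open>g h x\<close> into the coboundary
  of gX. Right multiplication by x changes membership in X only on an H-finite set, so smallness
  passes from the coboundary to gH.\<close>

lemma not_crosses_stronglyD:
  assumes S: "S \<subseteq> carrier G" "generate G S = carrier G" and H: "subgroup H G"
    and X: "H_almost_invariant G H X" "X \<noteq> {}" "X \<noteq> carrier G"
    and g: "g \<in> carrier G" and nc: "\<not> crosses_strongly G S H X g"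
  shows "fin_over H ((g <# H) \<inter> X) \<or> fin_over H ((g <# H) - X)"
proof -
  have HG: "H \<subseteq> carrier G" using H by (rule subgroup.subset)
  note XD = H_almost_invariantD[OF H X(1)]
  define D where "D = coboundary_verts (cayley_graph G S) (g <# X)"
  obtain s x where sx: "s \<in> S" "x \<in> bd X s" using ex_bd_generator[OF S XD(1) X(2,3)] by blast
  have c: "s \<in> carrier G" "x \<in> carrier G" using sx S by (auto simp: bd_def)
  have DG: "D \<subseteq> carrier G"
    using S(1) by (auto simp: D_def coboundary_verts_def coboundary_def cayley_graph_def)
  have gh: "g \<otimes> h \<otimes> x \<in> D" if h: "h \<in> H" for h
  proof -
    have hG: "h \<in> carrier G" using h HG by auto
    have st: "h \<in> stab X" using XD(2)[OF h] hG by (simp add: stab_def)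
    have e: "inv g \<otimes> (g \<otimes> h \<otimes> x) = h \<otimes> x" "inv g \<otimes> (g \<otimes> h \<otimes> x \<otimes> s) = h \<otimes> (x \<otimes> s)"
      using g hG c by (simp_all flip: m_assoc)
    have "(g \<otimes> h \<otimes> x \<in> g <# X) \<noteq> (g \<otimes> h \<otimes> x \<otimes> s \<in> g <# X)"
      using sx(2) c hG g e stab_mult[OF XD(1) st, of x] stab_mult[OF XD(1) st, of "x \<otimes> s"]
      by (simp add: lcos_mem[OF g XD(1)] bd_def)
    then have "(g \<otimes> h \<otimes> x, s) \<in> coboundary (cayley_graph G S) (g <# X)"
      using sx(1) g hG c by (simp add: coboundary_def cayley_graph_def)
    then show ?thesis unfolding D_def coboundary_verts_def by (force simp: cayley_graph_def)
  qed
  have cov: "fin_over H ((g <# H) \<inter> Z)"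
    if Z: "fin_over H (D \<inter> Z)" "fin_over H (bd Z x)" for Z
  proof -
    have "(g <# H) \<inter> Z \<subseteq> {z \<in> carrier G. z \<otimes> x \<in> D \<inter> Z} \<union> bd Z x"
      using gh g HG by (auto simp: l_coset_def bd_def)
    then show ?thesis using fin_over_Un[OF fin_over_rmult[OF Z(1) HG c(2)] Z(2)] fin_over_subset by blast
  qed
  have "finite (coset_image G H (D \<inter> X)) \<or> finite (coset_image G H (D \<inter> (carrier G - X)))"
    using nc by (simp add: crosses_strongly_def D_def Let_def)
  then have "fin_over H (D \<inter> X) \<or> fin_over H (D \<inter> (carrier G - X))"
    using fin_over_coset_image[OF H, of "D \<inter> X"] fin_over_coset_image[OF H, of "D \<inter> (carrier G - X)"] DG by blast
  then have "fin_over H ((g <# H) \<inter> X) \<or> fin_over H ((g <# H) \<inter> (carrier G - X))"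
    using cov[of X] cov[of "carrier G - X"] XD(3)[OF c(2)] bd_compl[OF c(2)] by auto
  moreover have "(g <# H) \<inter> (carrier G - X) = (g <# H) - X" using lcos_closed[OF g HG] by blast
  ultimately show ?thesis by simp
qed

lemma ecard_eq_0: "ecard A = 0 \<longleftrightarrow> A = {}"
  by (auto simp: ecard_def zero_enat_def)

theorem splits_over_commensurable:
  assumes S: "finite S" "S \<subseteq> carrier G" "generate G S = carrier G"
    and H: "subgroup H G" and fg: "fin_gen_subgroup G H"
    and ends1: "\<And>K L. subgroup K G \<Longrightarrow> subgroup L G \<Longrightarrow> L \<subseteq> H \<Longrightarrow> \<not> finite_index G L H \<Longrightarrow>
           commensurable G K L \<Longrightarrow> ends_of_pair G S K = 1"
    and X: "H_almost_invariant G H X" "nontrivial_over G H X"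
    and si: "strong_self_intersection G S H X = 0"
  shows "\<exists>L. splits_over G L \<and> commensurable G L H"
proof -
  have HG: "H \<subseteq> carrier G" using H by (rule subgroup.subset)
  obtain T where T: "finite T" "T \<subseteq> carrier G" "H = generate G T"
    using fg by (auto simp: fin_gen_subgroup_def)
  note XD = H_almost_invariantD[OF H X(1)]
  have ni: "\<not> fin_over H X" "\<not> fin_over H (carrier G - X)"
    using X(2) fin_over_coset_image[OF H] XD(1) by (auto simp: nontrivial_over_def)
  then have ne: "X \<noteq> {}" "X \<noteq> carrier G" using fin_over_empty by auto
  have comm_refl: "commensurable G K K" if "subgroup K G" for K
    using finite_index_iff[OF that] fin_over_refl subgroup.subset[OF that] by (simp add: commensurable_def)
  have ends: "ends_of_pair G S K = 1" if "subgroup K G" "K \<subseteq> H" "\<not> fin_over K H" for K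
    using ends1[OF that(1,1,2) _ comm_refl[OF that(1)]] finite_index_iff[OF that(1) HG] that(3) by simp
  \<comment> \<open>If only g were in the commensurator, \<open>gHg^-1\<close> would meet H in a
    subgroup of finite index in \<open>gHg^-1\<close> but of infinite index in H. It would then have
    one end in G by hypothesis, against the nontrivial almost invariant set gX.\<close>
  have comm_inv: "inv g \<in> commensurator H" if gC: "g \<in> commensurator H" for g
  proof (rule ccontr)
    assume ninv: "inv g \<notin> commensurator H"
    have g: "g \<in> carrier G" using gC commensurator_closed by auto
    let ?K = "conj_set g H"
    have K: "subgroup ?K G" using g H by (rule subgroup_conj_set)
    have KG: "?K \<subseteq> carrier G" using K by (rule subgroup.subset)
    have L: "subgroup (H \<inter> ?K) G" using H K by (rule subgroups_Inter_pair)
    have LG: "H \<inter> ?K \<subseteq> carrier G" using HG by auto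
    have "?K \<subseteq> {x \<in> carrier G. x \<otimes> g \<in> g <# H}"
    proof
      fix x assume "x \<in> ?K"
      then have "x \<in> carrier G" "inv g \<otimes> x \<otimes> g \<in> H" using conj_set_mem[OF g HG] by auto
      then show "x \<in> {x \<in> carrier G. x \<otimes> g \<in> g <# H}" using g by (simp add: lcos_mem[OF g HG] m_assoc)
    qed
    moreover have "fin_over H {x \<in> carrier G. x \<otimes> g \<in> g <# H}"
      using gC HG g by (intro fin_over_rmult) (auto simp: commensurator_def)
    ultimately have "fin_over H ?K" using fin_over_subset by blast
    then have LK: "fin_over (H \<inter> ?K) ?K" using fin_over_Int[OF H K _ fin_over_refl[OF KG]] by simp
    have "\<not> fin_over (H \<inter> ?K) H"
    proof
      assume "fin_over (H \<inter> ?K) H"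
      then have "fin_over ?K H" using fin_over_mono_left by blast
      then have "fin_over (conj_set (inv g) ?K) (inv g <# H)" using fin_over_lcos g KG by simp
      then have "fin_over H (inv g <# H)" using conj_set_inv[OF g HG] by simp
      then show False using ninv g by (simp add: commensurator_def)
    qed
    then have "\<not> finite_index G (H \<inter> ?K) H" using finite_index_iff[OF L HG] by simp
    moreover have "commensurable G ?K (H \<inter> ?K)"
      using finite_index_iff[OF L KG] finite_index_iff[OF L LG] LK fin_over_refl[OF LG]
      by (simp add: commensurable_def Int_commute Int_left_commute)
    ultimately have "ends_of_pair G S ?K = 1" using ends1[OF K L] by simp
    moreover have "ends_of_pair G S ?K \<noteq> 1"
    proof (rule ends_of_pair_neq_1[OF S K])
      show "g <# X \<subseteq> carrier G" using g XD(1) by (rule lcos_closed)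
      show "k \<otimes> d \<in> g <# X" if k: "k \<in> ?K" and d: "d \<in> g <# X" for k d
      proof -
        obtain h where h: "h \<in> H" "k = g \<otimes> h \<otimes> inv g" using k by (auto simp: conj_set_def)
        obtain x where x: "x \<in> X" "d = g \<otimes> x" using d by (auto simp: l_coset_def)
        have c: "h \<in> carrier G" "x \<in> carrier G" using h x HG XD(1) by auto
        have "inv g \<otimes> (g \<otimes> x) = x" using g c by (simp flip: m_assoc)
        then have "k \<otimes> d = g \<otimes> (h \<otimes> x)" using h x c g by (simp add: m_assoc)
        moreover have "h \<otimes> x \<in> X" using lcosI[OF x(1), of h] XD(2)[OF h(1)] by simp
        ultimately show ?thesis by (simp add: lcosI)
      qed
      show "fin_over ?K (bd (g <# X) s)" if "s \<in> S" for s
        using fin_over_lcos[OF g HG XD(3)[of s]] bd_lcos[OF g XD(1), of s] that S(2) by auto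
      show "\<not> fin_over ?K (g <# X)" "\<not> fin_over ?K (carrier G - (g <# X))"
        using fin_over_lcos_iff[OF g HG] ni XD(1) g by (simp_all flip: lcos_compl)
    qed
    ultimately show False by simp
  qed
  interpret si_zero G S H T
  proof (intro si_zero.intro si_zero_axioms.intro)
    show "group G" by (rule group_axioms)
    show "finite S" "S \<subseteq> carrier G" "generate G S = carrier G" "subgroup H G" "finite T" "T \<subseteq> carrier G"
      "H = generate G T" by (rule S H T)+
    show "inv g \<in> commensurator H" if "g \<in> commensurator H" for g using that by (rule comm_inv)
    show "ends_of_pair G S K = 1" if "subgroup K G" "K \<subseteq> H" "\<not> fin_over K H" for K using that by (rule ends)
  qed
  have "{(H #>\<^bsub>G\<^esub> g) <#>\<^bsub>G\<^esub> H | g. g \<in> carrier G \<and> crosses_strongly G S H X g} = {}"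
    using si by (simp only: strong_self_intersection_def ecard_eq_0)
  then have "\<not> crosses_strongly G S H X g" if "g \<in> carrier G" for g using that by blast
  then have dich: "fin_over H ((g <# H) \<inter> X) \<or> fin_over H ((g <# H) - X)" if "g \<in> carrier G" for g
    using not_crosses_stronglyD[OF S(2,3) H X(1) ne that] that by blast
  have "\<exists>X'. X' \<subseteq> carrier G \<and> (\<forall>h\<in>H. h <# X' = X') \<and> (\<forall>u\<in>carrier G. fin_over H (bd X' u)) \<and>
    \<not> fin_over H X' \<and> \<not> fin_over H (carrier G - X') \<and>
    (\<forall>g\<in>carrier G - C. g <# H \<subseteq> X' \<or> g <# H \<subseteq> carrier G - X')"
    by (rule good_position[OF XD(1) XD(2) XD(3) ni]) (use dich in auto)
  then obtain X' where X': "X' \<subseteq> carrier G" "\<And>h. h \<in> H \<Longrightarrow> h <# X' = X'"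
    "\<And>u. u \<in> carrier G \<Longrightarrow> fin_over H (bd X' u)" "\<not> fin_over H X'" "\<not> fin_over H (carrier G - X')"
    "\<And>g. g \<in> carrier G - C \<Longrightarrow> g <# H \<subseteq> X' \<or> g <# H \<subseteq> carrier G - X'"
    by (elim exE conjE) simp
  interpret good_set G S H T X'
    by (intro good_set.intro good_set_axioms.intro si_zero_axioms X')
  obtain Y where "nested_set G S H T Y" using ex_nested_set by blast
  then have "splits_over G (stab Y) \<and> commensurable G (stab Y) H" by (rule nested_set.splits_over_stab)
  then show ?thesis by blast
qed

end

theorem theorem3p13:
  fixes G :: "('a, 'm) monoid_scheme" and S H X :: "'a set"
  assumes "group G"
    and "finite S" and "S \<subseteq> carrier G" and "generate G S = carrier G"
    and "subgroup H G" and "fin_gen_subgroup G H"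
    and "ends_of_pair G S H > 1"
    and "\<And>K L. subgroup K G \<Longrightarrow> subgroup L G \<Longrightarrow> L \<subseteq> H \<Longrightarrow> \<not> finite_index G L H \<Longrightarrow>
           commensurable G K L \<Longrightarrow> ends_of_pair G S K = 1"
    and "H_almost_invariant G H X" and "nontrivial_over G H X"
    and "strong_self_intersection G S H X = 0"
  shows "\<exists>L. splits_over G L \<and> commensurable G L H"
  using group.splits_over_commensurable[OF assms(1-6) assms(8-11)] .

end
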